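(* Let $p$ be a prime number, let $n\ge 1$, and let $T$ be an $n$-tangle. Let $\psi: Col_p(T)\to \mathbf{Z}_p^{2n}$ be the homomorphism sending a Fox $p$-coloring of $T$ to the induced coloring of the $2n$ boundary points of $T$, and let $\hat\psi : Col_p(T)/\mathbf{Z}_p\to \mathbf{Z}_p^{2n-2}$ be the induced map, where $\mathbf{Z}_p\subset Col_p(T)$ is the subspace of trivial (monochromatic) colorings. Then $\hat\psi(Col_p(T)/\mathbf{Z}_p)$ is a Lagrangian subspace of $\mathbf{Z}_p^{2n-2}$ with respect to the symplectic form $\hat\phi$.
   Context: $\mathbf{Z}_p$ denotes the field with $p$ elements. An $n$-tangle is a 1-manifold properly embedded in a 3-ball, consisting of $n$ arcs and possibly some closed components, with $2n$ fixed boundary points. It is represented by a diagram $T$ in a disk, whose $2n$ endpoints lie on the boundary circle and are numbered $1,\dots,2n$ in cyclic order along the circle. Fox $p$-coloring: an assignment of an element of $\mathbf{Z}_p$ to every arc of the diagram (arcs run from undercrossing to undercrossing or to a boundary point; a closed curve of the diagram with no undercrossing is also an arc) such that at each crossing the sum of the colors of the two undercrossing arcs equals twice the color of the overcrossing arc modulo $p$. The Fox $p$-colorings of $T$ form a $\mathbf{Z}_p$-vector space $Col_p(T)$. Restricting a coloring to the boundary points gives the linear map $\psi: Col_p(T)\to\mathbf{Z}_p^{2n}$. Symplectic space: let $e_1,\dots,e_{2n}$ be the standard basis of $\mathbf{Z}_p^{2n}$ (the colorings of the $2n$ boundary points). Let $\mathbf{Z}_p^{2n-1}\subset\mathbf{Z}_p^{2n}$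 denote the subspace of vectors $\sum a_ie_i$ satisfying the alternating condition $\sum_{i=1}^{2n}(-1)^ia_i=0$. It has basis $f_1,\dots,f_{2n-1}$, where $f_k=e_k+e_{k+1}$. Let $\phi$ be the skew-symmetric bilinear form on $\mathbf{Z}_p^{2n-1}$ given by $\phi(f_i,f_j)=0$ if $|j-i|\ne1$, $\phi(f_i,f_j)=1$ if $j=i+1$, and $\phi(f_i,f_j)=-1$ if $j=i-1$. The vector $e_1+\dots+e_{2n}$ is $\phi$-orthogonal to every vector of $\mathbf{Z}_p^{2n-1}$. Let $\mathbf{Z}_p^{2n-2}$ denote the quotient of $\mathbf{Z}_p^{2n-1}$ by the line spanned by $e_1+\dots+e_{2n}$ (the monochromatic boundary colorings); $\phi$ descends to a symplectic form $\hat\phi$ on $\mathbf{Z}_p^{2n-2}$. For every $n$-tangle $T$ one has $\psi(Col_p(T))\subset\mathbf{Z}_p^{2n-1}$, and the line $\mathbf{Z}_p\subset Col_p(T)$ of trivial (constant) colorings is mapped by $\psi$ onto the line spanned by $e_1+\dots+e_{2n}$; hence $\psi$ induces $\hat\psi: Col_p(T)/\mathbf{Z}_p\to\mathbf{Z}_p^{2n-2}$. A subspace $W\subset\mathbf{Z}_p^{2n-2}$ is isotropic if $\hat\phi(w_1,w_2)=0$ for all $w_1,w_2\in W$; it is Lagrangian if it is a maximal isotropic, i.e. $(n-1)$-dimensional isotropic, subspace. *)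

theory Defs
  imports
    "HOL-Analysis.Analysis"
    "HOL-Algebra.AbelCoset"
    "Jordan_Normal_Form.VS_Connect"
    "Berlekamp_Zassenhaus.Finite_Field"
begin

section \<open>Tangle diagrams\<close>

text \<open>
  A tangle diagram is drawn piecewise linearly in the closed unit disk of the complex plane.
  An edge is the two-element set of the endpoints of a straight segment.  The diagram is
  subdivided at its crossings, so that every crossing is a vertex and distinct edges meet at most
  in a common vertex.  \<open>over T v\<close> consists of the two edges of the overcrossing strand at
  the crossing \<open>v\<close> (its value elsewhere is irrelevant), and \<open>endpt T i\<close> is the \<open>i\<close>-th boundary
  point, for \<open>i = 1, \<dots>, 2n\<close>.
\<close>

record tangle_data =
  edges :: "complex set set"
  over :: "complex \<Rightarrow> complex set set"
  endpt :: "nat \<Rightarrow> complex"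

definition vertices :: "tangle_data \<Rightarrow> complex set" where
  "vertices T = \<Union> (edges T)"

definition star :: "tangle_data \<Rightarrow> complex \<Rightarrow> complex set set" where
  "star T v = {e \<in> edges T. v \<in> e}"

text \<open>
  At a crossing \<open>v\<close> the straight strands \<open>a \<rightarrow> v \<rightarrow> c\<close> and \<open>b \<rightarrow> v \<rightarrow> d\<close> pass through each other,
  the former above the latter.  They are transverse because distinct edges do not overlap.
\<close>

definition crossing :: "tangle_data \<Rightarrow> complex \<Rightarrow> bool" where
  "crossing T v \<longleftrightarrow> (\<exists>a b c d.
     star T v = {{v, a}, {v, b}, {v, c}, {v, d}} \<and> card (star T v) = 4 \<and>
     v \<in> open_segment a c \<and> v \<in> open_segment b d \<and> over T v = {{v, a}, {v, c}})"

text \<open>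
  In the interior of the disk, a vertex is either a bend of a strand (two edges) or a crossing;
  on the boundary circle, it is an end of a strand.  Hence the underlying curve consists of
  \<open>n\<close> arcs with the \<open>2n\<close> given ends and of closed components.  The boundary points
  may be numbered along the circle in either direction (\<open>s = 1\<close> is counterclockwise).
\<close>

definition tangle_diagram :: "nat \<Rightarrow> tangle_data \<Rightarrow> bool" where
  "tangle_diagram n T \<longleftrightarrow>
     finite (edges T) \<and>
     (\<forall>e\<in>edges T. card e = 2) \<and>
     (\<forall>e\<in>edges T. \<forall>e'\<in>edges T. convex hull e \<inter> convex hull e' = convex hull (e \<inter> e')) \<and>
     vertices T \<subseteq> cball 0 1 \<and>
     (\<forall>v \<in> vertices T \<inter> sphere 0 1. card (star T v) = 1) \<and>
     (\<forall>v \<in> vertices T \<inter> ball 0 1. card (star T v) = 2 \<or> crossing T v) \<and>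
     vertices T \<inter> sphere 0 1 = endpt T ` {1..2*n} \<and>
     (\<exists>s \<theta>. s \<in> {1, -1} \<and> strict_mono_on {1..2*n} \<theta> \<and> \<theta> (2*n) < \<theta> 1 + 2 * pi \<and>
        (\<forall>i\<in>{1..2*n}. endpt T i = cis (s * \<theta> i)))"

text \<open>
  Two edges are consecutive in an arc of the diagram if they meet in a bend or form the
  overcrossing strand of a crossing.  An arc is represented by the set of all its edges.
\<close>

definition arc_step :: "tangle_data \<Rightarrow> (complex set \<times> complex set) set" where
  "arc_step T = {(e, e'). \<exists>v\<in>vertices T. star T v = {e, e'} \<or> crossing T v \<and> over T v = {e, e'}}"

definition arc_of :: "tangle_data \<Rightarrow> complex set \<Rightarrow> complex set set" where
  "arc_of T e = (arc_step T)\<^sup>* `` {e}"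

definition arcs :: "tangle_data \<Rightarrow> complex set set set" where
  "arcs T = arc_of T ` edges T"

definition end_arc :: "tangle_data \<Rightarrow> nat \<Rightarrow> complex set set" where
  "end_arc T i = arc_of T (the_elem (star T (endpt T i)))"


section \<open>Quotient spaces\<close>

text \<open>
  The additive cosets of \<open>L\<close>; the fields \<open>mult\<close> and \<open>one\<close> of the record play no role for vector
  spaces.
\<close>

definition quotient_space :: "('k, 'v) module \<Rightarrow> 'v set \<Rightarrow> ('k, 'v set) module" where
  "quotient_space V L =
     \<lparr>carrier = a_rcosets\<^bsub>V\<^esub> L, mult = (\<lambda>A B. L), one = L, zero = L, add = set_add V,
      smult = (\<lambda>c A. \<Union>a\<in>A. L +>\<^bsub>V\<^esub> (c \<odot>\<^bsub>V\<^esub> a))\<rparr>"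


section \<open>Fox colorings of tangle diagrams\<close>

text \<open>The field with \<open>p\<close> elements is \<open>'p mod_ring\<close>, where \<open>p = CARD('p)\<close> is prime.\<close>

abbreviation Zp :: "'p::prime_card mod_ring ring" where
  "Zp \<equiv> class_ring"

abbreviation fun_space :: "'i set \<Rightarrow> ('p::prime_card mod_ring, 'i \<Rightarrow> 'p mod_ring) module" where
  "fun_space I \<equiv> ring.func_space Zp I"

definition colorings :: "tangle_data \<Rightarrow> (complex set set \<Rightarrow> 'p::prime_card mod_ring) set" where
  "colorings T = {c \<in> arcs T \<rightarrow>\<^sub>E UNIV. \<forall>v. crossing T v \<longrightarrow>
     (\<forall>h\<in>over T v. (\<Sum>u \<in> star T v - over T v. c (arc_of T u)) = 2 * c (arc_of T h))}"

definition Col ::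
  "tangle_data \<Rightarrow> ('p::prime_card mod_ring, complex set set \<Rightarrow> 'p mod_ring) module" where
  "Col T = (fun_space (arcs T))\<lparr>carrier := colorings T\<rparr>"

definition trivial_colorings ::
  "tangle_data \<Rightarrow> (complex set set \<Rightarrow> 'p::prime_card mod_ring) set" where
  "trivial_colorings T = range (\<lambda>x. \<lambda>a\<in>arcs T. x)"

definition Col_mod_trivial ::
  "tangle_data \<Rightarrow> ('p::prime_card mod_ring, (complex set set \<Rightarrow> 'p mod_ring) set) module" where
  "Col_mod_trivial T = quotient_space (Col T) (trivial_colorings T)"


section \<open>The symplectic space of boundary colorings\<close>

definition bvec_e :: "nat \<Rightarrow> nat \<Rightarrow> nat \<Rightarrow> 'p::prime_card mod_ring" where
  "bvec_e n k = (\<lambda>i\<in>{1..2*n}. if i = k then 1 else 0)"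

definition bvec_f :: "nat \<Rightarrow> nat \<Rightarrow> nat \<Rightarrow> 'p::prime_card mod_ring" where
  "bvec_f n k = bvec_e n k \<oplus>\<^bsub>fun_space {1..2*n}\<^esub> bvec_e n (k + 1)"

definition alternating :: "nat \<Rightarrow> (nat \<Rightarrow> 'p::prime_card mod_ring) set" where
  "alternating n = {a \<in> {1..2*n} \<rightarrow>\<^sub>E UNIV. (\<Sum>i=1..2*n. (-1)^i * a i) = 0}"

definition alt_space :: "nat \<Rightarrow> ('p::prime_card mod_ring, nat \<Rightarrow> 'p mod_ring) module" where
  "alt_space n = (fun_space {1..2*n})\<lparr>carrier := alternating n\<rparr>"

definition f_coords :: "nat \<Rightarrow> (nat \<Rightarrow> 'p::prime_card mod_ring) \<Rightarrow> nat \<Rightarrow> 'p mod_ring" where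
  "f_coords n a = (THE s. s \<in> {1..2*n-1} \<rightarrow>\<^sub>E UNIV \<and>
     (\<forall>i\<in>{1..2*n}. a i = (\<Sum>k=1..2*n-1. s k * bvec_f n k i)))"

definition phi_f :: "nat \<Rightarrow> nat \<Rightarrow> 'p::prime_card mod_ring" where
  "phi_f i j = (if j = i + 1 then 1 else if i = j + 1 then -1 else 0)"

definition phi ::
  "nat \<Rightarrow> (nat \<Rightarrow> 'p::prime_card mod_ring) \<Rightarrow> (nat \<Rightarrow> 'p mod_ring) \<Rightarrow> 'p mod_ring" where
  "phi n a b = (\<Sum>i=1..2*n-1. \<Sum>j=1..2*n-1. f_coords n a i * f_coords n b j * phi_f i j)"

definition monochromatic :: "nat \<Rightarrow> (nat \<Rightarrow> 'p::prime_card mod_ring) set" where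
  "monochromatic n = range (\<lambda>x. \<lambda>i\<in>{1..2*n}. x)"

definition symp_space ::
  "nat \<Rightarrow> ('p::prime_card mod_ring, (nat \<Rightarrow> 'p mod_ring) set) module" where
  "symp_space n = quotient_space (alt_space n) (monochromatic n)"

text \<open>
  Maps on quotients are given by their common value on all representatives, which
  \<^const>\<open>the_elem\<close> extracts.
\<close>

definition phi_hat ::
  "nat \<Rightarrow> (nat \<Rightarrow> 'p::prime_card mod_ring) set \<Rightarrow> (nat \<Rightarrow> 'p mod_ring) set \<Rightarrow> 'p mod_ring" where
  "phi_hat n A B = the_elem ((\<lambda>(a, b). phi n a b) ` (A \<times> B))"

definition isotropic :: "nat \<Rightarrow> (nat \<Rightarrow> 'p::prime_card mod_ring) set set \<Rightarrow> bool" where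
  "isotropic n W \<longleftrightarrow> VectorSpace.subspace Zp W (symp_space n) \<and>
     (\<forall>w1\<in>W. \<forall>w2\<in>W. phi_hat n w1 w2 = 0)"

definition lagrangian :: "nat \<Rightarrow> (nat \<Rightarrow> 'p::prime_card mod_ring) set set \<Rightarrow> bool" where
  "lagrangian n W \<longleftrightarrow> isotropic n W \<and> (\<forall>W'. isotropic n W' \<and> W \<subseteq> W' \<longrightarrow> W' = W) \<and>
     vectorspace.dim Zp ((symp_space n)\<lparr>carrier := W\<rparr>) = n - 1"


section \<open>The boundary map\<close>

definition psi ::
  "nat \<Rightarrow> tangle_data \<Rightarrow> (complex set set \<Rightarrow> 'p::prime_card mod_ring) \<Rightarrow> nat \<Rightarrow> 'p mod_ring" where
  "psi n T c = (\<lambda>i\<in>{1..2*n}. c (end_arc T i))"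

definition psi_hat ::
  "nat \<Rightarrow> tangle_data \<Rightarrow> (complex set set \<Rightarrow> 'p::prime_card mod_ring) set \<Rightarrow>
     (nat \<Rightarrow> 'p mod_ring) set" where
  "psi_hat n T C = the_elem ((\<lambda>c. monochromatic n +>\<^bsub>alt_space n\<^esub> psi n T c) ` C)"

end

theory Submission
  imports Defs
begin

text \<open>
  Project the disk from a point of the circle between the last and the first end, so that the rays
  from that point become vertical lines, and sweep the diagram by a vertical line.  The colors of
  the ends already passed, followed by the colors of the edges on the line from bottom to top, form
  the boundary colorings of a tangle, namely of the part already swept.  In terms of the colors
  themselves, the form is a sum over pairs of positions with alternating signs.  Passing a vertex inserts a pair \<open>[c, c]\<close> with \<open>c\<close> arbitrary, contracts such a pair, or
  applies \<open>[x, y] \<mapsto> [2 x - y, x]\<close> or its inverse.  Each of these moves preserves the property of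
  being equal to the own orthogonal complement among the sequences of alternating sum zero, and
  changes the cardinality by the expected power of \<open>p\<close>.
\<close>

section \<open>Self-orthogonal sets of color sequences\<close>

text \<open>Projecting from a point of the circle puts every end below all edges that the sweep line
  meets, hence at the junction of the list of passed ends with the list of edges on the line. So an
  end is passed without permuting strands: either the lowest edge on the line becomes the last
  passed end, or the edge of the end occurs in both lists and a pair is inserted. During the sweep
  colors are put on edges instead of arcs, because an arc may be swept only in part and met by the
  line several times, whereas each condition on edges lives at a single vertex. Self-orthogonality
  is stated before dividing by the constants, which span the radical of the form; this avoids
  quotients of varying dimension while the number of strands changes. The cardinality is tracked
  next to it because counting is enough to read off the dimension at the end.\<close>

fun alt :: "'a::comm_ring_1 list \<Rightarrow> 'a" where
  "alt [] = 0"
| "alt (x # xs) = x - alt xs"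

text \<open>Expanded, this is the sum over i < j of (-1)^(j-i-1) * (x_i y_j - x_j y_i). It is
  \<open>phi\<close> in terms of colors instead of coordinates in the basis \<open>f\<close>, see
  \<open>phi_eq_alt_form\<close>.\<close>

fun alt_form :: "'a::comm_ring_1 list \<Rightarrow> 'a list \<Rightarrow> 'a" where
  "alt_form (x # xs) (y # ys) = x * alt ys - y * alt xs + alt_form xs ys"
| "alt_form _ _ = 0"

lemma alt_append: "alt (xs @ ys) = alt xs + (- 1) ^ length xs * alt ys"
  by (induction xs) (auto simp: algebra_simps)

text \<open>Pairs of positions lie in the first part, in the second part, or in both; for the mixed
  ones the sign factors, so their sum is a product of alternating sums.\<close>

lemma alt_form_append:
  assumes "length xs = length xs'"
  shows "alt_form (xs @ ys) (xs' @ ys') = alt_form xs xs' + alt_form ys ys' -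
    (- 1) ^ length xs * (alt xs * alt ys' - alt xs' * alt ys)"
  using assms
  by (induction xs xs' rule: list_induct2) (auto simp: algebra_simps alt_append)

text \<open>Locality principle behind all moves: by \<open>alt_form_append\<close> a middle block
  interacts with its surroundings only through its alternating sum and the parity of its length. A
  move therefore has to be checked on the replaced block alone.\<close>

lemma alt_form_append3:
  assumes "length P = length P'" "length M = length M'" "length N = length N'"
    and "alt M = alt N" "alt M' = alt N'" "alt_form M M' = alt_form N N'"
    and "even (length M) \<longleftrightarrow> even (length N)"
  shows "alt_form (P @ M @ Q) (P' @ M' @ Q') = alt_form (P @ N @ Q) (P' @ N' @ Q')"
proof -
  have "(- 1 :: 'a) ^ length M = (- 1) ^ length N"
    using assms(7) by (cases "even (length M)") auto
  with assms show ?thesis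
    by (simp add: alt_form_append alt_append)
qed

text \<open>The pair \<open>[c, c]\<close> has alternating sum zero, so \<open>c\<close> is felt
  only against \<open>[d, e]\<close>, where it contributes c * e - d * c. This is for contracting a
  pair, where \<open>c\<close> has to be found or recovered.\<close>

lemma alt_form_pair:
  assumes "length P = length P'" and "alt (P @ Q) = 0"
  shows "alt_form (P @ [c, c] @ Q) (P' @ [d, e] @ Q') =
    alt_form (P @ [0, 0] @ Q) (P' @ [d, e] @ Q') - c * (d - e)"
  using assms by (simp add: alt_form_append alt_append algebra_simps)

definition lin_comb :: "'a::comm_ring_1 \<Rightarrow> 'a list \<Rightarrow> 'a \<Rightarrow> 'a list \<Rightarrow> 'a list" where
  "lin_comb r xs s ys = map2 (\<lambda>x y. r * x + s * y) xs ys"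

lemma length_lin_comb [simp]: "length (lin_comb r xs s ys) = min (length xs) (length ys)"
  by (simp add: lin_comb_def)

lemma lin_comb_Cons [simp]: "lin_comb r (x # xs) s (y # ys) = (r * x + s * y) # lin_comb r xs s ys"
  by (simp add: lin_comb_def)

lemma lin_comb_Nil [simp]: "lin_comb r [] s [] = []"
  by (simp add: lin_comb_def)

lemma lin_comb_append:
  assumes "length xs = length xs'"
  shows "lin_comb r (xs @ ys) s (xs' @ ys') = lin_comb r xs s xs' @ lin_comb r ys s ys'"
  using assms by (simp add: lin_comb_def)

lemma alt_lin_comb:
  assumes "length xs = length ys"
  shows "alt (lin_comb r xs s ys) = r * alt xs + s * alt ys"
  using assms by (induction xs ys rule: list_induct2) (auto simp: algebra_simps)

lemma alt_form_lin_comb: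
  assumes "length zs = length xs" "length xs = length ys"
  shows "alt_form (lin_comb r xs s ys) zs = r * alt_form xs zs + s * alt_form ys zs"
  using assms
  by (induction zs xs ys rule: list_induct3) (auto simp: algebra_simps alt_lin_comb)

lemma alt_form_skew: "length xs = length ys \<Longrightarrow> alt_form ys xs = - alt_form xs ys"
  by (induction xs ys rule: list_induct2) (auto simp: algebra_simps)

definition alt_seqs :: "nat \<Rightarrow> 'a::comm_ring_1 list set" where
  "alt_seqs m = {xs. length xs = 2 * m \<and> alt xs = 0}"

text \<open>The constants span the radical of the form on alternating sequences, so such a set
  contains them and becomes Lagrangian modulo constants. Linearity follows, since an orthogonal
  complement is a subspace (\<open>lagr_lin_comb\<close>).\<close>

definition lagr :: "nat \<Rightarrow> 'a::{finite,field} list set \<Rightarrow> bool" where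
  "lagr m S \<longleftrightarrow> S = {a \<in> alt_seqs m. \<forall>b\<in>S. alt_form a b = 0} \<and> card S = CARD('a) ^ m"

lemma lagrD:
  assumes "lagr m S" "a \<in> S"
  shows "length a = 2 * m" "alt a = 0" "b \<in> S \<Longrightarrow> alt_form a b = 0"
  using assms unfolding lagr_def alt_seqs_def by blast+

lemma lagr_mem:
  assumes "lagr m S" "length a = 2 * m" "alt a = 0" "\<And>b. b \<in> S \<Longrightarrow> alt_form a b = 0"
  shows "a \<in> S"
  using assms unfolding lagr_def alt_seqs_def by blast

lemma lagrI:
  assumes "\<And>a. a \<in> S \<Longrightarrow> length a = 2 * m \<and> alt a = 0"
    and "\<And>a b. a \<in> S \<Longrightarrow> b \<in> S \<Longrightarrow> alt_form a b = 0"
    and "\<And>a. length a = 2 * m \<Longrightarrow> alt a = 0 \<Longrightarrow> (\<And>b. b \<in> S \<Longrightarrow> alt_form a b = 0) \<Longrightarrow> a \<in> S"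
    and "card S = CARD('a) ^ m"
  shows "lagr m (S :: 'a::{finite,field} list set)"
  using assms unfolding lagr_def alt_seqs_def by blast

lemma lagr_finite:
  assumes "lagr m (S :: 'a::{finite,field} list set)"
  shows "finite S"
proof (rule finite_subset)
  show "S \<subseteq> {xs. set xs \<subseteq> UNIV \<and> length xs = 2 * m}"
    using lagrD(1)[OF assms] by blast
qed (rule finite_lists_length_eq, simp)

lemma lagr_lin_comb:
  assumes "lagr m S" "xs \<in> S" "ys \<in> S"
  shows "lin_comb r xs s ys \<in> S"
proof (rule lagr_mem[OF assms(1)])
  note lagrD[OF assms(1,2)] lagrD[OF assms(1,3)]
  moreover from this show "length (lin_comb r xs s ys) = 2 * m" "alt (lin_comb r xs s ys) = 0"
    by (simp_all add: alt_lin_comb)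
  ultimately show "alt_form (lin_comb r xs s ys) b = 0" if "b \<in> S" for b
    using that lagrD(1)[OF assms(1) that] by (simp add: alt_form_lin_comb)
qed

section \<open>Inserting and contracting a pair\<close>

lemma lagr_empty: "lagr 0 {[] :: 'a::{finite,field} list}"
  by (rule lagrI) auto

lemma list_split_at_pair:
  assumes "length a = Suc (Suc k)" "j \<le> k"
  obtains P x y Q where "a = P @ [x, y] @ Q" "length P = j" "length (P @ Q) = k"
proof -
  define P where "P = take j a"
  have P: "a = P @ drop j a" "length P = j" using assms by (auto simp: P_def)
  obtain x y Q where "drop j a = x # y # Q"
    using assms by (metis Cons_nth_drop_Suc Suc_le_mono le_imp_less_Suc less_Suc_eq_le less_SucI)
  with P have "a = P @ [x, y] @ Q" by simp
  moreover from this have "length (P @ Q) = k" using assms(1) by simp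
  ultimately show thesis using that P(2) by blast
qed

definition cup :: "nat \<Rightarrow> 'a list set \<Rightarrow> 'a list set" where
  "cup j S = {P @ [c, c] @ Q | P c Q. length P = j \<and> P @ Q \<in> S}"

text \<open>In terms of linear algebra this is symplectic reduction by the hyperplane on which the
  two entries agree.\<close>

definition cap :: "nat \<Rightarrow> 'a list set \<Rightarrow> 'a list set" where
  "cap j S = {P @ Q | P c Q. length P = j \<and> P @ [c, c] @ Q \<in> S}"

lemma card_cup: "card (cup j (S :: 'a::finite list set)) = CARD('a) * card {a \<in> S. j \<le> length a}"
proof -
  let ?f = "\<lambda>(c, a). take j a @ [c, c] @ drop j a"
  have "inj_on ?f (UNIV \<times> {a \<in> S. j \<le> length a})"
  proof (rule inj_onI)
    fix x y assume *: "x \<in> UNIV \<times> {a \<in> S. j \<le> length a}" "y \<in> UNIV \<times> {a \<in> S. j \<le> length a}" "?f x = ?f y"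
    obtain c a d b where xy: "x = (c, a)" "y = (d, b)" by (cases x, cases y)
    with * have "length (take j a) = length (take j b)" "take j a @ c # c # drop j a = take j b @ d # d # drop j b"
      by auto
    then have "take j a = take j b \<and> c # c # drop j a = d # d # drop j b"
      by (simp only: append_eq_append_conv simp_thms)
    then show "x = y" unfolding xy by (metis append_take_drop_id list.inject)
  qed
  moreover have "cup j S = ?f ` (UNIV \<times> {a \<in> S. j \<le> length a})"
  proof (intro equalityI subsetI)
    fix z assume "z \<in> cup j S"
    then obtain P c Q where "z = P @ [c, c] @ Q" "length P = j" "P @ Q \<in> S"
      by (auto simp: cup_def)
    then have "z = ?f (c, P @ Q)" "(c, P @ Q) \<in> UNIV \<times> {a \<in> S. j \<le> length a}" by auto
    then show "z \<in> ?f ` (UNIV \<times> {a \<in> S. j \<le> length a})" by blast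
  next
    fix z assume "z \<in> ?f ` (UNIV \<times> {a \<in> S. j \<le> length a})"
    then obtain c a where "z = take j a @ [c, c] @ drop j a" "a \<in> S" "j \<le> length a" by auto
    moreover from this have "length (take j a) = j" "take j a @ drop j a \<in> S" by auto
    ultimately show "z \<in> cup j S" unfolding cup_def by blast
  qed
  ultimately show ?thesis
    by (simp add: card_image card_cartesian_product)
qed

text \<open>Orthogonality to a pair of ones inserted into zeros forces the two entries at the
  insertion point to agree. Once they agree, the pairs can be deleted from both arguments without
  changing the form.\<close>

lemma lagr_cup:
  fixes S :: "'a::{finite,field} list set"
  assumes "lagr m S" "j \<le> 2 * m"
  shows "lagr (Suc m) (cup j S)"
proof (rule lagrI)
  show "length a = 2 * Suc m \<and> alt a = 0" if "a \<in> cup j S" for a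
  proof -
    from that obtain P c Q where *: "a = P @ [c, c] @ Q" "P @ Q \<in> S" by (auto simp: cup_def)
    then show ?thesis using lagrD(1,2)[OF assms(1) *(2)] by (auto simp: alt_append)
  qed
next
  fix a b assume "a \<in> cup j S" "b \<in> cup j S"
  then obtain P c Q P' c' Q' where *: "a = P @ [c, c] @ Q" "length P = j" "P @ Q \<in> S"
    "b = P' @ [c', c'] @ Q'" "length P' = j" "P' @ Q' \<in> S"
    unfolding cup_def by blast
  have "alt_form a b = alt_form (P @ [] @ Q) (P' @ [] @ Q')"
    unfolding * by (rule alt_form_append3) (use * in auto)
  then show "alt_form a b = 0"
    using lagrD(3)[OF assms(1) *(3,6)] by simp
next
  fix a :: "'a list"
  assume a: "length a = 2 * Suc m" "alt a = 0" "\<And>b. b \<in> cup j S \<Longrightarrow> alt_form a b = 0"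
  obtain P x y Q where a_eq: "a = P @ [x, y] @ Q" "length P = j" "length (P @ Q) = 2 * m"
    by (rule list_split_at_pair[of a "2 * m" j]) (use a(1) assms(2) in auto)
  have alt0: "alt (replicate k 0) = (0 :: 'a)" for k by (induction k) auto
  have form0: "alt_form (replicate k 0) b = 0" for k and b :: "'a list"
  proof (induction k arbitrary: b)
    case (Suc k)
    then show ?case by (cases b) (auto simp: alt0)
  qed simp
  have zero: "replicate (2 * m) 0 \<in> S"
    by (rule lagr_mem[OF assms(1)]) (auto simp: alt0 form0)
  \<comment> \<open>The form of \<open>?z\<close> with \<open>a\<close> is y - x: the other blocks
    of \<open>?z\<close> are zero and \<open>[1, 1]\<close> has alternating sum zero.\<close>
  let ?z = "replicate j 0 @ [1, 1] @ replicate (2 * m - j) (0 :: 'a)"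
  have "replicate j 0 @ replicate (2 * m - j) 0 \<in> S"
    using zero assms(2) by (simp flip: replicate_add)
  then have z: "?z \<in> cup j S"
    unfolding cup_def by (intro CollectI exI conjI) (rule refl, auto)
  have "alt_form ?z a = - alt_form a ?z"
    using a(1) assms(2) by (intro alt_form_skew) auto
  then have "alt_form ?z a = 0" using a(3)[OF z] by simp
  then have "x = y"
    using a_eq by (simp add: alt_form_append alt0 form0 alt_append)
  have "P @ Q \<in> S"
  proof -
    have "alt_form (P @ Q) b = 0" if "b \<in> S" for b
    proof -
      have b: "length b = 2 * m" by (rule lagrD(1)[OF assms(1) that])
      have "take j b @ [0, 0] @ drop j b \<in> cup j S"
        unfolding cup_def using that b assms(2) by (intro CollectI exI conjI) (rule refl, auto)
      then have "alt_form a (take j b @ [0, 0] @ drop j b) = 0" by (rule a(3))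
      moreover have "alt_form a (take j b @ [0, 0] @ drop j b) = alt_form (P @ [] @ Q) (take j b @ [] @ drop j b)"
        unfolding a_eq(1) \<open>x = y\<close> by (rule alt_form_append3) (use a_eq b assms(2) in auto)
      ultimately show ?thesis by simp
    qed
    then show ?thesis
      using a a_eq \<open>x = y\<close> by (intro lagr_mem[OF assms(1)]) (auto simp: alt_append)
  qed
  then show "a \<in> cup j S"
    using a_eq \<open>x = y\<close> unfolding cup_def by blast
next
  have "{a \<in> S. j \<le> length a} = S" using lagrD(1)[OF assms(1)] assms(2) by auto
  then show "card (cup j S) = CARD('a) ^ Suc m"
    using assms(1) by (simp add: card_cup lagr_def)
qed

text \<open>Let \<delta> be the difference of the two entries to be contracted. For \<open>a\<close>
  orthogonal to the result, pairing \<open>a\<close> with \<open>[c, c]\<close> inserted gives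
  \<phi> - c * \<delta> on \<open>S\<close>, where \<phi> vanishes on the kernel of \<delta>; hence
  a suitable \<open>c\<close> makes it zero. For the count: if \<delta> is not zero on
  \<open>S\<close>, its kernel has index \<open>CARD('a)\<close> and deleting the pair is injective
  there; otherwise the deletion has fibres of size \<open>CARD('a)\<close>.\<close>

lemma lagr_cap:
  fixes S :: "'a::{finite,field} list set"
  assumes "lagr (Suc m) S" "j \<le> 2 * m"
  shows "lagr m (cap j S)"
proof -
  note S = lagrD[OF assms(1)]
  define \<delta> :: "'a list \<Rightarrow> 'a" where "\<delta> b = b ! j - b ! Suc j" for b
  have \<delta>: "\<delta> (P @ [x, y] @ Q) = x - y" if "length P = j" for P x y Q
    using that by (simp add: \<delta>_def nth_append)
  have split: thesis if "b \<in> S" "\<And>P x y Q. b = P @ [x, y] @ Q \<Longrightarrow> length P = j \<Longrightarrow> length (P @ Q) = 2 * m \<Longrightarrow> thesis"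
    for b thesis
    by (rule list_split_at_pair[of b "2 * m" j]) (use S(1)[of b] that assms(2) in auto)
  have \<delta>_lin: "\<delta> (lin_comb r xs s ys) = r * \<delta> xs + s * \<delta> ys" if "xs \<in> S" "ys \<in> S" for r xs s ys
  proof (rule split[OF that(1)], rule split[OF that(2)])
    fix P x y Q P' x' y' Q'
    assume "ys = P @ [x, y] @ Q" "length P = j" "xs = P' @ [x', y'] @ Q'" "length P' = j"
    then show ?thesis
      by (simp add: lin_comb_append \<delta>_def nth_append algebra_simps)
  qed
  show ?thesis
  proof (rule lagrI)
    show "length a = 2 * m \<and> alt a = 0" if "a \<in> cap j S" for a
    proof -
      from that obtain P c Q where *: "a = P @ Q" "P @ [c, c] @ Q \<in> S"
        by (auto simp: cap_def)
      then show ?thesis using S(1,2)[OF *(2)] by (auto simp: alt_append)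
    qed
  next
    fix a b assume "a \<in> cap j S" "b \<in> cap j S"
    then obtain P c Q P' c' Q' where *: "a = P @ Q" "length P = j" "P @ [c, c] @ Q \<in> S"
      "b = P' @ Q'" "length P' = j" "P' @ [c', c'] @ Q' \<in> S"
      unfolding cap_def by blast
    have "alt_form (P @ [c, c] @ Q) (P' @ [c', c'] @ Q') = alt_form (P @ [] @ Q) (P' @ [] @ Q')"
      by (rule alt_form_append3) (use * in auto)
    then show "alt_form a b = 0"
      using S(3)[OF *(3,6)] * by simp
  next
    fix a :: "'a list"
    assume a: "length a = 2 * m" "alt a = 0" "\<And>b. b \<in> cap j S \<Longrightarrow> alt_form a b = 0"
    define P where "P = take j a"
    define Q where "Q = drop j a"
    have P: "a = P @ Q" "length P = j" unfolding P_def Q_def using a assms(2) by auto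
    define \<phi> where "\<phi> b = alt_form (P @ [0, 0] @ Q) b" for b
    have form: "alt_form (P @ [c, c] @ Q) b = \<phi> b - c * \<delta> b" if "b \<in> S" for b c
    proof (rule split[OF that])
      fix P' x y Q'
      assume *: "b = P' @ [x, y] @ Q'" "length P' = j"
      show ?thesis
        unfolding \<phi>_def *(1) \<delta>[OF *(2)] by (rule alt_form_pair) (use * P a in auto)
    qed
    have \<phi>_0: "\<phi> b = 0" if b: "b \<in> S" "\<delta> b = 0" for b
    proof (rule split[OF b(1)])
      fix P' x y Q'
      assume *: "b = P' @ [x, y] @ Q'" "length P' = j"
      with \<delta> b have "x = y" by auto
      have "P' @ Q' \<in> cap j S" using * b \<open>x = y\<close> unfolding cap_def by blast
      then have "alt_form (P @ [] @ Q) (P' @ [] @ Q') = 0" using a P by auto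
      moreover have "\<phi> b = alt_form (P @ [] @ Q) (P' @ [] @ Q')"
        unfolding \<phi>_def * \<open>x = y\<close> by (rule alt_form_append3) (use * P in auto)
      ultimately show ?thesis by simp
    qed
    have \<phi>_lin: "\<phi> (lin_comb r xs s ys) = r * \<phi> xs + s * \<phi> ys" if "xs \<in> S" "ys \<in> S" for r xs s ys
    proof -
      have l: "length (P @ [0, 0] @ Q) = 2 * Suc m" "length xs = 2 * Suc m" "length ys = 2 * Suc m"
        using S(1) that P a by auto
      have "\<phi> zs = - alt_form zs (P @ [0, 0] @ Q)" if "length zs = 2 * Suc m" for zs
        unfolding \<phi>_def by (rule alt_form_skew) (use that l in simp)
      then show ?thesis using l by (simp add: alt_form_lin_comb del: append.simps)
    qed
    \<comment> \<open>Linear functionals on \<open>S\<close> with \<open>\<phi> = 0\<close> wherever \<open>\<delta> = 0\<close> are proportional.\<close>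
    obtain c where c: "\<And>b. b \<in> S \<Longrightarrow> \<phi> b = c * \<delta> b"
    proof (cases "\<exists>b\<in>S. \<delta> b \<noteq> 0")
      case False
      then show ?thesis using \<phi>_0 by (intro that[of 0]) auto
    next
      case True
      then obtain b0 where b0: "b0 \<in> S" "\<delta> b0 \<noteq> 0" by blast
      show ?thesis
      proof (rule that[of "\<phi> b0 / \<delta> b0"])
        fix b assume b: "b \<in> S"
        have "\<phi> (lin_comb 1 b (- (\<delta> b / \<delta> b0)) b0) = 0"
          using b b0 by (intro \<phi>_0 lagr_lin_comb[OF assms(1)]) (auto simp: \<delta>_lin)
        then show "\<phi> b = \<phi> b0 / \<delta> b0 * \<delta> b" using b b0 by (simp add: \<phi>_lin)
      qed
    qed
    have "P @ [c, c] @ Q \<in> S"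
      using a P by (intro lagr_mem[OF assms(1)]) (auto simp: form c alt_append simp del: append.simps)
    then show "a \<in> cap j S" using P unfolding cap_def by blast
  next
    have fin: "finite S" by (rule lagr_finite[OF assms(1)])
    have card_S: "card S = CARD('a) * CARD('a) ^ m" using assms(1) by (simp add: lagr_def)
    have len_cap: "length a = 2 * m" if "a \<in> cap j S" for a
      using that by (auto simp: cap_def dest!: S(1))
    show "card (cap j S) = CARD('a) ^ m"
    proof (cases "\<exists>b\<in>S. \<delta> b \<noteq> 0")
      case False
      \<comment> \<open>With \<delta> zero on \<open>S\<close>, recoloring the pair
        \<open>[c, c]\<close> does not affect orthogonality to \<open>S\<close>, so every color of
        the pair occurs.\<close>
      have "S = cup j (cap j S)"
      proof (intro equalityI subsetI)
        fix b assume b: "b \<in> S"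
        then show "b \<in> cup j (cap j S)"
        proof (rule split)
          fix P x y Q
          assume *: "b = P @ [x, y] @ Q" "length P = j"
          with False b \<delta> have "x = y" by auto
          with * b show ?thesis unfolding cup_def cap_def by blast
        qed
      next
        fix b assume "b \<in> cup j (cap j S)"
        then obtain P c Q where *: "b = P @ [c, c] @ Q" "length P = j" "P @ Q \<in> cap j S"
          unfolding cup_def by blast
        then obtain d P' Q' where d: "P' @ [d, d] @ Q' \<in> S" "P' @ Q' = P @ Q" "length P' = j"
          unfolding cap_def by auto
        have d': "P @ [d, d] @ Q \<in> S" using d *(2) by (metis append_eq_append_conv)
        have "alt_form b z = 0" if "z \<in> S" for z
        proof (rule split[OF that])
          fix P' x y Q'
          assume z: "z = P' @ [x, y] @ Q'" "length P' = j"
          with False that \<delta> have "x = y" by auto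
          have "alt_form b z = alt_form (P @ [d, d] @ Q) z"
            unfolding * z \<open>x = y\<close> by (rule alt_form_append3) (use z * in auto)
          then show ?thesis using S(3)[OF d' that] by simp
        qed
        then show "b \<in> S"
          using S(1,2)[OF d'] by (intro lagr_mem[OF assms(1)]) (auto simp: * alt_append)
      qed
      then have "card S = CARD('a) * card {a \<in> cap j S. j \<le> length a}"
        by (metis card_cup)
      moreover have "{a \<in> cap j S. j \<le> length a} = cap j S" using len_cap assms(2) by auto
      ultimately show ?thesis using card_S by simp
    next
      case True
      then obtain b1 where b1: "b1 \<in> S" "\<delta> b1 \<noteq> 0" by blast
      \<comment> \<open>A multiple of \<open>b1\<close> with \<delta> = 1, written as a linear
        combination whose second coefficient is 0. Subtracting \<delta> b times \<open>b0\<close>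
        from b projects \<open>S\<close> onto the kernel \<open>K\<close>.\<close>
      define b0 where "b0 = lin_comb (1 / \<delta> b1) b1 0 b1"
      have b0: "b0 \<in> S" "\<delta> b0 = 1"
        unfolding b0_def using b1 by (auto simp: lagr_lin_comb[OF assms(1)] \<delta>_lin)
      define K where "K = {b \<in> S. \<delta> b = 0}"
      note len = S(1)
      have undo: "lin_comb 1 (lin_comb 1 xs r ys) (- r) ys = xs" if "length xs = length ys"
        for r :: 'a and xs ys
        using that by (induction xs ys rule: list_induct2) auto
      have "bij_betw (\<lambda>(b, r). lin_comb 1 b r b0) (K \<times> UNIV) S"
      proof (rule bij_betw_byWitness[where f' = "\<lambda>b. (lin_comb 1 b (- \<delta> b) b0, \<delta> b)"])
        show "\<forall>a\<in>K \<times> UNIV. (\<lambda>b. (lin_comb 1 b (- \<delta> b) b0, \<delta> b)) ((\<lambda>(b, r). lin_comb 1 b r b0) a) = a"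
          using b0 len by (auto simp: K_def \<delta>_lin undo)
        show "\<forall>b\<in>S. (\<lambda>(b, r). lin_comb 1 b r b0) (lin_comb 1 b (- \<delta> b) b0, \<delta> b) = b"
          using b0 len undo[of _ b0 "- \<delta> _"] by auto
      qed (use b0 in \<open>auto simp: K_def \<delta>_lin intro: lagr_lin_comb[OF assms(1)]\<close>)
      from bij_betw_same_card[OF this] have "card S = CARD('a) * card K"
        by (simp add: card_cartesian_product mult.commute)
      moreover have "bij_betw (\<lambda>b. take j b @ drop (Suc (Suc j)) b) K (cap j S)"
        unfolding bij_betw_def
      proof
        have K: thesis if "b \<in> K" "\<And>P c Q. b = P @ [c, c] @ Q \<Longrightarrow> length P = j \<Longrightarrow> thesis" for b thesis
        proof (rule split[of b])
          show "b \<in> S" using that by (simp add: K_def)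
          fix P x y Q assume *: "b = P @ [x, y] @ Q" "length P = j"
          with that(1) \<delta> have "x = y" by (auto simp: K_def)
          with * that(2) show thesis by blast
        qed
        show "inj_on (\<lambda>b. take j b @ drop (Suc (Suc j)) b) K"
        proof (rule inj_onI)
          fix a b assume ab: "a \<in> K" "b \<in> K" and eq: "take j a @ drop (Suc (Suc j)) a = take j b @ drop (Suc (Suc j)) b"
          obtain P c Q where a: "a = P @ [c, c] @ Q" "length P = j" by (rule K[OF ab(1)])
          obtain P' c' Q' where b: "b = P' @ [c', c'] @ Q'" "length P' = j" by (rule K[OF ab(2)])
          have PQ: "P' = P" "Q' = Q" using eq a b by auto
          have "alt a = 0" using S(2) ab by (auto simp: K_def)
          then have alt: "alt (P @ Q) = 0" by (simp add: a alt_append)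
          show "a = b"
          proof (rule split[OF b0(1)])
            fix P0 x y Q0 assume z: "b0 = P0 @ [x, y] @ Q0" "length P0 = j"
            have "x - y = 1" using b0(2) z \<delta> by metis
            moreover have "length P = length P0" using z a(2) by (simp only:)
            \<comment> \<open>Since \<delta> is 1 at \<open>b0\<close>, orthogonality to
              \<open>b0\<close> determines the color of the deleted pair, so deletion is injective
              on \<open>K\<close>.\<close>
            ultimately have form: "alt_form (P @ [d, d] @ Q) b0 = alt_form (P @ [0, 0] @ Q) b0 - d" for d
              unfolding z(1) using alt_form_pair[OF _ alt, of P0 d x y Q0] by (simp only: mult_1_right)
            have "alt_form a b0 = 0" "alt_form b b0 = 0" using S(3) ab b0 by (auto simp: K_def)
            then have "alt_form (P @ [0, 0] @ Q) b0 - c = 0" "alt_form (P @ [0, 0] @ Q) b0 - c' = 0"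
              unfolding a(1) b(1) PQ form[of c] form[of c'] .
            then have "c = c'" by (metis eq_iff_diff_eq_0)
            then show ?thesis unfolding a(1) b(1) PQ by simp
          qed
        qed
        show "(\<lambda>b. take j b @ drop (Suc (Suc j)) b) ` K = cap j S"
        proof (intro equalityI subsetI)
          fix z assume "z \<in> (\<lambda>b. take j b @ drop (Suc (Suc j)) b) ` K"
          then obtain b where b: "b \<in> K" "z = take j b @ drop (Suc (Suc j)) b" by auto
          show "z \<in> cap j S"
          proof (rule K[OF b(1)])
            fix P c Q assume "b = P @ [c, c] @ Q" "length P = j"
            moreover have "b \<in> S" using b by (simp add: K_def)
            ultimately show ?thesis using b(2) unfolding cap_def by auto
          qed
        next
          fix z assume "z \<in> cap j S"
          then obtain P c Q where "z = P @ Q" "length P = j" "P @ [c, c] @ Q \<in> S"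
            unfolding cap_def by blast
          moreover from this have "P @ [c, c] @ Q \<in> K" using \<delta> by (auto simp: K_def)
          ultimately show "z \<in> (\<lambda>b. take j b @ drop (Suc (Suc j)) b) ` K"
            by (intro image_eqI[of _ _ "P @ [c, c] @ Q"]) auto
        qed
      qed
      from bij_betw_same_card[OF this] have "card K = card (cap j S)" .
      ultimately show ?thesis using card_S by simp
    qed
  qed
qed

text \<open>Two adjacent strands exchange places. With \<open>True\<close> the lower strand
  \<open>x\<close> passes over and arrives on top, and the Fox relation gives
  \<open>2 * x - y\<close> to the other one; with \<open>False\<close> the upper strand
  \<open>y\<close> passes over. The last clause keeps the length of all other lists.\<close>

fun twist :: "bool \<Rightarrow> 'a::comm_ring_1 list \<Rightarrow> 'a list" where
  "twist True [x, y] = [2 * x - y, x]"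
| "twist False [x, y] = [y, 2 * y - x]"
| "twist _ xs = xs"

lemma length_twist [simp]: "length (twist r xs) = length xs"
  by (induction r xs rule: twist.induct) auto

lemma alt_twist: "alt (twist r xs) = alt xs"
  by (induction r xs rule: twist.induct) auto

text \<open>On two letters the form is the determinant x * y' - x' * y, and both twists are linear
  of determinant 1.\<close>

lemma alt_form_twist: "alt_form (twist r [x, y]) (twist r [x', y']) = alt_form [x, y] [x', y']"
  by (cases r) (auto simp: algebra_simps)

lemma twist_twist: "twist r (twist (\<not> r) [x, y]) = [x, y]"
  by (cases r) auto

definition cross :: "nat \<Rightarrow> bool \<Rightarrow> 'a::comm_ring_1 list set \<Rightarrow> 'a list set" where
  "cross j r S = {P @ twist r [x, y] @ Q | P x y Q. length P = j \<and> P @ [x, y] @ Q \<in> S}"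

text \<open>The twist is invertible and keeps both the alternating sum and the form. A sequence
  orthogonal to the image is pulled back by the opposite twist to one orthogonal to
  \<open>S\<close>, hence in \<open>S\<close>.\<close>

lemma lagr_cross:
  fixes S :: "'a::{finite,field} list set"
  assumes "lagr (Suc m) S" "j \<le> 2 * m"
  shows "lagr (Suc m) (cross j r S)"
proof -
  note S = lagrD[OF assms(1)]
  have split: thesis if "length b = 2 * Suc m" "\<And>P x y Q. b = P @ [x, y] @ Q \<Longrightarrow> length P = j \<Longrightarrow> length (P @ Q) = 2 * m \<Longrightarrow> thesis"
    for b :: "'a list" and thesis
    by (rule list_split_at_pair[of b "2 * m" j]) (use that assms(2) in auto)
  have form: "alt_form (P @ twist r [x, y] @ Q) (P' @ twist r [x', y'] @ Q') =
      alt_form (P @ [x, y] @ Q) (P' @ [x', y'] @ Q')"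
    if "length P = length P'" for P P' Q Q' :: "'a list" and x y x' y'
    by (rule alt_form_append3) (use that in \<open>auto simp: alt_twist alt_form_twist simp del: alt_form.simps\<close>)
  show ?thesis
  proof (rule lagrI)
    fix a assume "a \<in> cross j r S"
    then obtain P x y Q where *: "a = P @ twist r [x, y] @ Q" "P @ [x, y] @ Q \<in> S"
      unfolding cross_def by blast
    then show "length a = 2 * Suc m \<and> alt a = 0"
      using S(1,2)[OF *(2)] by (simp add: alt_append alt_twist algebra_simps)
  next
    fix a b assume "a \<in> cross j r S" "b \<in> cross j r S"
    then obtain P x y Q P' x' y' Q' where
      "a = P @ twist r [x, y] @ Q" "P @ [x, y] @ Q \<in> S" "length P = j"
      "b = P' @ twist r [x', y'] @ Q'" "P' @ [x', y'] @ Q' \<in> S" "length P' = j"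
      unfolding cross_def by blast
    then show "alt_form a b = 0" using S(3) form by metis
  next
    fix a :: "'a list"
    assume a: "length a = 2 * Suc m" "alt a = 0" "\<And>b. b \<in> cross j r S \<Longrightarrow> alt_form a b = 0"
    show "a \<in> cross j r S"
    proof (rule split[OF a(1)])
      fix P x y Q assume *: "a = P @ [x, y] @ Q" "length P = j" "length (P @ Q) = 2 * m"
      obtain u v where uv: "twist (\<not> r) [x, y] = [u, v]" by (cases r) auto
      have tw: "twist r [u, v] = [x, y]" using twist_twist[of r x y] uv by simp
      have "P @ [u, v] @ Q \<in> S"
      proof (rule lagr_mem[OF assms(1)])
        show "length (P @ [u, v] @ Q) = 2 * Suc m" using * by simp
        have "alt [u, v] = alt [x, y]" using alt_twist[of r "[u, v]"] tw by simp
        then have "alt ([u, v] @ Q) = alt ([x, y] @ Q)"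
          unfolding alt_append by (simp only: list.size)
        then show "alt (P @ [u, v] @ Q) = 0" using a(2) unfolding * alt_append[of P] by (simp only:)
        fix b assume b: "b \<in> S"
        show "alt_form (P @ [u, v] @ Q) b = 0"
        proof (rule split[OF S(1)[OF b]])
          fix P' x' y' Q' assume b': "b = P' @ [x', y'] @ Q'" "length P' = j"
          with b have "P' @ twist r [x', y'] @ Q' \<in> cross j r S" unfolding cross_def by blast
          from a(3)[OF this] show ?thesis
            using form[of P P' u v Q x' y' Q'] * b' tw by simp
        qed
      qed
      then show ?thesis unfolding *(1) tw[symmetric] using *(2) cross_def by blast
    qed
  next
    let ?f = "\<lambda>a. take j a @ twist r [a ! j, a ! Suc j] @ drop (Suc (Suc j)) a"
    have f: "?f (P @ [x, y] @ Q) = P @ twist r [x, y] @ Q" if "length P = j" for P x y Q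
      using that by (simp add: nth_append)
    have "cross j r S = ?f ` S"
    proof (intro equalityI subsetI)
      fix z assume "z \<in> cross j r S"
      then obtain P x y Q where "z = P @ twist r [x, y] @ Q" "P @ [x, y] @ Q \<in> S" "length P = j"
        unfolding cross_def by blast
      then show "z \<in> ?f ` S"
        using f[of P x y Q] by (intro image_eqI[of _ _ "P @ [x, y] @ Q"]) simp_all
    next
      fix z assume "z \<in> ?f ` S"
      then obtain b where b: "b \<in> S" "z = ?f b" by blast
      show "z \<in> cross j r S"
      proof (rule split[OF S(1)[OF b(1)]])
        fix P x y Q assume *: "b = P @ [x, y] @ Q" "length P = j"
        have "z = P @ twist r [x, y] @ Q" using b(2) f[OF *(2)] *(1) by simp
        then show ?thesis using * b(1) unfolding cross_def by blast
      qed
    qed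
    moreover have "inj_on ?f S"
    proof (rule inj_onI)
      fix a b assume ab: "a \<in> S" "b \<in> S" "?f a = ?f b"
      show "a = b"
      proof (rule split[OF S(1)[OF ab(1)]], rule split[OF S(1)[OF ab(2)]])
        fix P x y Q P' x' y' Q'
        assume a: "a = P @ [x, y] @ Q" "length P = j" and b: "b = P' @ [x', y'] @ Q'" "length P' = j"
        have "?f a = P @ twist r [x, y] @ Q" "?f b = P' @ twist r [x', y'] @ Q'"
          unfolding a(1) b(1) by (rule f[OF a(2)], rule f[OF b(2)])
        with ab(3) have "P @ twist r [x, y] @ Q = P' @ twist r [x', y'] @ Q'" by (simp only:)
        then have "P = P' \<and> twist r [x, y] = twist r [x', y'] \<and> Q = Q'"
          using a(2) b(2) by (cases r) auto
        then show ?thesis using a b by (cases r) auto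
      qed
    qed
    ultimately show "card (cross j r S) = CARD('a) ^ Suc m"
      using assms(1) by (simp add: card_image lagr_def)
  qed
qed

text \<open>A power of \<open>CARD('a)\<close> is not zero, so \<open>S\<close> has a member, whose
  length determines \<open>m\<close>. This lets the sweep leave \<open>m\<close> existentially
  quantified.\<close>

lemma lagr_length:
  assumes "lagr m S" and "\<And>a. a \<in> S \<Longrightarrow> length a = k"
  shows "k = 2 * m"
proof -
  have "card S \<noteq> 0" using assms(1) by (simp add: lagr_def)
  then obtain a where "a \<in> S" by fastforce
  then show ?thesis using assms(2) lagrD(1)[OF assms(1)] by metis
qed

section \<open>Colorings of a moving sequence of edges\<close>

text \<open>\<open>G\<close> stands for the conditions at the vertices already passed and
  \<open>R\<close> for the edges starting at the current vertex. As \<open>G\<close> does not look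
  at \<open>R\<close>, every color of the inserted pair is realized. The edges \<open>e\<close> and
  \<open>e'\<close> may coincide, as happens at an end of the tangle.\<close>

lemma lagr_colors_cup:
  fixes G :: "('e \<Rightarrow> 'a::{finite,field}) \<Rightarrow> bool"
  assumes "lagr m {map x (A @ Q) | x. G x}"
    and G: "\<forall>x y. (\<forall>e. e \<notin> R \<longrightarrow> x e = y e) \<longrightarrow> G x \<longrightarrow> G y"
    and "set A \<inter> R = {}" "set Q \<inter> R = {}" "e \<in> R" "e' \<in> R"
  shows "lagr (Suc m) {map x (A @ [e, e'] @ Q) | x. G x \<and> x e = x e'}"
proof -
  have "length (A @ Q) = 2 * m" by (rule lagr_length[OF assms(1)]) auto
  then have "lagr (Suc m) (cup (length A) {map x (A @ Q) | x. G x})"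
    by (intro lagr_cup assms(1)) auto
  also have "cup (length A) {map x (A @ Q) | x. G x} = {map x (A @ [e, e'] @ Q) | x. G x \<and> x e = x e'}"
  proof (intro equalityI subsetI)
    fix z assume "z \<in> cup (length A) {map x (A @ Q) | x. G x}"
    then obtain P c Q' x where z: "z = P @ [c, c] @ Q'" "length P = length A" "P @ Q' = map x (A @ Q)" "G x"
      unfolding cup_def by blast
    then have PQ: "P = map x A" "Q' = map x Q" by (auto simp: append_eq_append_conv)
    define y where "y e = (if e \<in> R then c else x e)" for e
    have "map y A = map x A" "map y Q = map x Q"
      using assms(3,4) by (auto simp: y_def)
    then have "z = map y (A @ [e, e'] @ Q)" using z PQ assms(5,6) by (simp add: y_def)
    moreover have "G y" by (rule G[rule_format, OF _ z(4)]) (simp add: y_def)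
    moreover have "y e = y e'" using assms(5,6) by (simp add: y_def)
    ultimately show "z \<in> {map x (A @ [e, e'] @ Q) | x. G x \<and> x e = x e'}" by blast
  next
    fix z assume "z \<in> {map x (A @ [e, e'] @ Q) | x. G x \<and> x e = x e'}"
    then obtain x where "z = map x (A @ [e, e'] @ Q)" "G x" "x e = x e'" by blast
    then have "z = map x A @ [x e, x e] @ map x Q" "G x" by auto
    moreover from this have "map x A @ map x Q \<in> {map x (A @ Q) | x. G x}" by auto
    ultimately show "z \<in> cup (length A) {map x (A @ Q) | x. G x}"
      unfolding cup_def
      by (intro CollectI exI[of _ "map x A"] exI[of _ "x e"] exI[of _ "map x Q"]) simp
  qed
  finally show ?thesis .
qed

lemma lagr_colors_cap:
  fixes G :: "('e \<Rightarrow> 'a::{finite,field}) \<Rightarrow> bool"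
  assumes "lagr m {map x (A @ [e, e'] @ Q) | x. G x}"
  shows "lagr (m - 1) {map x (A @ Q) | x. G x \<and> x e = x e'}"
proof -
  have len: "length (A @ [e, e'] @ Q) = 2 * m" by (rule lagr_length[OF assms(1)]) auto
  then obtain m' where m': "m = Suc m'" by (cases m) auto
  then have "lagr m' (cap (length A) {map x (A @ [e, e'] @ Q) | x. G x})"
    using assms len by (intro lagr_cap) auto
  also have "cap (length A) {map x (A @ [e, e'] @ Q) | x. G x} = {map x (A @ Q) | x. G x \<and> x e = x e'}"
  proof (intro equalityI subsetI)
    fix z assume "z \<in> cap (length A) {map x (A @ [e, e'] @ Q) | x. G x}"
    then obtain P c Q' x where z: "z = P @ Q'" "length P = length A" "P @ [c, c] @ Q' = map x (A @ [e, e'] @ Q)" "G x"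
      unfolding cap_def by blast
    then have "P = map x A" "Q' = map x Q" "x e = c" "x e' = c" by (auto simp: append_eq_append_conv)
    then show "z \<in> {map x (A @ Q) | x. G x \<and> x e = x e'}" using z by auto
  next
    fix z assume "z \<in> {map x (A @ Q) | x. G x \<and> x e = x e'}"
    then obtain x where "z = map x (A @ Q)" and x: "G x" "x e = x e'" by blast
    then have z: "z = map x A @ map x Q" by auto
    from x have "map x (A @ [e, e'] @ Q) = map x A @ [x e, x e] @ map x Q" by auto
    then have "map x A @ [x e, x e] @ map x Q \<in> {map x (A @ [e, e'] @ Q) | x. G x}" using x(1) by force
    then show "z \<in> cap (length A) {map x (A @ [e, e'] @ Q) | x. G x}"
      unfolding cap_def z
      by (intro CollectI exI[of _ "map x A"] exI[of _ "x e"] exI[of _ "map x Q"]) simp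
  qed
  finally show ?thesis using m' by simp
qed

text \<open>For a bend where the strand continues to the right: the set of color sequences stays the
  same, and only the edge carrying one of the colors is renamed.\<close>

lemma lagr_colors_replace:
  fixes G :: "('e \<Rightarrow> 'a::{finite,field}) \<Rightarrow> bool"
  assumes "lagr m {map x (A @ [e] @ Q) | x. G x}"
    and G: "\<forall>x y. (\<forall>e. e \<notin> R \<longrightarrow> x e = y e) \<longrightarrow> G x \<longrightarrow> G y"
    and "set A \<inter> R = {}" "set Q \<inter> R = {}" "e \<notin> R" "e' \<in> R"
  shows "lagr m {map x (A @ [e'] @ Q) | x. G x \<and> x e = x e'}"
proof -
  have "{map x (A @ [e] @ Q) | x. G x} = {map x (A @ [e'] @ Q) | x. G x \<and> x e = x e'}"
  proof (intro equalityI subsetI)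
    fix z assume "z \<in> {map x (A @ [e] @ Q) | x. G x}"
    then obtain x where z: "z = map x (A @ [e] @ Q)" "G x" by blast
    define y where "y f = (if f \<in> R then x e else x f)" for f
    have "map y A = map x A" "map y Q = map x Q"
      using assms(3,4) by (auto simp: y_def)
    then have "z = map y (A @ [e'] @ Q)" using z assms(5,6) by (simp add: y_def)
    moreover have "G y" by (rule G[rule_format, OF _ z(2)]) (simp add: y_def)
    moreover have "y e = y e'" using assms(5,6) by (simp add: y_def)
    ultimately show "z \<in> {map x (A @ [e'] @ Q) | x. G x \<and> x e = x e'}" by blast
  next
    fix z assume "z \<in> {map x (A @ [e'] @ Q) | x. G x \<and> x e = x e'}"
    then obtain x where "z = map x (A @ [e'] @ Q)" "G x" "x e = x e'" by blast
    then have "z = map x (A @ [e] @ Q)" "G x" by auto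
    then show "z \<in> {map x (A @ [e] @ Q) | x. G x}" by blast
  qed
  then show ?thesis using assms(1) by simp
qed

text \<open>The crossing determines the colors of the outgoing edges \<open>c\<close> and
  \<open>d\<close> from those of \<open>a\<close> and \<open>b\<close>. Since \<open>G\<close>
  leaves \<open>c\<close> and \<open>d\<close> free, these values can always be assigned.\<close>

lemma lagr_colors_cross:
  fixes G :: "('e \<Rightarrow> 'a::{finite,field}) \<Rightarrow> bool"
  assumes "lagr m {map x (A @ [a, b] @ Q) | x. G x}"
    and G: "\<forall>x y. (\<forall>e. e \<notin> R \<longrightarrow> x e = y e) \<longrightarrow> G x \<longrightarrow> G y"
    and "set A \<inter> R = {}" "set Q \<inter> R = {}" "a \<notin> R" "b \<notin> R" "R = {c, d}" "c \<noteq> d"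
  shows "lagr m {map x (A @ [c, d] @ Q) | x. G x \<and> [x c, x d] = twist r [x a, x b]}"
proof -
  have len: "length (A @ [a, b] @ Q) = 2 * m" by (rule lagr_length[OF assms(1)]) auto
  then obtain m' where m': "m = Suc m'" by (cases m) auto
  then have "lagr m (cross (length A) r {map x (A @ [a, b] @ Q) | x. G x})"
    using assms(1) len unfolding m' by (intro lagr_cross) auto
  also have "cross (length A) r {map x (A @ [a, b] @ Q) | x. G x} =
    {map x (A @ [c, d] @ Q) | x. G x \<and> [x c, x d] = twist r [x a, x b]}"
  proof (intro equalityI subsetI)
    fix z assume "z \<in> cross (length A) r {map x (A @ [a, b] @ Q) | x. G x}"
    then obtain P u v Q' x where z: "z = P @ twist r [u, v] @ Q'" "length P = length A"
      "P @ [u, v] @ Q' = map x (A @ [a, b] @ Q)" "G x"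
      unfolding cross_def by blast
    then have PQ: "P = map x A" "Q' = map x Q" "x a = u" "x b = v" by (auto simp: append_eq_append_conv)
    obtain s t where st: "twist r [u, v] = [s, t]" by (cases r) auto
    define y where "y = x(c := s, d := t)"
    have "map y A = map x A" "map y Q = map x Q" "y c = s" "y d = t" "y a = u" "y b = v"
      using assms(3-8) PQ by (auto simp: y_def)
    then have "z = map y (A @ [c, d] @ Q)" "[y c, y d] = twist r [y a, y b]" using z st PQ by simp_all
    moreover have "G y" by (rule G[rule_format, OF _ z(4)]) (use assms(7) in \<open>simp add: y_def\<close>)
    ultimately show "z \<in> {map x (A @ [c, d] @ Q) | x. G x \<and> [x c, x d] = twist r [x a, x b]}" by blast
  next
    fix z assume "z \<in> {map x (A @ [c, d] @ Q) | x. G x \<and> [x c, x d] = twist r [x a, x b]}"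
    then obtain x where "z = map x (A @ [c, d] @ Q)" and x: "G x" "[x c, x d] = twist r [x a, x b]" by blast
    then have z: "z = map x A @ [x c, x d] @ map x Q" by simp
    have "map x (A @ [a, b] @ Q) = map x A @ [x a, x b] @ map x Q" by auto
    then have "map x A @ [x a, x b] @ map x Q \<in> {map x (A @ [a, b] @ Q) | x. G x}" using x(1) by force
    then show "z \<in> cross (length A) r {map x (A @ [a, b] @ Q) | x. G x}"
      unfolding cross_def z x(2)
      by (intro CollectI exI[of _ "map x A"] exI[of _ "x a"] exI[of _ "x b"] exI[of _ "map x Q"]) simp
  qed
  finally show ?thesis .
qed

section \<open>Sweeping a diagram by vertical lines\<close>

definition lft :: "('v \<Rightarrow> real) \<Rightarrow> 'v set \<Rightarrow> 'v" where
  "lft X e = (SOME a. a \<in> e \<and> (\<forall>b\<in>e. X a \<le> X b))"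

definition rgt :: "('v \<Rightarrow> real) \<Rightarrow> 'v set \<Rightarrow> 'v" where
  "rgt X e = lft (\<lambda>v. - X v) e"

text \<open>Open, so that an edge at a vertex does not count as meeting the vertical line through
  that vertex.\<close>

definition span :: "('v \<Rightarrow> real) \<Rightarrow> 'v set \<Rightarrow> real set" where
  "span X e = {X (lft X e)<..<X (rgt X e)}"

definition slope :: "('v \<Rightarrow> real) \<Rightarrow> ('v \<Rightarrow> real) \<Rightarrow> 'v set \<Rightarrow> real" where
  "slope X Y e = (Y (rgt X e) - Y (lft X e)) / (X (rgt X e) - X (lft X e))"

definition height :: "('v \<Rightarrow> real) \<Rightarrow> ('v \<Rightarrow> real) \<Rightarrow> 'v set \<Rightarrow> real \<Rightarrow> real" where
  "height X Y e t = Y (lft X e) + slope X Y e * (t - X (lft X e))"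

lemma lft_eq: "X a < X b \<Longrightarrow> lft X {a, b} = a"
  unfolding lft_def by (rule some_equality) auto

lemma rgt_eq: "X a < X b \<Longrightarrow> rgt X {a, b} = b"
  unfolding rgt_def by (subst insert_commute, rule lft_eq) simp

lemma slope_eq:
  assumes "X a \<noteq> X b"
  shows "slope X Y {a, b} = (Y b - Y a) / (X b - X a)"
proof (cases "X a < X b")
  case True
  then show ?thesis by (simp add: slope_def lft_eq rgt_eq)
next
  case False
  with assms have "X b < X a" by simp
  then have "slope X Y {b, a} = (Y a - Y b) / (X a - X b)" by (simp add: slope_def lft_eq rgt_eq)
  then show ?thesis using minus_divide_divide[of "Y b - Y a" "X b - X a"] by (simp add: insert_commute)
qed

lemma height_eq:
  assumes "X a \<noteq> X b"
  shows "height X Y {a, b} t = Y a + slope X Y {a, b} * (t - X a)"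
proof (cases "X a < X b")
  case True
  then show ?thesis by (simp add: height_def lft_eq)
next
  case False
  with assms have lt: "X b < X a" by simp
  then have "lft X {a, b} = b" by (subst insert_commute) (rule lft_eq)
  moreover have "slope X Y {a, b} * (X a - X b) = Y a - Y b"
    using lt by (simp add: insert_commute[of a b] slope_eq)
  ultimately show ?thesis by (simp add: height_def algebra_simps)
qed

lemma height_affine:
  "height X Y e (t + r * (t' - t)) = height X Y e t + r * (height X Y e t' - height X Y e t)"
  by (simp add: height_def algebra_simps)

lemma sorted_wrt_key_unique:
  fixes k :: "'b \<Rightarrow> 'c::linorder"
  assumes "sorted_wrt (\<lambda>x y. k x < k y) xs" "sorted_wrt (\<lambda>x y. k x < k y) ys" "set xs = set ys"
  shows "xs = ys"
proof (rule map_inj_on)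
  have sorted: "sorted_wrt (<) (map k xs)" "sorted_wrt (<) (map k ys)"
    using assms by (simp_all add: sorted_wrt_map)
  show "map k xs = map k ys"
    using strict_sorted_equal[OF sorted] assms(3) by simp
  have "distinct (map k xs)" using sorted(1) by (simp only: strict_sorted_iff)
  then show "inj_on k (set xs \<union> set ys)" using assms(3) by (simp add: distinct_map)
qed

lemma sorted_wrt_key_exists:
  fixes k :: "'b \<Rightarrow> 'c::linorder"
  assumes "finite A" "inj_on k A"
  obtains xs where "set xs = A" "sorted_wrt (\<lambda>x y. k x < k y) xs"
proof -
  obtain ys where ys: "set ys = A" "distinct ys" using finite_distinct_list[OF assms(1)] by blast
  have "sorted (map k (sort_key k ys))" "distinct (map k (sort_key k ys))"
    using ys assms(2) by (auto simp: distinct_map)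
  then have "sorted_wrt (<) (map k (sort_key k ys))" by (simp add: strict_sorted_iff)
  then show thesis using ys by (intro that[of "sort_key k ys"]) (simp_all add: sorted_wrt_map)
qed

text \<open>What the projection has to deliver. Injectivity of \<open>X\<close> makes the line meet
  one vertex at a time; \<open>ends_lowest\<close> and \<open>ends_increasing\<close> place each end
  at the junction of passed ends and edges on the line. \<open>straight\<close> asks for a common
  ratio in both coordinates and not for the ratio in the disk, because a projective map preserves
  lines but not ratios.\<close>

locale sweep =
  fixes n :: nat and T :: tangle_data and X Y :: "complex \<Rightarrow> real"
  assumes finite_edges: "finite (edges T)"
    and card_edge: "e \<in> edges T \<Longrightarrow> card e = 2"
    and inj_X: "inj_on X (vertices T)"
    and heights_neq: "\<lbrakk>e \<in> edges T; f \<in> edges T; e \<noteq> f; t \<in> span X e; t \<in> span X f\<rbrakk>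
      \<Longrightarrow> height X Y e t \<noteq> height X Y f t"
    and vertex_off: "\<lbrakk>v \<in> vertices T; e \<in> edges T; X v \<in> span X e\<rbrakk> \<Longrightarrow> height X Y e (X v) \<noteq> Y v"
    and ends_vertices: "i \<in> {1..2*n} \<Longrightarrow> endpt T i \<in> vertices T"
    and ends_card: "i \<in> {1..2*n} \<Longrightarrow> card (star T (endpt T i)) = 1"
    and ends_lowest: "\<lbrakk>i \<in> {1..2*n}; e \<in> edges T; X (endpt T i) \<in> span X e\<rbrakk>
      \<Longrightarrow> Y (endpt T i) < height X Y e (X (endpt T i))"
    and ends_increasing: "strict_mono_on {1..2*n} (\<lambda>i. X (endpt T i))"
    and vertex_cases: "v \<in> vertices T \<Longrightarrow> v \<in> endpt T ` {1..2*n} \<or> card (star T v) = 2 \<or> crossing T v"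
    and straight: "\<lbrakk>v \<in> open_segment a c; {v, a} \<in> edges T; {v, c} \<in> edges T\<rbrakk>
      \<Longrightarrow> \<exists>r\<in>{0<..<1}. X v = X a + r * (X c - X a) \<and> Y v = Y a + r * (Y c - Y a)"
begin

abbreviation E where "E \<equiv> edges T"
abbreviation V where "V \<equiv> vertices T"
abbreviation left_end where "left_end \<equiv> lft X"
abbreviation right_end where "right_end \<equiv> rgt X"
abbreviation H where "H \<equiv> height X Y"

lemma edge_cases:
  assumes "e \<in> E"
  obtains a b where "e = {a, b}" "X a < X b" "left_end e = a" "right_end e = b" "a \<in> V" "b \<in> V"
proof -
  obtain a b where ab: "e = {a, b}" "a \<noteq> b"
    using card_edge[OF assms] by (meson card_2_iff)
  then have V: "a \<in> V" "b \<in> V" using assms by (auto simp: vertices_def)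
  then consider "X a < X b" | "X b < X a"
    using ab(2) inj_X by (metis inj_onD linorder_neqE_linordered_idom)
  then show thesis
  proof cases
    case 1
    then show ?thesis using that[of a b] ab V by (simp add: lft_eq rgt_eq)
  next
    case 2
    moreover have "e = {b, a}" using ab by auto
    ultimately show ?thesis using that[of b a] V by (simp add: lft_eq rgt_eq)
  qed
qed

lemma edge_ends:
  assumes "e \<in> E"
  shows "left_end e \<in> V" "right_end e \<in> V" "X (left_end e) < X (right_end e)"
    "e = {left_end e, right_end e}"
  by (rule edge_cases[OF assms], auto)+

lemma finite_vertices: "finite V"
  unfolding vertices_def using finite_edges card_edge by (metis card.infinite finite_Union zero_neq_numeral)

lemma star_edge: "e \<in> star T v \<Longrightarrow> e \<in> E"
  by (simp add: star_def)

lemma star_end: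
  assumes "e \<in> star T v"
  shows "left_end e = v \<or> right_end e = v"
  by (rule edge_cases[OF star_edge[OF assms]]) (use assms in \<open>auto simp: star_def\<close>)

lemma height_end:
  assumes "e \<in> star T v"
  shows "H e (X v) = Y v"
proof (rule edge_cases[OF star_edge[OF assms]])
  fix a b assume ab: "e = {a, b}" "X a < X b"
  then have "v = a \<or> v = b" using assms by (auto simp: star_def)
  then show ?thesis
    using height_eq[of X a b Y "X v"] height_eq[of X b a Y "X v"] ab by (auto simp: insert_commute)
qed

text \<open>The difference of two heights is affine and has no zero over the common part of the spans.\<close>

lemma height_less_persists:
  assumes "e \<in> E" "f \<in> E" "e \<noteq> f"
    and "X (left_end e) \<le> t" "t \<le> X (right_end e)" "X (left_end f) \<le> t" "t \<le> X (right_end f)"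
    and t': "t' \<in> span X e" "t' \<in> span X f"
    and "H e t < H f t"
  shows "H e t' < H f t'"
proof (rule ccontr)
  assume "\<not> H e t' < H f t'"
  moreover have "H e t' \<noteq> H f t'" by (rule heights_neq[OF assms(1-3) t'])
  ultimately have gt: "H e t' > H f t'" by simp
  define D where "D = H f t - H e t"
  define D' where "D' = H e t' - H f t'"
  define r where "r = D / (D + D')"
  have D: "D > 0" "D' > 0" using gt assms(10) by (auto simp: D_def D'_def)
  then have r: "0 < r" "r < 1" "r * (D + D') = D" by (auto simp: r_def)
  let ?s = "t + r * (t' - t)"
  have "H f ?s - H e ?s = D - r * (D + D')"
    unfolding height_affine D_def D'_def by (simp add: algebra_simps)
  then have "H e ?s = H f ?s" using r by simp
  moreover have "?s \<in> span X g" if "X (left_end g) \<le> t" "t \<le> X (right_end g)" "t' \<in> span X g" for g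
  proof -
    have "?s = (1 - r) * t + r * t'" by (simp add: algebra_simps)
    moreover have "(1 - r) * X (left_end g) \<le> (1 - r) * t" "r * X (left_end g) < r * t'"
      "(1 - r) * t \<le> (1 - r) * X (right_end g)" "r * t' < r * X (right_end g)"
      using that r by (auto simp: span_def)
    ultimately show ?thesis by (auto simp: span_def algebra_simps)
  qed
  ultimately show False
    using heights_neq[OF assms(1-3)] assms(4-9) by blast
qed

section \<open>The order of the edges on the sweep line\<close>

definition active :: "real \<Rightarrow> complex set set" where
  "active t = {e \<in> E. t \<in> span X e}"

definition stack :: "real \<Rightarrow> complex set list" where
  "stack t = (SOME xs. set xs = active t \<and> sorted_wrt (\<lambda>e f. H e t < H f t) xs)"

lemma stack_eq:
  assumes "set xs = active t" "sorted_wrt (\<lambda>e f. H e t < H f t) xs"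
  shows "stack t = xs"
  unfolding stack_def
  by (rule some_equality) (use assms sorted_wrt_key_unique[of "\<lambda>e. H e t"] in blast)+

text \<open>Either side of \<open>v\<close> is allowed, so that the same lemma describes the line
  just before and just after \<open>v\<close>.\<close>

definition near :: "complex \<Rightarrow> real \<Rightarrow> bool" where
  "near v t \<longleftrightarrow> t \<noteq> X v \<and> (\<forall>w\<in>V. w \<noteq> v \<longrightarrow> X w \<noteq> t \<and> (X w < t \<longleftrightarrow> X w < X v))"

definition incident :: "complex \<Rightarrow> real \<Rightarrow> complex set set" where
  "incident v t = {e \<in> star T v. t \<in> span X e}"

lemma incident_left:
  assumes "near v t" "v \<in> V" "t < X v"
  shows "incident v t = {e \<in> star T v. right_end e = v}"
proof -
  have "t \<in> span X e \<longleftrightarrow> right_end e = v" if "e \<in> star T v" for e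
  proof (rule edge_cases[OF star_edge[OF that]])
    fix a b assume ab: "e = {a, b}" "X a < X b" "left_end e = a" "right_end e = b" "a \<in> V" "b \<in> V"
    then have "v = a \<or> v = b" using that by (auto simp: star_def)
    then show ?thesis
    proof
      assume "v = a"
      then show ?thesis using ab assms by (auto simp: span_def)
    next
      assume "v = b"
      then have "X a < t" using ab assms by (auto simp: near_def)
      then show ?thesis using ab assms \<open>v = b\<close> by (auto simp: span_def)
    qed
  qed
  then show ?thesis by (auto simp: incident_def)
qed

lemma incident_right:
  assumes "near v t" "v \<in> V" "X v < t"
  shows "incident v t = {e \<in> star T v. left_end e = v}"
proof -
  have "t \<in> span X e \<longleftrightarrow> left_end e = v" if "e \<in> star T v" for e
  proof (rule edge_cases[OF star_edge[OF that]])
    fix a b assume ab: "e = {a, b}" "X a < X b" "left_end e = a" "right_end e = b" "a \<in> V" "b \<in> V"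
    then have "v = a \<or> v = b" using that by (auto simp: star_def)
    then show ?thesis
    proof
      assume "v = b"
      then show ?thesis using ab assms by (auto simp: span_def)
    next
      assume "v = a"
      then have "\<not> X b < t" "X b \<noteq> t" using ab assms by (auto simp: near_def)
      then show ?thesis using ab assms \<open>v = a\<close> by (auto simp: span_def)
    qed
  qed
  then show ?thesis by (auto simp: incident_def)
qed

lemma span_near:
  assumes "near v t" "v \<in> V" "e \<in> E" "v \<notin> e"
  shows "t \<in> span X e \<longleftrightarrow> X v \<in> span X e"
proof (rule edge_cases[OF assms(3)])
  fix a b assume ab: "e = {a, b}" "X a < X b" "left_end e = a" "right_end e = b" "a \<in> V" "b \<in> V"
  then have ne: "a \<noteq> v" "b \<noteq> v" using assms(4) by auto
  have "X b \<noteq> X v" using ne ab(6) inj_X assms(2) by (auto dest: inj_onD)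
  then show ?thesis
    using ne ab assms(1) unfolding near_def span_def by (metis greaterThanLessThan_iff linorder_less_linear order.asym)
qed

lemma star_not_span: "e \<in> star T v \<Longrightarrow> X v \<notin> span X e"
  using star_end[of e v] by (auto simp: span_def)

lemma finite_star: "finite (star T v)"
  using finite_edges by (simp add: star_def)

text \<open>All edges at \<open>v\<close> have height \<open>Y v\<close> over \<open>v\<close>, so
  near \<open>v\<close> they form one block between the edges running below \<open>v\<close> and
  those running above. By \<open>height_less_persists\<close> the order of the others is kept; only
  the block changes when the line passes \<open>v\<close>.\<close>

lemma stack_near:
  assumes "near v t" "v \<in> V"
    and P: "set P = {g \<in> active (X v). H g (X v) < Y v}" "sorted_wrt (\<lambda>e f. H e (X v) < H f (X v)) P"
    and Q: "set Q = {g \<in> active (X v). Y v < H g (X v)}" "sorted_wrt (\<lambda>e f. H e (X v) < H f (X v)) Q"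
    and M: "set M = incident v t" "sorted_wrt (\<lambda>e f. H e t < H f t) M"
  shows "stack t = P @ M @ Q"
proof (rule stack_eq)
  have off: "v \<notin> g" if "g \<in> active (X v)" for g
    using that star_not_span[of g v] by (auto simp: active_def star_def)
  have pers: "H e t < H f t" if "e \<in> active (X v)" "f \<in> active (X v)" "H e (X v) < H f (X v)" for e f
    using that off[of e] off[of f] span_near[OF assms(1,2), of e] span_near[OF assms(1,2), of f]
    by (intro height_less_persists[of e f "X v" t]) (auto simp: active_def span_def)
  have closed: "X (left_end e) \<le> X v \<and> X v \<le> X (right_end e)" if "e \<in> star T v" for e
    using star_end[OF that] edge_ends(3)[OF star_edge[OF that]] by auto
  have below: "H e t < H f t" if "e \<in> set P" "f \<in> incident v t" for e f
    using that P off[of e] span_near[OF assms(1,2), of e] closed[of f] height_end[of f v]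
    by (intro height_less_persists[of e f "X v" t]) (auto simp: active_def span_def incident_def star_def)
  have above: "H e t < H f t" if "f \<in> set Q" "e \<in> incident v t" for e f
    using that Q off[of f] span_near[OF assms(1,2), of f] closed[of e] height_end[of e v]
    by (intro height_less_persists[of e f "X v" t]) (auto simp: active_def span_def incident_def star_def)
  have PQ: "H e t < H f t" if "e \<in> set P" "f \<in> set Q" for e f
    using that P Q by (intro pers) auto
  have sP: "sorted_wrt (\<lambda>e f. H e t < H f t) P" "sorted_wrt (\<lambda>e f. H e t < H f t) Q"
    using P Q pers by (auto intro: sorted_wrt_mono_rel[OF _ P(2)] sorted_wrt_mono_rel[OF _ Q(2)])
  show "sorted_wrt (\<lambda>e f. H e t < H f t) (P @ M @ Q)"
    unfolding sorted_wrt_append set_append using sP M(2) below[folded M(1)] above[folded M(1)] PQ by blast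
  have "active t = active (X v) \<union> incident v t"
  proof -
    have "e \<in> active t \<longleftrightarrow> e \<in> active (X v) \<union> incident v t" for e
    proof (cases "e \<in> star T v")
      case True
      then show ?thesis using star_not_span[OF True] star_edge[OF True] by (simp add: active_def incident_def)
    next
      case False
      then show ?thesis using span_near[OF assms(1,2), of e] by (auto simp: active_def incident_def star_def)
    qed
    then show ?thesis by blast
  qed
  moreover have "active (X v) = set P \<union> set Q"
  proof -
    have "H g (X v) < Y v \<or> Y v < H g (X v)" if "g \<in> active (X v)" for g
      using vertex_off[OF assms(2), of g] that by (auto simp: active_def)
    then show ?thesis unfolding P(1) Q(1) by blast
  qed
  ultimately show "set (P @ M @ Q) = active t"
    using M by (simp add: Un_ac)
qed

lemma levels_exist:
  assumes "v \<in> V"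
  obtains P Q where
    "set P = {g \<in> active (X v). H g (X v) < Y v}" "sorted_wrt (\<lambda>e f. H e (X v) < H f (X v)) P"
    "set Q = {g \<in> active (X v). Y v < H g (X v)}" "sorted_wrt (\<lambda>e f. H e (X v) < H f (X v)) Q"
proof -
  have inj: "inj_on (\<lambda>g. H g (X v)) (active (X v))"
    using heights_neq by (auto simp: inj_on_def active_def)
  have fin: "finite (active (X v))" using finite_edges by (simp add: active_def)
  obtain P where "set P = {g \<in> active (X v). H g (X v) < Y v}" "sorted_wrt (\<lambda>e f. H e (X v) < H f (X v)) P"
    by (rule sorted_wrt_key_exists[of "{g \<in> active (X v). H g (X v) < Y v}" "\<lambda>g. H g (X v)"])
      (use fin inj in \<open>auto intro: inj_on_subset\<close>)
  moreover obtain Q where "set Q = {g \<in> active (X v). Y v < H g (X v)}" "sorted_wrt (\<lambda>e f. H e (X v) < H f (X v)) Q"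
    by (rule sorted_wrt_key_exists[of "{g \<in> active (X v). Y v < H g (X v)}" "\<lambda>g. H g (X v)"])
      (use fin inj in \<open>auto intro: inj_on_subset\<close>)
  ultimately show thesis by (rule that)
qed

end

text \<open>The coloring conditions for colors on edges, localized at one vertex: agreement along an
  arc and the Fox relation. Colors of arcs are recovered in
  \<open>good_coloring_exists\<close>.\<close>

definition good_at :: "tangle_data \<Rightarrow> complex \<Rightarrow> (complex set \<Rightarrow> 'a::comm_ring_1) \<Rightarrow> bool" where
  "good_at T v x \<longleftrightarrow>
     (\<forall>e e'. star T v = {e, e'} \<or> crossing T v \<and> over T v = {e, e'} \<longrightarrow> x e = x e') \<and>
     (crossing T v \<longrightarrow> (\<forall>h\<in>over T v. (\<Sum>u\<in>star T v - over T v. x u) = 2 * x h))"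

lemma crossing_card: "crossing T v \<Longrightarrow> card (star T v) = 4"
  by (auto simp: crossing_def)

lemma crossing_over: "crossing T v \<Longrightarrow> over T v \<subseteq> star T v"
  by (auto simp: crossing_def)

lemma good_at_cong:
  assumes "\<And>e. e \<in> star T v \<Longrightarrow> x e = y e"
  shows "good_at T v x \<longleftrightarrow> good_at T v y"
proof -
  have "x e = y e" if "crossing T v" "e \<in> over T v" for e
    using crossing_over that assms by blast
  then show ?thesis
    unfolding good_at_def using assms by (simp add: conj_commute cong: conj_cong)
qed

lemma good_at_end:
  assumes "card (star T v) = 1"
  shows "good_at T v x"
proof -
  obtain e where "star T v = {e}" using assms by (auto simp: card_1_singleton_iff)
  moreover have "\<not> crossing T v" using assms crossing_card by force
  ultimately show ?thesis by (auto simp: good_at_def doubleton_eq_iff)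
qed

lemma good_at_bend:
  assumes "star T v = {e, e'}" "e \<noteq> e'"
  shows "good_at T v x \<longleftrightarrow> x e = x e'"
proof -
  have "\<not> crossing T v" using assms crossing_card[of T v] by auto
  then show ?thesis using assms by (auto simp: good_at_def doubleton_eq_iff)
qed

lemma good_at_crossing:
  assumes "crossing T v" "star T v = {o1, o2, u1, u2}" "over T v = {o1, o2}"
  shows "good_at T v x \<longleftrightarrow> x o1 = x o2 \<and> x u1 + x u2 = 2 * x o1"
proof -
  have card: "card {o1, o2, u1, u2} = 4" using crossing_card[OF assms(1)] assms(2) by simp
  then have d: "distinct [o1, o2, u1, u2]"
    using card_distinct[of "[o1, o2, u1, u2]"] by simp
  have "star T v \<noteq> {e, e'}" for e e'
  proof
    assume "star T v = {e, e'}"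
    then have "card (star T v) \<le> 2" by (simp add: card_insert_if)
    then show False using crossing_card[OF assms(1)] by simp
  qed
  moreover have "star T v - {o1, o2} = {u1, u2}" using d unfolding assms by auto
  ultimately have "good_at T v x \<longleftrightarrow> (\<forall>e e'. {o1, o2} = {e, e'} \<longrightarrow> x e = x e') \<and>
      (\<forall>h\<in>{o1, o2}. (\<Sum>u\<in>{u1, u2}. x u) = 2 * x h)"
    unfolding good_at_def using assms(1,3) by (simp only: simp_thms)
  moreover have "(\<forall>e e'. {o1, o2} = {e, e'} \<longrightarrow> x e = x e') \<longleftrightarrow> x o1 = x o2"
    by (metis doubleton_eq_iff)
  moreover have "(\<Sum>u\<in>{u1, u2}. x u) = x u1 + x u2" using d by simp
  ultimately show ?thesis by auto
qed

section \<open>Passing one vertex\<close>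

context sweep
begin

definition end_edge :: "nat \<Rightarrow> complex set" where
  "end_edge i = the_elem (star T (endpt T i))"

text \<open>By \<open>ends_increasing\<close> the numbering agrees with the order of passing, so
  this list grows only at its end.\<close>

definition passed :: "real \<Rightarrow> complex set list" where
  "passed t = map end_edge (filter (\<lambda>i. X (endpt T i) < t) [1..<2*n+1])"

text \<open>Edges entirely to the right of the line have arbitrary colors in \<open>x\<close>, but
  these do not show in the list.\<close>

definition colors :: "real \<Rightarrow> 'a::comm_ring_1 list set" where
  "colors t = {map x (passed t @ stack t) | x. \<forall>w\<in>V. X w < t \<longrightarrow> good_at T w x}"

lemma end_edge_star:
  assumes "i \<in> {1..2*n}"
  shows "star T (endpt T i) = {end_edge i}"
proof -
  obtain e where "star T (endpt T i) = {e}"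
    using ends_card[OF assms] by (auto simp: card_1_singleton_iff)
  then show ?thesis by (simp add: end_edge_def)
qed

lemma height_star:
  assumes "e \<in> star T v"
  shows "H e t = Y v + slope X Y e * (t - X v)"
  using height_affine[of X Y e "X v" 1 t] height_end[OF assms] by (simp add: height_def algebra_simps)

text \<open>As \<open>v\<close> divides the strand in the same ratio in both coordinates, the strand
  enters \<open>v\<close> from the left and leaves it to the right with one slope. Hence two strands
  with distinct slopes exchange their order at \<open>v\<close>.\<close>

lemma strand:
  assumes "v \<in> open_segment a c" "{v, a} \<in> star T v" "{v, c} \<in> star T v"
  obtains l r where "{{v, a}, {v, c}} = {l, r}" "right_end l = v" "left_end r = v"
    "slope X Y l = slope X Y r"
proof -
  obtain r where r: "0 < r" "r < 1" and v: "X v = X a + r * (X c - X a)" "Y v = Y a + r * (Y c - Y a)"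
    using straight[OF assms(1)] assms(2,3) by (auto dest!: star_edge)
  have "v \<noteq> a" using assms(1) by (auto simp: open_segment_def)
  moreover have "a \<in> V" "v \<in> V" using assms(2) by (auto simp: star_def vertices_def)
  ultimately have "X v \<noteq> X a" using inj_X by (auto dest: inj_onD)
  then have ne: "X c \<noteq> X a" using v(1) by auto
  have diff: "X v - X a = r * (X c - X a)" "X c - X v = (1 - r) * (X c - X a)"
    "Y v - Y a = r * (Y c - Y a)" "Y c - Y v = (1 - r) * (Y c - Y a)"
    using v by (simp_all add: algebra_simps)
  have "r * (X c - X a) \<noteq> 0" "(1 - r) * (X c - X a) \<noteq> 0" using ne r by simp_all
  then have ne': "X a \<noteq> X v" "X v \<noteq> X c" unfolding diff(1,2)[symmetric] by simp_all
  have "slope X Y {v, a} = (Y c - Y a) / (X c - X a)"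
    unfolding insert_commute[of v a] slope_eq[of X a v Y, OF ne'(1)] diff using r by simp
  moreover have "slope X Y {v, c} = (Y c - Y a) / (X c - X a)"
    unfolding slope_eq[of X v c Y, OF ne'(2)] diff using r by simp
  ultimately have slope: "slope X Y {v, a} = slope X Y {v, c}" by simp
  show thesis
  proof (cases "X a < X c")
    case True
    then have "r * (X c - X a) > 0" "(1 - r) * (X c - X a) > 0" using r by simp_all
    then have "X a < X v" "X v < X c" unfolding diff(1,2)[symmetric] by simp_all
    then show ?thesis
      using that[of "{v, a}" "{v, c}"] slope rgt_eq[of X a v] lft_eq[of X v c] by (simp add: insert_commute)
  next
    case False
    then have "X c - X a < 0" using ne by simp
    then have "r * (X c - X a) < 0" "(1 - r) * (X c - X a) < 0" using r by (simp_all add: mult_pos_neg)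
    then have "X v < X a" "X c < X v" unfolding diff(1,2)[symmetric] by simp_all
    then show ?thesis
      using that[of "{v, c}" "{v, a}"] slope rgt_eq[of X c v] lft_eq[of X v a] by (simp add: insert_commute)
  qed
qed

lemma passed_step_other:
  assumes "near v t1" "near v t2" "v \<notin> endpt T ` {1..2*n}"
  shows "passed t2 = passed t1"
proof -
  have "X (endpt T i) < t1 \<longleftrightarrow> X (endpt T i) < t2" if "i \<in> {1..2*n}" for i
    using assms ends_vertices[OF that] that unfolding near_def by (metis image_eqI)
  then show ?thesis
    unfolding passed_def by (intro arg_cong[of _ _ "map end_edge"] filter_cong) auto
qed

lemma passed_step_end:
  assumes "near v t1" "near v t2" "t1 < X v" "X v < t2" "v = endpt T i" "i \<in> {1..2*n}"
  shows "passed t2 = passed t1 @ [end_edge i]"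
proof -
  have iff: "X (endpt T j) < t1 \<longleftrightarrow> j < i" "X (endpt T j) < t2 \<longleftrightarrow> j \<le> i" if "j \<in> {1..2*n}" for j
  proof -
    consider "j < i" | "j = i" | "i < j" by linarith
    then have "(X (endpt T j) < t1 \<longleftrightarrow> j < i) \<and> (X (endpt T j) < t2 \<longleftrightarrow> j \<le> i)"
    proof cases
      case 1
      then have "X (endpt T j) < X v"
        using strict_mono_onD[OF ends_increasing that assms(6)] assms(5) by simp
      then show ?thesis using 1 assms ends_vertices[OF that] by (auto simp: near_def)
    next
      case 2
      then show ?thesis using assms by auto
    next
      case 3
      then have "X v < X (endpt T j)"
        using strict_mono_onD[OF ends_increasing assms(6) that] assms(5) by simp
      then show ?thesis using 3 assms ends_vertices[OF that] by (auto simp: near_def)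
    qed
    then show "X (endpt T j) < t1 \<longleftrightarrow> j < i" "X (endpt T j) < t2 \<longleftrightarrow> j \<le> i" by auto
  qed
  have split: "[1..<2*n+1] = [1..<i] @ [i] @ [i+1..<2*n+1]"
    using assms(6) upt_add_eq_append[of 1 i "2 * n + 1 - i"] by (simp add: upt_conv_Cons del: upt_Suc)
  have "filter (\<lambda>j. X (endpt T j) < t1) [1..<2*n+1] = [1..<i]"
    unfolding split filter_append using assms(6) iff(1)
    by (auto simp: filter_empty_conv intro!: filter_True)
  moreover have "filter (\<lambda>j. X (endpt T j) < t2) [1..<2*n+1] = [1..<i] @ [i]"
    unfolding split filter_append using assms(6) iff(2)
    by (auto simp: filter_empty_conv intro!: filter_True)
  ultimately show ?thesis by (simp add: passed_def)
qed

text \<open>The sides on which the edges at \<open>v\<close> lie decide the move. An end changes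
  nothing if its edge comes from the left and inserts a pair if it goes to the right. A bend with
  two, one or no left edges contracts a pair, renames an edge or inserts a pair. At a crossing the
  slopes tell which strand is lower before it.\<close>

lemma colors_step:
  fixes m :: nat
  assumes v: "v \<in> V" and near: "near v t1" "near v t2" and t: "t1 < X v" "X v < t2"
    and lagr: "lagr m (colors t1 :: 'a::{finite,field} list set)"
  shows "\<exists>m. lagr m (colors t2 :: 'a list set)"
proof -
  obtain P Q where PQ:
    "set P = {g \<in> active (X v). H g (X v) < Y v}" "sorted_wrt (\<lambda>e f. H e (X v) < H f (X v)) P"
    "set Q = {g \<in> active (X v). Y v < H g (X v)}" "sorted_wrt (\<lambda>e f. H e (X v) < H f (X v)) Q"
    by (rule levels_exist[OF v])
  define R where "R = incident v t2"
  define G where "G x \<longleftrightarrow> (\<forall>w\<in>V. X w < t1 \<longrightarrow> good_at T w x)" for x :: "complex set \<Rightarrow> 'a"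
  have R: "R = {e \<in> star T v. left_end e = v}" unfolding R_def by (rule incident_right[OF near(2) v t(2)])
  have L: "incident v t1 = {e \<in> star T v. right_end e = v}" by (rule incident_left[OF near(1) v t(1)])
  have stack1: "stack t1 = P @ M @ Q" if "set M = incident v t1" "sorted_wrt (\<lambda>e f. H e t1 < H f t1) M" for M
    by (rule stack_near[OF near(1) v PQ that])
  have stack2: "stack t2 = P @ M @ Q" if "set M = R" "sorted_wrt (\<lambda>e f. H e t2 < H f t2) M" for M
    by (rule stack_near[OF near(2) v PQ that[unfolded R_def]])
  have colors1: "colors t1 = {map x (passed t1 @ stack t1) | x. G x}"
    by (simp add: colors_def G_def)
  have "(\<forall>w\<in>V. X w < t2 \<longrightarrow> good_at T w x) \<longleftrightarrow> G x \<and> good_at T v x" for x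
    using near t v unfolding G_def near_def by (metis order.asym)
  then have colors2: "colors t2 = {map x (passed t2 @ stack t2) | x. G x \<and> good_at T v x}"
    by (simp add: colors_def)
  \<comment> \<open>An edge starting at \<open>v\<close> is incident to no vertex passed before, so
    the earlier conditions do not involve its color.\<close>
  have fresh: "e \<notin> R" if "w \<in> V" "X w < t1" "e \<in> star T w" for e w
  proof
    assume e: "e \<in> R"
    then have "e \<in> E" "left_end e = v" by (auto simp: R star_def)
    moreover have "left_end e = w \<or> right_end e = w" by (rule star_end[OF that(3)])
    ultimately show False using edge_ends(3)[of e] that(2) t by auto
  qed
  have G: "\<forall>x y. (\<forall>e. e \<notin> R \<longrightarrow> x e = y e) \<longrightarrow> G x \<longrightarrow> G y"
    using fresh good_at_cong[of T] unfolding G_def by metis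
  have passed_R: "set (passed t1) \<inter> R = {}"
    using fresh[OF ends_vertices] end_edge_star by (force simp: passed_def)
  have PQ_R: "set P \<inter> R = {}" "set Q \<inter> R = {}"
    using PQ star_not_span by (auto simp: active_def R)
  have LR: "e \<notin> R" if "e \<in> incident v t1" for e
    using that edge_ends(3)[of e] unfolding L R by (auto simp: star_def)
  have LR_star: "star T v = incident v t1 \<union> R"
    using star_end unfolding L R by blast
  have inj: "inj_on (\<lambda>e. H e s) (incident v s)" for s
    using heights_neq by (auto simp: inj_on_def incident_def star_def)
  have fin: "finite (incident v s)" for s
    using finite_star by (simp add: incident_def)
  obtain M1 where M1: "set M1 = incident v t1" "sorted_wrt (\<lambda>e f. H e t1 < H f t1) M1"
    by (rule sorted_wrt_key_exists[OF fin inj])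
  obtain M2 where M2: "set M2 = R" "sorted_wrt (\<lambda>e f. H e t2 < H f t2) M2"
    unfolding R_def by (rule sorted_wrt_key_exists[OF fin inj])
  have lagr1: "lagr m {map x (passed t1 @ P @ M @ Q) | x. G x}"
    if "set M = incident v t1" "sorted_wrt (\<lambda>e f. H e t1 < H f t1) M" for M
    using lagr unfolding colors1 stack1[OF that] .
  show ?thesis
  proof (cases "v \<in> endpt T ` {1..2*n}")
    case True
    then obtain i where i: "v = endpt T i" "i \<in> {1..2*n}" by blast
    note passed = passed_step_end[OF near t i]
    define e where "e = end_edge i"
    have star: "star T v = {e}" using end_edge_star[OF i(2)] i(1) by (simp add: e_def)
    then have good: "good_at T v x" for x :: "complex set \<Rightarrow> 'a" by (intro good_at_end) simp
    have "\<not> (g \<in> active (X v) \<and> H g (X v) < Y v)" for g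
      using ends_lowest[OF i(2), of g] i(1) by (auto simp: active_def)
    then have "set P = {}" unfolding PQ(1) by blast
    then have P: "P = []" by simp
    have un: "incident v t1 \<union> R = {e}" unfolding LR_star[symmetric] by (rule star)
    then have sub: "R \<subseteq> {e}" "incident v t1 \<subseteq> {e}" by (metis Un_upper2, metis Un_upper1)
    show ?thesis
    proof (cases "e \<in> R")
      case False
      then have "R = {}" using subset_singletonD[OF sub(1)] by auto
      then have *: "R = {}" "incident v t1 = {e}" using un by simp_all
      then have "stack t2 = Q" "stack t1 = e # Q"
        using stack1[of "[e]"] stack2[of "[]"] unfolding P * by simp_all
      \<comment> \<open>The lowest edge \<open>e\<close> on the line becomes the last passed end, so
        the concatenation of the two lists is literally the same.\<close>
      then have "colors t2 = (colors t1 :: 'a list set)"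
        unfolding colors1 colors2 passed by (simp add: good e_def)
      then show ?thesis using lagr by auto
    next
      case True
      then have "R = {e}" using subset_singletonD[OF sub(1)] by auto
      then have "e \<notin> incident v t1" using LR by auto
      then have "incident v t1 = {}" using subset_singletonD[OF sub(2)] by auto
      note * = \<open>R = {e}\<close> this
      then have st: "stack t2 = [e] @ Q" "stack t1 = Q"
        using stack1[of "[]"] stack2[of "[e]"] unfolding P * by simp_all
      \<comment> \<open>The edge \<open>e\<close> appears twice: as the end just passed and as the
        lowest edge on the line.\<close>
      have "lagr (Suc m) {map x (passed t1 @ [e, e] @ Q) | x. G x \<and> x e = x e}"
        by (rule lagr_colors_cup[OF lagr[unfolded colors1 st] G passed_R PQ_R(2)]) (use * in auto)
      then have "lagr (Suc m) (colors t2 :: 'a list set)"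
        unfolding colors2 passed st by (simp add: good e_def)
      then show ?thesis by blast
    qed
  next
    case False
    note passed = passed_step_other[OF near False]
    have A: "set (passed t1 @ P) \<inter> R = {}" using passed_R PQ_R by auto
    consider "card (star T v) = 2" | "crossing T v" using vertex_cases[OF v] False by blast
    then show ?thesis
    proof cases
      case 1
      have card: "card (incident v t1) + card R = 2"
        using 1 LR fin unfolding LR_star R_def by (subst (asm) card_Un_disjoint) auto
      have dist: "distinct M1" "distinct M2"
        using M1(2) M2(2) by (auto simp: sorted_wrt_iff_nth_less distinct_conv_nth)
          (metis linorder_neqE_nat order.irrefl)+
      then have len: "length M1 + length M2 = 2"
        using card M1(1) M2(1) by (metis distinct_card)
      have "(length M1 = 2 \<and> length M2 = 0) \<or> (length M1 = 1 \<and> length M2 = 1) \<or> (length M1 = 0 \<and> length M2 = 2)"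
        using len by linarith
      then consider a b where "M1 = [a, b]" "M2 = []" | a b where "M1 = [a]" "M2 = [b]" | a b where "M1 = []" "M2 = [a, b]"
        by (auto simp: length_Suc_conv numeral_2_eq_2)
      then show ?thesis
      proof cases
        case (1 a b)
        then have "star T v = {a, b}" "a \<noteq> b" using M1 M2 LR_star dist by auto
        note good = good_at_bend[OF this]
        have "lagr m {map x ((passed t1 @ P) @ [a, b] @ Q) | x. G x}"
          using lagr1[OF M1] 1 by simp
        from lagr_colors_cap[OF this] have "lagr (m - 1) (colors t2 :: 'a list set)"
          unfolding colors2 passed good stack2[OF M2] using 1 by simp
        then show ?thesis by blast
      next
        case (2 a b)
        then have "star T v = {a, b}" using M1 M2 LR_star by auto
        moreover have ab: "a \<notin> R" "b \<in> R" using LR M1 M2 2 by auto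
        ultimately have good: "good_at T v x \<longleftrightarrow> x a = x b" for x :: "complex set \<Rightarrow> 'a"
          by (intro good_at_bend) auto
        have "lagr m {map x ((passed t1 @ P) @ [a] @ Q) | x. G x}"
          using lagr1[OF M1] 2 by simp
        from lagr_colors_replace[OF this G A PQ_R(2) ab] have "lagr m (colors t2 :: 'a list set)"
          unfolding colors2 passed good stack2[OF M2] using 2 by simp
        then show ?thesis by blast
      next
        case (3 a b)
        then have "star T v = {a, b}" "a \<noteq> b" using M1 M2 LR_star dist by auto
        note good = good_at_bend[OF this]
        have ab: "a \<in> R" "b \<in> R" using M2 3 by auto
        have "lagr m {map x ((passed t1 @ P) @ Q) | x. G x}"
          using lagr1[OF M1] 3 by simp
        from lagr_colors_cup[OF this G A PQ_R(2) ab] have "lagr (Suc m) (colors t2 :: 'a list set)"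
          unfolding colors2 passed good stack2[OF M2] using 3 by simp
        then show ?thesis by blast
      qed
    next
      case 2
      from 2[unfolded crossing_def] obtain a b c d where star: "star T v = {{v, a}, {v, b}, {v, c}, {v, d}}" "card (star T v) = 4"
        and seg: "v \<in> open_segment a c" "v \<in> open_segment b d" and over: "over T v = {{v, a}, {v, c}}"
        by (elim exE conjE) (rule that)
      obtain ol or where o: "{{v, a}, {v, c}} = {ol, or}" "right_end ol = v" "left_end or = v" "slope X Y ol = slope X Y or"
        by (rule strand[OF seg(1)]) (use star in auto)
      obtain ul ur where u: "{{v, b}, {v, d}} = {ul, ur}" "right_end ul = v" "left_end ur = v" "slope X Y ul = slope X Y ur"
        by (rule strand[OF seg(2)]) (use star in auto)
      have "star T v = {{v, a}, {v, c}} \<union> {{v, b}, {v, d}}" using star(1) by auto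
      then have star': "star T v = {ol, or, ul, ur}" unfolding o u by auto
      then have "card {ol, or, ul, ur} = 4" using star(2) by simp
      then have dist: "distinct [ol, or, ul, ur]" using card_distinct[of "[ol, or, ul, ur]"] by simp
      have good: "good_at T v x \<longleftrightarrow> x ol = x or \<and> x ul + x ur = 2 * x ol" for x :: "complex set \<Rightarrow> 'a"
        by (rule good_at_crossing[OF 2 star' over[unfolded o]])
      have mem: "or \<in> R" "ur \<in> R" "ol \<in> incident v t1" "ul \<in> incident v t1"
        using star' o(2,3) u(2,3) by (simp_all add: L R)
      have nR: "ol \<notin> R" "ul \<notin> R" by (rule LR, fact)+
      have nL: "or \<notin> incident v t1" "ur \<notin> incident v t1" using LR mem(1,2) by blast+
      have sub: "incident v t1 \<subseteq> {ol, or, ul, ur}" "R \<subseteq> {ol, or, ul, ur}"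
        unfolding star'[symmetric] LR_star by (rule Un_upper1, rule Un_upper2)
      have in1: "incident v t1 = {ol, ul}" and inR: "R = {or, ur}"
        using sub mem nR nL by blast+
      have h: "H e s = Y v + slope X Y e * (s - X v)" if "e \<in> {ol, or, ul, ur}" for e s
        by (rule height_star) (use that star' in simp)
      \<comment> \<open>All four edges have the same height over \<open>v\<close>, so equal slopes
        would give equal heights at \<open>t1\<close>.\<close>
      have "H ol t1 \<noteq> H ul t1" using inj_onD[OF inj, of ol t1 ul] in1 dist by auto
      then have "slope X Y ol \<noteq> slope X Y ul" by (auto simp: h)
      then consider "slope X Y ul < slope X Y ol" | "slope X Y ol < slope X Y ul" by linarith
      then show ?thesis
      proof cases
        case 1
        \<comment> \<open>The strand of larger slope is lower before \<open>v\<close> and higher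
          after it. Here it is the over strand, which selects \<open>twist True\<close>.\<close>
        then have "slope X Y ol * (t1 - X v) < slope X Y ul * (t1 - X v)"
          "slope X Y ul * (t2 - X v) < slope X Y ol * (t2 - X v)"
          using t by (auto simp: mult_less_cancel_right)
        then have lt: "H ol t1 < H ul t1" "H ur t2 < H or t2"
          using o(4) u(4) by (simp_all add: h)
        have "lagr m {map x ((passed t1 @ P) @ [ol, ul] @ Q) | x. G x}"
          using lagr1[of "[ol, ul]"] in1 lt by simp
        from lagr_colors_cross[OF this G A PQ_R(2) nR, of ur or True]
        have "lagr m {map x ((passed t1 @ P) @ [ur, or] @ Q) | x. G x \<and> [x ur, x or] = twist True [x ol, x ul]}"
          using inR dist by auto
        moreover have "[x ur, x or] = twist True [x ol, x ul] \<longleftrightarrow> good_at T v x" for x :: "complex set \<Rightarrow> 'a"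
          unfolding good by (auto simp: algebra_simps)
        moreover have "stack t2 = P @ [ur, or] @ Q"
          by (rule stack2) (use inR lt in auto)
        ultimately have "lagr m (colors t2 :: 'a list set)" unfolding colors2 passed by simp
        then show ?thesis by blast
      next
        case 2
        then have "slope X Y ul * (t1 - X v) < slope X Y ol * (t1 - X v)"
          "slope X Y ol * (t2 - X v) < slope X Y ul * (t2 - X v)"
          using t by (auto simp: mult_less_cancel_right)
        then have lt: "H ul t1 < H ol t1" "H or t2 < H ur t2"
          using o(4) u(4) by (simp_all add: h)
        have "lagr m {map x ((passed t1 @ P) @ [ul, ol] @ Q) | x. G x}"
          using lagr1[of "[ul, ol]"] in1 lt by (simp add: insert_commute)
        from lagr_colors_cross[OF this G A PQ_R(2) nR(2,1), of or ur False]
        have "lagr m {map x ((passed t1 @ P) @ [or, ur] @ Q) | x. G x \<and> [x or, x ur] = twist False [x ul, x ol]}"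
          using inR dist by auto
        moreover have "[x or, x ur] = twist False [x ul, x ol] \<longleftrightarrow> good_at T v x" for x :: "complex set \<Rightarrow> 'a"
          unfolding good by (auto simp: algebra_simps)
        moreover have "stack t2 = P @ [or, ur] @ Q"
          by (rule stack2) (use inR lt in auto)
        ultimately have "lagr m (colors t2 :: 'a list set)" unfolding colors2 passed by simp
        then show ?thesis by blast
      qed
    qed
  qed
qed

lemma active_none:
  assumes "(\<forall>w\<in>V. \<not> X w < t) \<or> (\<forall>w\<in>V. X w < t)"
  shows "active t = {}"
  using assms edge_ends(1,2) unfolding active_def span_def by fastforce

lemma stack_none: "active t = {} \<Longrightarrow> stack t = []"
  by (rule stack_eq) auto

text \<open>Induction on the number of passed vertices: the line is moved back across the last of
  them to a position \<open>s\<close> that is still to the right of all the others.\<close>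

lemma colors_lagr:
  assumes "t \<notin> X ` V"
  shows "\<exists>m. lagr m (colors t :: 'a::{finite,field} list set)"
  using assms
proof (induction "card {w \<in> V. X w < t}" arbitrary: t)
  case 0
  then have none: "\<forall>w\<in>V. \<not> X w < t" using finite_vertices by (auto simp: card_eq_0_iff)
  have "stack t = []" by (rule stack_none, rule active_none) (use none in blast)
  moreover have "passed t = []" using none ends_vertices by (auto simp: passed_def filter_empty_conv)
  ultimately have "colors t = {[] :: 'a list}" using none by (auto simp: colors_def)
  then show ?case using lagr_empty by metis
next
  case (Suc k)
  define D where "D = {w \<in> V. X w < t}"
  have "card D = Suc k" using Suc(2) by (simp add: D_def)
  then have D: "finite D" "D \<noteq> {}" by (metis card.infinite nat.distinct(1), metis card.empty nat.distinct(1))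
  have "Max (X ` D) \<in> X ` D" using D by (intro Max_in) auto
  then obtain v where vD: "v \<in> D" and vmax: "X v = Max (X ` D)" by auto
  have max: "X w \<le> X v" if "w \<in> D" for w using D that unfolding vmax by (intro Max_ge) auto
  have v: "v \<in> V" "X v < t" using vD by (auto simp: D_def)
  have lt: "X w < X v" if "w \<in> D" "w \<noteq> v" for w
    using max[OF that(1)] that inj_onD[OF inj_X, of w v] v(1) by (auto simp: D_def order.order_iff_strict)
  obtain s where s: "s < X v" "\<forall>w\<in>D. w \<noteq> v \<longrightarrow> X w < s"
  proof -
    \<comment> \<open>The element \<open>X v - 1\<close> keeps the set nonempty when
      \<open>v\<close> is the only vertex passed.\<close>
    let ?B = "insert (X v - 1) (X ` (D - {v}))"
    have fin: "finite ?B" "?B \<noteq> {}" using D by auto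
    have "Max ?B < X v" using lt fin by (subst Max_less_iff) auto
    then obtain s where "Max ?B < s" "s < X v" using dense by blast
    moreover from this have "\<forall>b\<in>?B. b < s" using fin by (subst (asm) Max_less_iff) auto
    ultimately show thesis using that by blast
  qed
  have "near v t"
    using Suc(3) v lt unfolding near_def D_def by (metis (mono_tags, lifting) image_eqI less_trans mem_Collect_eq order.irrefl)
  moreover have near_s: "near v s"
    unfolding near_def
  proof (intro conjI ballI impI)
    fix w assume w: "w \<in> V" "w \<noteq> v"
    have "X w \<noteq> s \<and> (X w < s \<longleftrightarrow> X w < X v)"
      using w s v lt[of w] by (cases "w \<in> D") (auto simp: D_def)
    then show "X w \<noteq> s" "X w < s \<longleftrightarrow> X w < X v" by auto
  qed (use s in simp)
  moreover have "\<exists>m. lagr m (colors s :: 'a list set)"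
  proof (rule Suc(1))
    show "s \<notin> X ` V" using near_s s v by (auto simp: near_def)
    have "{w \<in> V. X w < s} = D - {v}" using s v by (auto simp: D_def)
    then show "k = card {w \<in> V. X w < s}" using Suc(2) vD D by (simp add: D_def)
  qed
  ultimately show ?case using colors_step[OF v(1) near_s _ s(1) v(2)] by blast
qed

text \<open>To the right of all vertices the line meets no edge and all ends are passed; the length
  of the lists then identifies \<open>m\<close> with \<open>n\<close>.\<close>

theorem boundary_colors_lagr:
  "lagr n {map (x \<circ> end_edge) [1..<2*n+1] | x :: _ \<Rightarrow> 'a::{finite,field}. \<forall>v\<in>V. good_at T v x}"
proof -
  obtain t where t: "\<forall>w\<in>V. X w < t"
  proof -
    have "X w \<le> Max (X ` V)" if "w \<in> V" for w
      using finite_vertices that by (intro Max_ge) auto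
    then have "\<forall>w\<in>V. X w < Max (X ` V) + 1" by fastforce
    then show thesis by (rule that)
  qed
  then obtain m where m: "lagr m (colors t :: 'a list set)"
    using colors_lagr[of t] by auto
  have "stack t = []" by (rule stack_none, rule active_none) (use t in blast)
  moreover have "passed t = map end_edge [1..<2*n+1]"
    unfolding passed_def using t ends_vertices by (intro arg_cong[of _ _ "map end_edge"] filter_True) auto
  ultimately have eq: "colors t = {map (x \<circ> end_edge) [1..<2*n+1] | x :: _ \<Rightarrow> 'a. \<forall>v\<in>V. good_at T v x}"
    using t unfolding colors_def by (simp del: upt_Suc)
  have "2 * n = 2 * m"
    by (rule lagr_length[OF m]) (auto simp: eq simp del: upt_Suc)
  then show ?thesis using m eq by simp
qed

end

section \<open>Central projection from a point of the boundary circle\<close>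

text \<open>For \<open>b\<close> on the circle this is the signed distance of \<open>z\<close> from
  the tangent at \<open>b\<close>. It is the common denominator of the projection, positive on the
  closed disk away from \<open>b\<close>.\<close>

definition depth :: "complex \<Rightarrow> complex \<Rightarrow> real" where
  "depth b z = 1 - Re (z * cnj b)"

text \<open>
  The projective map with these two coordinates sends the base point \<open>b\<close> to infinity, the rays from
  \<open>b\<close> to vertical lines, and the unit circle to the parabola \<open>2 y = 1 + x\<^sup>2\<close> with the disk above
  it.  Hence the ends of the tangle become the lowest points of the diagram, and along the parabola
  they are met in the order of their numbers if \<open>b\<close> lies between the last and the first one.
\<close>

definition proj_x :: "real \<Rightarrow> complex \<Rightarrow> complex \<Rightarrow> real" where
  "proj_x s b z = - s * Im (z * cnj b) / depth b z"

definition proj_y :: "complex \<Rightarrow> complex \<Rightarrow> real" where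
  "proj_y b z = 1 / depth b z"

lemma depth_pos:
  assumes "norm b = 1" "norm z \<le> 1" "z \<noteq> b"
  shows "depth b z > 0"
proof -
  have n: "norm (z * cnj b) \<le> 1" using assms by (simp add: norm_mult)
  then have "Re (z * cnj b) \<le> 1" using complex_Re_le_cmod order_trans by blast
  moreover have "Re (z * cnj b) \<noteq> 1"
  proof
    assume re: "Re (z * cnj b) = 1"
    have "(norm (z * cnj b))\<^sup>2 \<le> 1" using n by (simp add: power_le_one)
    then have "Im (z * cnj b) = 0" unfolding cmod_power2 re by simp
    with re have "z * cnj b = 1" by (simp add: complex_eq_iff)
    moreover have "cnj b * b = 1"
      using complex_norm_square[of b] assms(1) by (simp add: mult.commute)
    ultimately have "z = b" by (metis mult.assoc mult.right_neutral mult_1)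
    then show False using assms(3) by simp
  qed
  ultimately show ?thesis by (simp add: depth_def)
qed

lemma depth_affine: "depth b ((1 - u) *\<^sub>R a + u *\<^sub>R c) = (1 - u) * depth b a + u * depth b c"
  by (simp add: depth_def algebra_simps)

lemma proj_inj:
  assumes "norm b = 1" "s \<noteq> 0" "depth b z \<noteq> 0" "depth b z' \<noteq> 0"
    and "proj_x s b z = proj_x s b z'" "proj_y b z = proj_y b z'"
  shows "z = z'"
proof -
  have d: "depth b z = depth b z'" using assms(3,4,6) by (simp add: proj_y_def)
  then have "Im (z * cnj b) = Im (z' * cnj b)" using assms(2,3,5) by (simp add: proj_x_def)
  moreover have "Re (z * cnj b) = Re (z' * cnj b)" using d by (simp add: depth_def)
  ultimately have "z * cnj b = z' * cnj b" by (rule complex_eqI[rotated])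
  moreover have "cnj b \<noteq> 0" using assms(1) by auto
  ultimately show ?thesis by simp
qed

text \<open>A convex combination with weight \<open>u\<close> is projected to one with weight \<open>u * p1 / P\<close>.\<close>

lemma quotient_affine:
  fixes p0 p1 q0 q1 u :: real
  assumes "p0 \<noteq> 0" "p1 \<noteq> 0" "P = (1 - u) * p0 + u * p1" "P \<noteq> 0"
  shows "((1 - u) * q0 + u * q1) / P = q0 / p0 + (u * p1 / P) * (q1 / p1 - q0 / p0)"
proof -
  have "q0 / p0 + (u * p1 / P) * (q1 / p1 - q0 / p0) = (q0 / p0 * (P - u * p1) + u * q1) / P"
    using assms(1,2,4) by (simp add: field_simps)
  also have "P - u * p1 = (1 - u) * p0" using assms(3) by simp
  also have "q0 / p0 * ((1 - u) * p0) = (1 - u) * q0" using assms(1) by simp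
  finally show ?thesis by simp
qed

text \<open>Both coordinates are quotients of affine functions by the same denominator, so one
  weight \<open>r\<close> serves for both: segments are mapped to segments.\<close>

lemma proj_affine:
  assumes "depth b a > 0" "depth b c > 0" "z = (1 - u) *\<^sub>R a + u *\<^sub>R c" "0 \<le> u" "u \<le> 1"
  defines "r \<equiv> u * depth b c / depth b z"
  shows "proj_x s b z = proj_x s b a + r * (proj_x s b c - proj_x s b a)"
    and "proj_y b z = proj_y b a + r * (proj_y b c - proj_y b a)"
    and "depth b z > 0"
proof -
  have d: "depth b z = (1 - u) * depth b a + u * depth b c"
    unfolding assms(3) by (rule depth_affine)
  show pos: "depth b z > 0"
  proof (cases "u = 0")
    case False
    then have "u * depth b c > 0" "(1 - u) * depth b a \<ge> 0" using assms by simp_all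
    then show ?thesis unfolding d by linarith
  qed (use d assms(1) in simp)
  have q: "- s * Im (z * cnj b) = (1 - u) * (- s * Im (a * cnj b)) + u * (- s * Im (c * cnj b))"
    unfolding assms(3) by (simp add: algebra_simps)
  show "proj_x s b z = proj_x s b a + r * (proj_x s b c - proj_x s b a)"
    unfolding proj_x_def r_def q by (rule quotient_affine) (use assms d pos in auto)
  have "(1 :: real) = (1 - u) * 1 + u * 1" by simp
  then show "proj_y b z = proj_y b a + r * (proj_y b c - proj_y b a)"
    unfolding proj_y_def r_def by (subst (1) \<open>1 = _\<close>, intro quotient_affine) (use assms d pos in auto)
qed

text \<open>With d the depth of \<open>z\<close>, the identity behind both parts is 1 + x^2 - 2 * y
  = (|z|^2 - 1) / d^2.\<close>

lemma proj_parabola: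
  assumes "norm b = 1" "s\<^sup>2 = 1" "depth b z > 0"
  shows "norm z \<le> 1 \<Longrightarrow> 1 + (proj_x s b z)\<^sup>2 \<le> 2 * proj_y b z"
    and "norm z = 1 \<Longrightarrow> 1 + (proj_x s b z)\<^sup>2 = 2 * proj_y b z"
proof -
  define d where "d = depth b z"
  define q where "q = Im (z * cnj b)"
  have "(norm z)\<^sup>2 = (norm (z * cnj b))\<^sup>2" using assms(1) by (simp add: norm_mult)
  also have "\<dots> = (1 - d)\<^sup>2 + q\<^sup>2" unfolding cmod_power2 by (simp add: d_def q_def depth_def)
  finally have n: "(norm z)\<^sup>2 = 1 - 2 * d + d\<^sup>2 + q\<^sup>2" by (simp add: power2_eq_square algebra_simps)
  have d: "d > 0" using assms(3) by (simp add: d_def)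
  have "1 + (proj_x s b z)\<^sup>2 = (d\<^sup>2 + q\<^sup>2) / d\<^sup>2"
    unfolding proj_x_def d_def[symmetric] q_def[symmetric]
    using d assms(2) by (simp add: power_divide power_mult_distrib field_simps)
  also have "\<dots> = (2 * d + ((norm z)\<^sup>2 - 1)) / d\<^sup>2" unfolding n by simp
  finally have e: "1 + (proj_x s b z)\<^sup>2 = 2 * proj_y b z + ((norm z)\<^sup>2 - 1) / d\<^sup>2"
    using d by (simp add: proj_y_def d_def[symmetric] add_divide_distrib power2_eq_square)
  show "1 + (proj_x s b z)\<^sup>2 = 2 * proj_y b z" if "norm z = 1" using e that by simp
  show "1 + (proj_x s b z)\<^sup>2 \<le> 2 * proj_y b z" if "norm z \<le> 1"
  proof -
    have "((norm z)\<^sup>2 - 1) / d\<^sup>2 \<le> 0" using that d by (simp add: power_le_one divide_nonpos_nonneg)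
    then show ?thesis using e by linarith
  qed
qed

text \<open>The factor \<open>s\<close> in \<open>proj_x\<close> undoes a clockwise numbering: only
  the angle from the base point in the direction of the numbering remains.\<close>

lemma proj_x_cis:
  assumes "s \<in> {1, -1}"
  shows "proj_x s (cis (s * \<beta>)) (cis (s * \<theta>)) = - (sin (\<theta> - \<beta>) / (1 - cos (\<theta> - \<beta>)))"
proof -
  have "cis (s * \<theta>) * cnj (cis (s * \<beta>)) = cis (s * (\<theta> - \<beta>))"
    by (simp add: cis_cnj cis_mult algebra_simps)
  moreover have "sin (s * d) = s * sin d" "cos (s * d) = cos d" for d using assms by auto
  moreover have "s * (s * d) = d" for d using assms by auto
  ultimately show ?thesis by (simp add: proj_x_def depth_def)
qed

text \<open>The quotient is the cotangent of half the angle, which decreases while the half angle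
  runs from 0 to pi.\<close>

lemma minus_cot_half_mono:
  fixes x y :: real
  assumes "0 < x" "x < y" "y < 2 * pi"
  shows "- (sin x / (1 - cos x)) < - (sin y / (1 - cos y))"
proof -
  have half: "sin z / (1 - cos z) = cos (z / 2) / sin (z / 2)" for z :: real
    using sin_double[of "z / 2"] cos_double_sin[of "z / 2"] by (simp add: power2_eq_square)
  have pos: "sin (x / 2) > 0" "sin (y / 2) > 0" using assms by (auto intro!: sin_gt_zero)
  have "sin (y / 2 - x / 2) > 0" using assms by (intro sin_gt_zero) auto
  then have "cos (y / 2) * sin (x / 2) < cos (x / 2) * sin (y / 2)"
    unfolding sin_diff by (simp add: mult.commute)
  then have "cos (y / 2) / sin (y / 2) < cos (x / 2) / sin (x / 2)"
    using pos by (simp add: divide_simps)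
  then show ?thesis unfolding half by simp
qed

text \<open>Equal abscissae mean that \<open>b\<close>, \<open>u\<close> and \<open>v\<close> are
  collinear, and a line meets the circle in at most two points. Algebraically, b * cnj b = 1
  eliminates \<open>cnj b\<close> and leaves a quadratic equation for \<open>b\<close>.\<close>

lemma finite_collinear_base_points:
  assumes "u \<noteq> v"
  shows "finite {b. norm b = 1 \<and> depth b u \<noteq> 0 \<and> depth b v \<noteq> 0 \<and> proj_x 1 b u = proj_x 1 b v}"
proof -
  \<comment> \<open>This is \<open>b\<close> times the difference of (1 - u * cnj b) * (1 - cnj v *
    b) and its conjugate. The coefficient \<open>v - u\<close> shows that it is not the zero
    polynomial.\<close>
  let ?p = "[:v - u, u * cnj v - cnj u * v, cnj u - cnj v:]"
  have "?p \<noteq> 0" using assms by simp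
  then have fin: "finite {b. poly ?p b = 0}" by (rule poly_roots_finite)
  have "poly ?p b = 0" if b: "norm b = 1" "depth b u \<noteq> 0" "depth b v \<noteq> 0" "proj_x 1 b u = proj_x 1 b v" for b
  proof -
    have bb: "b * cnj b = 1" using complex_norm_square[of b] b(1) by simp
    have "Im (u * cnj b) * depth b v = Im (v * cnj b) * depth b u"
      using b(2-4) by (simp add: proj_x_def field_simps)
    then have "Im ((1 - u * cnj b) * (1 - cnj v * b)) = 0"
      by (simp add: depth_def algebra_simps)
    moreover have "z = cnj z" if "Im z = 0" for z using that by (simp add: complex_eq_iff)
    ultimately have "(1 - u * cnj b) * (1 - cnj v * b) = cnj ((1 - u * cnj b) * (1 - cnj v * b))"
      by blast
    then have "(1 - u * cnj b) * (1 - cnj v * b) - (1 - cnj u * b) * (1 - v * cnj b) = 0"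
      by simp
    moreover have "(1 - u * cnj b) * (1 - cnj v * b) - (1 - cnj u * b) * (1 - v * cnj b) =
        v * cnj b - u * cnj b + (cnj u - cnj v) * b + (u * cnj v - cnj u * v) * (b * cnj b)"
      by (simp add: algebra_simps)
    ultimately have "b * (v * cnj b - u * cnj b + (cnj u - cnj v) * b + (u * cnj v - cnj u * v)) = 0"
      using bb by simp
    moreover have "b * (v * cnj b - u * cnj b + (cnj u - cnj v) * b + (u * cnj v - cnj u * v)) =
        (v - u) * (b * cnj b) + b * (u * cnj v - cnj u * v) + b * b * (cnj u - cnj v)"
      by (simp add: algebra_simps)
    ultimately show ?thesis using bb by (simp add: algebra_simps)
  qed
  then show ?thesis by (intro finite_subset[OF _ fin]) blast
qed

lemma cis_eq_imp_eq:
  assumes "cis x = cis y" "\<bar>x - y\<bar> < 2 * pi"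
  shows "x = y"
proof -
  have "cis (x - y) = 1" using assms(1) by (simp flip: cis_divide)
  then have "cos (x - y) = 1" by (metis cis.sel(1) one_complex.sel(1))
  then obtain k where k: "x - y = real_of_int k * 2 * pi" unfolding cos_one_2pi_int by auto
  then have "\<bar>real_of_int k\<bar> * (2 * pi) < 1 * (2 * pi)" using assms(2) by (simp add: abs_mult)
  then have "\<bar>real_of_int k\<bar> < 1" by (subst (asm) mult_less_cancel_right) auto
  then have "k = 0" by linarith
  then show ?thesis using k by simp
qed

text \<open>An open arc of the circle is infinite, whereas only finitely many of its points are
  vertices or collinear with two vertices.\<close>

lemma generic_base_point:
  fixes V :: "complex set"
  assumes "finite V" "V \<subseteq> cball 0 1" "s \<in> {1, -1}" "\<alpha> < \<gamma>" "\<gamma> \<le> \<alpha> + 2 * pi"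
  obtains \<beta> where "\<alpha> < \<beta>" "\<beta> < \<gamma>" "cis (s * \<beta>) \<notin> V" "inj_on (proj_x s (cis (s * \<beta>))) V"
proof -
  define C where "C u v = {b. norm b = 1 \<and> depth b u \<noteq> 0 \<and> depth b v \<noteq> 0 \<and> proj_x 1 b u = proj_x 1 b v}" for u v
  define B where "B = V \<union> (\<Union>u\<in>V. \<Union>v\<in>V - {u}. C u v)"
  have "finite B"
    unfolding B_def C_def using assms(1) by (auto intro!: finite_collinear_base_points)
  moreover have "inj_on (\<lambda>\<beta>. cis (s * \<beta>)) {\<alpha><..<\<gamma>}"
  proof (rule inj_onI)
    fix x y assume xy: "x \<in> {\<alpha><..<\<gamma>}" "y \<in> {\<alpha><..<\<gamma>}" "cis (s * x) = cis (s * y)"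
    then have "\<bar>s * x - s * y\<bar> < 2 * pi" using assms(3,5) by auto
    then have "s * x = s * y" by (rule cis_eq_imp_eq[OF xy(3)])
    then show "x = y" using assms(3) by auto
  qed
  ultimately have "finite ((\<lambda>\<beta>. cis (s * \<beta>)) -` B \<inter> {\<alpha><..<\<gamma>})" by (rule finite_vimage_IntI)
  then have "\<not> {\<alpha><..<\<gamma>} \<subseteq> (\<lambda>\<beta>. cis (s * \<beta>)) -` B \<inter> {\<alpha><..<\<gamma>}"
    using infinite_Ioo[OF assms(4)] finite_subset by blast
  then have "\<exists>\<beta>. \<beta> \<in> {\<alpha><..<\<gamma>} \<and> cis (s * \<beta>) \<notin> B" by blast
  then obtain \<beta> where \<beta>: "\<alpha> < \<beta>" "\<beta> < \<gamma>" "cis (s * \<beta>) \<notin> B" by auto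
  let ?b = "cis (s * \<beta>)"
  have notV: "?b \<notin> V" using \<beta>(3) by (simp add: B_def)
  have "inj_on (proj_x s ?b) V"
  proof (rule inj_onI, rule ccontr)
    fix u v assume uv: "u \<in> V" "v \<in> V" "proj_x s ?b u = proj_x s ?b v" "u \<noteq> v"
    have "depth ?b w \<noteq> 0" if "w \<in> V" for w
    proof -
      have "depth ?b w > 0" by (rule depth_pos) (use that assms(2) notV in auto)
      then show ?thesis by simp
    qed
    moreover have "- s * I / d = s * (- 1 * I / d)" for I d :: real by simp
    then have "proj_x s ?b w = s * proj_x 1 ?b w" for w unfolding proj_x_def .
    then have "proj_x 1 ?b u = proj_x 1 ?b v" using uv(3) assms(3) by auto
    ultimately have "?b \<in> C u v" using uv by (simp add: C_def)
    then show False using \<beta>(3) uv by (auto simp: B_def)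
  qed
  then show thesis using that \<beta> notV by blast
qed

text \<open>The disk without the base point is projected injectively and segments go to segments, so
  the embedding condition on the edges becomes the disjointness required of heights. The position of
  the base point yields the order of the ends, its genericity the injectivity of \<open>X\<close> on
  vertices.\<close>

lemma tangle_sweep:
  assumes n: "n \<ge> 1" and T: "tangle_diagram n T"
  obtains X Y where "sweep n T X Y"
proof -
  note T' = T[unfolded tangle_diagram_def]
  have fin: "finite (edges T)" and card2: "\<And>e. e \<in> edges T \<Longrightarrow> card e = 2"
    and hull: "\<And>e f. e \<in> edges T \<Longrightarrow> f \<in> edges T \<Longrightarrow> convex hull e \<inter> convex hull f = convex hull (e \<inter> f)"
    and disk: "vertices T \<subseteq> cball 0 1"
    and ends1: "\<And>v. v \<in> vertices T \<inter> sphere 0 1 \<Longrightarrow> card (star T v) = 1"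
    and inner: "\<And>v. v \<in> vertices T \<inter> ball 0 1 \<Longrightarrow> card (star T v) = 2 \<or> crossing T v"
    and ends: "vertices T \<inter> sphere 0 1 = endpt T ` {1..2*n}"
    using T' by simp_all
  have "\<exists>s \<theta>. s \<in> {1, -1} \<and> strict_mono_on {1..2*n} \<theta> \<and> \<theta> (2*n) < \<theta> 1 + 2 * pi \<and>
      (\<forall>i\<in>{1..2*n}. endpt T i = cis (s * \<theta> i))"
    using T' by (elim conjE)
  then obtain s \<theta> where s: "s \<in> {1, -1 :: real}" and mono: "strict_mono_on {1..2*n} \<theta>"
    and last: "\<theta> (2*n) < \<theta> 1 + 2 * pi" and endpt': "\<forall>i\<in>{1..2*n}. endpt T i = cis (s * \<theta> i)"
    by blast
  note endpt = bspec[OF endpt']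
  have finV: "finite (vertices T)"
    unfolding vertices_def using fin card2 by (metis card.infinite finite_Union zero_neq_numeral)
  have "mono_on {1..2*n} \<theta>" using mono by (rule strict_mono_on_imp_mono_on)
  then have le: "\<theta> 1 \<le> \<theta> i" "\<theta> i \<le> \<theta> (2*n)" if "i \<in> {1..2*n}" for i
    using that by (auto intro: mono_onD)
  \<comment> \<open>With the last angle moved back by 2 * pi, the base point lies in the gap before
    the first end, and all differences \<theta> i - \<beta> lie strictly between 0 and 2 *
    pi.\<close>
  obtain \<beta> where \<beta>: "\<theta> (2*n) - 2 * pi < \<beta>" "\<beta> < \<theta> 1" "cis (s * \<beta>) \<notin> vertices T"
      "inj_on (proj_x s (cis (s * \<beta>))) (vertices T)"
    by (rule generic_base_point[OF finV disk s, of "\<theta> (2*n) - 2 * pi" "\<theta> 1"]) (use last le(1)[of "2*n"] n in auto)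
  define b where "b = cis (s * \<beta>)"
  define X where "X = proj_x s b"
  define Y where "Y = proj_y b"
  have b: "norm b = 1" and s2: "s\<^sup>2 = 1" "s \<noteq> 0" using s by (auto simp: b_def)
  have injX: "inj_on X (vertices T)" using \<beta>(4) by (simp add: X_def b_def)
  have pos: "depth b v > 0" if "v \<in> vertices T" for v
    by (rule depth_pos[OF b]) (use that disk \<beta>(3) b_def in auto)
  have edge: "\<exists>a c. e = {a, c} \<and> X a < X c \<and> a \<in> vertices T \<and> c \<in> vertices T" if e: "e \<in> edges T" for e
  proof -
    obtain a c where ac: "e = {a, c}" "a \<noteq> c" using card2[OF e] by (meson card_2_iff)
    then have V: "a \<in> vertices T" "c \<in> vertices T" using e by (auto simp: vertices_def)
    then have "X a \<noteq> X c" using ac(2) injX by (auto dest: inj_onD)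
    then consider "X a < X c" | "X c < X a" by linarith
    then show ?thesis using ac(1) V by cases (metis, metis insert_commute)
  qed
  have point: "\<exists>z \<in> convex hull e. X z = t \<and> Y z = height X Y e t \<and> depth b z > 0 \<and> norm z \<le> 1"
    if e: "e \<in> edges T" and t: "t \<in> span X e" for e t
  proof -
    obtain a c where ac: "e = {a, c}" "X a < X c" "a \<in> vertices T" "c \<in> vertices T"
      using edge[OF e] by blast
    have t': "X a < t" "t < X c" using t ac by (simp_all add: span_def lft_eq rgt_eq)
    define r where "r = (t - X a) / (X c - X a)"
    have r: "0 < r" "r < 1" "r * (X c - X a) = t - X a" using t' by (auto simp: r_def)
    define D where "D = r * depth b a + (1 - r) * depth b c"
    \<comment> \<open>The projection changes weights; this \<open>u\<close> solves u * depth b c /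
      depth b z = r, so that \<open>z\<close> gets the prescribed abscissa.\<close>
    define u where "u = r * depth b a / D"
    have D: "D > 0" using r pos ac by (auto simp: D_def intro!: add_pos_pos)
    have u: "0 \<le> u" "u \<le> 1" using D r pos[OF ac(3)] pos[OF ac(4)] by (auto simp: u_def D_def)
    define z where "z = (1 - u) *\<^sub>R a + u *\<^sub>R c"
    note aff = proj_affine[OF pos[OF ac(3)] pos[OF ac(4)] z_def u]
    have u1: "1 - u = (1 - r) * depth b c / D" using D by (simp add: u_def D_def field_simps)
    have "depth b z = (1 - u) * depth b a + u * depth b c" unfolding z_def by (rule depth_affine)
    also have "\<dots> = ((1 - r) + r) * (depth b a * depth b c / D)"
      unfolding u1 unfolding u_def by (simp only: distrib_right) (simp add: mult_ac)
    finally have "depth b z = depth b a * depth b c / D" by simp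
    then have "u * depth b c / depth b z = r"
      using D pos[OF ac(3)] pos[OF ac(4)] by (simp add: u_def)
    then have z: "X z = X a + r * (X c - X a)" "Y z = Y a + r * (Y c - Y a)" "depth b z > 0"
      using aff by (simp_all add: X_def Y_def)
    have "X z = t" using z(1) r(3) by simp
    moreover have "Y z = height X Y e t"
      using z(2) ac(1,2) by (simp add: height_eq slope_eq r_def)
    moreover have "z \<in> convex hull e"
      unfolding ac(1) segment_convex_hull[symmetric] in_segment z_def using u by blast
    moreover have "convex hull e \<subseteq> cball 0 1" by (rule hull_minimal) (use ac disk in auto)
    moreover from calculation have "norm z \<le> 1" by (meson mem_cball_0 subsetD)
    ultimately show ?thesis using z(3) by blast
  qed
  have off_end: "X x \<notin> span X e" if "e \<in> edges T" "x \<in> e" for e x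
    using edge[OF that(1)] that(2) by (auto simp: span_def lft_eq rgt_eq)
  \<comment> \<open>Distinct edges share at most one vertex, so their segments meet in nothing or in
    that vertex.\<close>
  have meet: "\<exists>x\<in>e \<inter> f. z = x" if "e \<in> edges T" "f \<in> edges T" "e \<noteq> f" "z \<in> convex hull e" "z \<in> convex hull f" for e f z
  proof -
    have z: "z \<in> convex hull (e \<inter> f)" using hull[OF that(1,2)] that(4,5) by blast
    have fin: "finite e" "finite f"
      using card2[OF that(1)] card2[OF that(2)] by (auto intro: card_ge_0_finite)
    have "e \<inter> f \<noteq> e"
    proof
      assume "e \<inter> f = e"
      then have "e \<subseteq> f" by blast
      then have "e = f" using card_subset_eq[OF fin(2)] card2[OF that(1)] card2[OF that(2)] by simp
      then show False using that(3) by simp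
    qed
    then have "card (e \<inter> f) < card e" by (intro psubset_card_mono fin) blast
    then have "card (e \<inter> f) = 0 \<or> card (e \<inter> f) = 1" using card2[OF that(1)] by linarith
    then consider "e \<inter> f = {}" | x where "e \<inter> f = {x}"
      using fin by (auto simp: card_1_singleton_iff)
    then show ?thesis using z by cases auto
  qed
  have vertex_off: "height X Y e (X v) \<noteq> Y v" if A: "v \<in> vertices T" "e \<in> edges T" "X v \<in> span X e" for v e
  proof
    assume h: "height X Y e (X v) = Y v"
    obtain z where z: "z \<in> convex hull e" "X z = X v" "Y z = Y v" "depth b z > 0"
      using point[OF A(2,3)] h by auto
    have "z = v"
      by (rule proj_inj[OF b s2(2)]) (use z pos[OF A(1)] in \<open>auto simp: X_def Y_def\<close>)
    obtain f where f: "f \<in> edges T" "v \<in> f" using A(1) by (auto simp: vertices_def)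
    have "v \<notin> e" using off_end[OF A(2)] A(3) by blast
    then have "e \<noteq> f" using f by auto
    from meet[OF A(2) f(1) this z(1)] hull_inc[of v f convex] f \<open>z = v\<close> have "v \<in> e" by auto
    with \<open>v \<notin> e\<close> show False by simp
  qed
  have ends_V: "endpt T i \<in> vertices T \<and> norm (endpt T i) = 1" if "i \<in> {1..2*n}" for i
  proof -
    have "endpt T i \<in> vertices T \<inter> sphere 0 1" unfolding ends using that by (rule imageI)
    then show ?thesis by simp
  qed
  have "sweep n T X Y"
  proof
    show "finite (edges T)" by (rule fin)
    show "card e = 2" if "e \<in> edges T" for e by (rule card2[OF that])
    show "inj_on X (vertices T)" by (rule injX)
    show "height X Y e t \<noteq> height X Y f t"
      if A: "e \<in> edges T" "f \<in> edges T" "e \<noteq> f" "t \<in> span X e" "t \<in> span X f" for e f t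
    proof
      assume h: "height X Y e t = height X Y f t"
      obtain z where z: "z \<in> convex hull e" "X z = t" "Y z = height X Y e t" "depth b z > 0"
        using point[OF A(1,4)] by auto
      obtain z' where z': "z' \<in> convex hull f" "X z' = t" "Y z' = height X Y f t" "depth b z' > 0"
        using point[OF A(2,5)] by auto
      have "z = z'"
        by (rule proj_inj[OF b s2(2)]) (use z z' h in \<open>auto simp: X_def Y_def\<close>)
      then obtain x where "x \<in> e" "z = x" using meet[OF A(1-3) z(1)] z'(1) by auto
      then show False using off_end[OF A(1)] z(2) A(4) by auto
    qed
    show "height X Y e (X v) \<noteq> Y v" if "v \<in> vertices T" "e \<in> edges T" "X v \<in> span X e" for v e
      by (rule vertex_off[OF that])
    show "endpt T i \<in> vertices T" if "i \<in> {1..2*n}" for i using ends_V[OF that] by simp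
    show "card (star T (endpt T i)) = 1" if "i \<in> {1..2*n}" for i
      using ends_V[OF that] by (intro ends1) simp
    show "Y (endpt T i) < height X Y e (X (endpt T i))"
      if A: "i \<in> {1..2*n}" "e \<in> edges T" "X (endpt T i) \<in> span X e" for i e
    proof -
      let ?p = "endpt T i"
      have p: "?p \<in> vertices T" "norm ?p = 1" using ends_V[OF A(1)] by auto
      obtain z where z: "X z = X ?p" "Y z = height X Y e (X ?p)" "depth b z > 0" "norm z \<le> 1"
        using point[OF A(2,3)] by auto
      \<comment> \<open>The end lies on the parabola and the point of the edge on or above it;
        \<open>vertex_off\<close> then excludes equality.\<close>
      have "1 + (X ?p)\<^sup>2 = 2 * Y ?p"
        using proj_parabola(2)[OF b s2(1) pos[OF p(1)] p(2)] by (simp add: X_def Y_def)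
      moreover have "1 + (X z)\<^sup>2 \<le> 2 * Y z"
        using proj_parabola(1)[OF b s2(1) z(3) z(4)] by (simp add: X_def Y_def)
      ultimately have "Y ?p \<le> height X Y e (X ?p)" using z by simp
      then show ?thesis using vertex_off[OF p(1) A(2,3)] by simp
    qed
    show "strict_mono_on {1..2*n} (\<lambda>i. X (endpt T i))"
    proof (rule strict_mono_onI)
      fix i j assume ij: "i \<in> {1..2*n}" "j \<in> {1..2*n}" "i < j"
      have "\<theta> i < \<theta> j" by (rule strict_mono_onD[OF mono ij])
      then show "X (endpt T i) < X (endpt T j)"
        unfolding X_def b_def endpt[OF ij(1)] endpt[OF ij(2)] proj_x_cis[OF s]
        using \<beta>(1,2) le[OF ij(1)] le[OF ij(2)] by (intro minus_cot_half_mono) auto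
    qed
    show "v \<in> endpt T ` {1..2*n} \<or> card (star T v) = 2 \<or> crossing T v" if "v \<in> vertices T" for v
    proof (cases "norm v = 1")
      case True
      then have "v \<in> vertices T \<inter> sphere 0 1" using that by simp
      then show ?thesis using ends by simp
    next
      case False
      then have "v \<in> vertices T \<inter> ball 0 1" using that disk by (auto simp: order.order_iff_strict)
      then show ?thesis using inner by blast
    qed
    show "\<exists>r\<in>{0<..<1}. X v = X a + r * (X c - X a) \<and> Y v = Y a + r * (Y c - Y a)"
      if A: "v \<in> open_segment a c" "{v, a} \<in> edges T" "{v, c} \<in> edges T" for v a c
    proof -
      have V: "a \<in> vertices T" "c \<in> vertices T" using A(2,3) by (auto simp: vertices_def)
      obtain u where u: "0 < u" "u < 1" "v = (1 - u) *\<^sub>R a + u *\<^sub>R c"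
        using A(1) by (auto simp: in_segment)
      define r where "r = u * depth b c / depth b v"
      \<comment> \<open>The difference is (1 - u) * depth b a, which is positive; this gives r <
        1.\<close>
      have "depth b v > u * depth b c"
        unfolding u(3) depth_affine using u pos[OF V(1)] by simp
      moreover have "u * depth b c > 0" using u pos[OF V(2)] by simp
      ultimately have "0 < r" "r < 1" by (simp_all add: r_def)
      then show ?thesis
        using proj_affine(1,2)[OF pos[OF V(1)] pos[OF V(2)] u(3)] u(1,2)
        by (intro bexI[of _ r]) (simp_all add: X_def Y_def r_def)
    qed
  qed
  then show thesis by (rule that)
qed

section \<open>Quotients and dimensions of vector spaces\<close>

lemma submodule_abelian_subgroup:
  assumes "vectorspace K V" "LinearCombinations.submodule K L V"
  shows "abelian_subgroup L V"
proof -
  interpret V: vectorspace K V by fact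
  have sub: "L \<subseteq> carrier V" "\<zero>\<^bsub>V\<^esub> \<in> L" "\<And>x y. x \<in> L \<Longrightarrow> y \<in> L \<Longrightarrow> x \<oplus>\<^bsub>V\<^esub> y \<in> L"
    "\<And>c x. c \<in> carrier K \<Longrightarrow> x \<in> L \<Longrightarrow> c \<odot>\<^bsub>V\<^esub> x \<in> L"
    using assms(2) unfolding LinearCombinations.submodule_def by auto
  have inv: "\<ominus>\<^bsub>V\<^esub> x \<in> L" if "x \<in> L" for x
    using sub(4)[of "\<ominus>\<^bsub>K\<^esub> \<one>\<^bsub>K\<^esub>" x] that sub(1) V.smult_minus_1[of x] by auto
  have "subgroup L (add_monoid V)"
    by (rule group.subgroupI[OF V.a_group]) (use sub inv in \<open>auto simp: a_inv_def\<close>)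
  from abelian_subgroupI3[OF additive_subgroupI[OF this] V.abelian_group_axioms] show ?thesis .
qed

lemma quotient_space_carrier:
  "carrier (quotient_space V L) = (\<lambda>a. L +>\<^bsub>V\<^esub> a) ` carrier V"
  by (auto simp: quotient_space_def A_RCOSETS_def')

lemma quotient_space_add:
  assumes "vectorspace K V" "LinearCombinations.submodule K L V" "a \<in> carrier V" "b \<in> carrier V"
  shows "(L +>\<^bsub>V\<^esub> a) \<oplus>\<^bsub>quotient_space V L\<^esub> (L +>\<^bsub>V\<^esub> b) = L +>\<^bsub>V\<^esub> (a \<oplus>\<^bsub>V\<^esub> b)"
  using abelian_subgroup.a_rcos_sum[OF submodule_abelian_subgroup[OF assms(1,2)] assms(3,4)]
  by (simp add: quotient_space_def)

lemma quotient_space_zero: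
  assumes "vectorspace K V" "LinearCombinations.submodule K L V"
  shows "\<zero>\<^bsub>quotient_space V L\<^esub> = L +>\<^bsub>V\<^esub> \<zero>\<^bsub>V\<^esub>"
proof -
  interpret L: abelian_subgroup L V by (rule submodule_abelian_subgroup[OF assms])
  show ?thesis by (simp add: quotient_space_def L.a_rcos_const)
qed

text \<open>Since \<open>L\<close> is closed under scalars, all representatives give the same coset,
  and the union in the definition collapses to it.\<close>

lemma quotient_space_smult:
  assumes "vectorspace K V" "LinearCombinations.submodule K L V" "c \<in> carrier K" "a \<in> carrier V"
  shows "c \<odot>\<^bsub>quotient_space V L\<^esub> (L +>\<^bsub>V\<^esub> a) = L +>\<^bsub>V\<^esub> (c \<odot>\<^bsub>V\<^esub> a)"
proof -
  interpret V: vectorspace K V by fact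
  interpret L: abelian_subgroup L V by (rule submodule_abelian_subgroup[OF assms(1,2)])
  have "L +>\<^bsub>V\<^esub> (c \<odot>\<^bsub>V\<^esub> x) = L +>\<^bsub>V\<^esub> (c \<odot>\<^bsub>V\<^esub> a)" if x: "x \<in> L +>\<^bsub>V\<^esub> a" for x
  proof -
    obtain h where h: "h \<in> L" "x = h \<oplus>\<^bsub>V\<^esub> a" using x by (auto simp: a_r_coset_def')
    then have hV: "h \<in> carrier V" using L.a_subset by blast
    have ch: "c \<odot>\<^bsub>V\<^esub> h \<in> L"
      using assms(2,3) h(1) by (simp add: LinearCombinations.submodule_def)
    have "L +>\<^bsub>V\<^esub> (c \<odot>\<^bsub>V\<^esub> x) = L +>\<^bsub>V\<^esub> (c \<odot>\<^bsub>V\<^esub> h \<oplus>\<^bsub>V\<^esub> c \<odot>\<^bsub>V\<^esub> a)"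
      using h(2) hV assms(3,4) by (simp add: V.smult_r_distr)
    also have "\<dots> = (L +>\<^bsub>V\<^esub> (c \<odot>\<^bsub>V\<^esub> h)) +>\<^bsub>V\<^esub> (c \<odot>\<^bsub>V\<^esub> a)"
      using L.a_subset hV assms(3,4) by (intro V.a_coset_add_assoc[symmetric]) auto
    also have "L +>\<^bsub>V\<^esub> (c \<odot>\<^bsub>V\<^esub> h) = L" by (rule L.a_rcos_const[OF ch])
    finally show ?thesis .
  qed
  moreover have "a \<in> L +>\<^bsub>V\<^esub> a" using L.a_rcos_self[OF assms(4)] .
  ultimately have "(\<Union>x\<in>L +>\<^bsub>V\<^esub> a. L +>\<^bsub>V\<^esub> (c \<odot>\<^bsub>V\<^esub> x)) = L +>\<^bsub>V\<^esub> (c \<odot>\<^bsub>V\<^esub> a)" by blast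
  then show ?thesis by (simp add: quotient_space_def)
qed

lemma quotient_space_vectorspace:
  assumes "vectorspace K V" "LinearCombinations.submodule K L V"
  shows "vectorspace K (quotient_space V L)"
proof -
  interpret V: vectorspace K V by fact
  note simps = quotient_space_add[OF assms] quotient_space_zero[OF assms] quotient_space_smult[OF assms]
  let ?Q = "quotient_space V L"
  have rep: "\<exists>a\<in>carrier V. A = L +>\<^bsub>V\<^esub> a" if "A \<in> carrier ?Q" for A
    using that by (auto simp: quotient_space_carrier)
  have mem: "L +>\<^bsub>V\<^esub> a \<in> carrier ?Q" if "a \<in> carrier V" for a
    using that by (auto simp: quotient_space_carrier)
  show ?thesis
  proof (rule vs_criteria)
    show "field K" by (rule V.field_axioms)
    show "\<zero>\<^bsub>?Q\<^esub> \<in> carrier ?Q" by (simp add: simps mem)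
    show "\<forall>v w. v \<in> carrier ?Q \<and> w \<in> carrier ?Q \<longrightarrow> v \<oplus>\<^bsub>?Q\<^esub> w \<in> carrier ?Q"
      by (auto dest!: rep simp: simps mem)
    show "\<forall>v\<in>carrier ?Q. \<exists>w\<in>carrier ?Q. v \<oplus>\<^bsub>?Q\<^esub> w = \<zero>\<^bsub>?Q\<^esub>"
    proof
      fix A assume "A \<in> carrier ?Q"
      then obtain a where "a \<in> carrier V" "A = L +>\<^bsub>V\<^esub> a" using rep by blast
      then show "\<exists>w\<in>carrier ?Q. A \<oplus>\<^bsub>?Q\<^esub> w = \<zero>\<^bsub>?Q\<^esub>"
        by (intro bexI[of _ "L +>\<^bsub>V\<^esub> (\<ominus>\<^bsub>V\<^esub> a)"]) (simp_all add: simps mem V.r_neg)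
    qed
    show "\<forall>c v. c \<in> carrier K \<and> v \<in> carrier ?Q \<longrightarrow> c \<odot>\<^bsub>?Q\<^esub> v \<in> carrier ?Q"
      by (auto dest!: rep simp: simps mem)
    show "\<forall>v w. v \<in> carrier ?Q \<and> w \<in> carrier ?Q \<longrightarrow> v \<oplus>\<^bsub>?Q\<^esub> w = w \<oplus>\<^bsub>?Q\<^esub> v"
      by (auto dest!: rep simp: simps mem V.M.add.m_comm)
    show "\<forall>v w x. v \<in> carrier ?Q \<and> w \<in> carrier ?Q \<and> x \<in> carrier ?Q \<longrightarrow>
        v \<oplus>\<^bsub>?Q\<^esub> w \<oplus>\<^bsub>?Q\<^esub> x = v \<oplus>\<^bsub>?Q\<^esub> (w \<oplus>\<^bsub>?Q\<^esub> x)"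
      by (auto dest!: rep simp: simps mem V.M.add.m_assoc)
    show "\<forall>v\<in>carrier ?Q. v \<oplus>\<^bsub>?Q\<^esub> \<zero>\<^bsub>?Q\<^esub> = v"
      by (auto dest!: rep simp: simps mem)
    show "\<forall>a b v. a \<in> carrier K \<and> b \<in> carrier K \<and> v \<in> carrier ?Q \<longrightarrow>
        (a \<otimes>\<^bsub>K\<^esub> b) \<odot>\<^bsub>?Q\<^esub> v = a \<odot>\<^bsub>?Q\<^esub> (b \<odot>\<^bsub>?Q\<^esub> v)"
      by (auto dest!: rep simp: simps mem V.smult_assoc1)
    show "\<forall>v\<in>carrier ?Q. \<one>\<^bsub>K\<^esub> \<odot>\<^bsub>?Q\<^esub> v = v"
      by (auto dest!: rep simp: simps mem)
    show "\<forall>a b v. a \<in> carrier K \<and> b \<in> carrier K \<and> v \<in> carrier ?Q \<longrightarrow>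
        (a \<oplus>\<^bsub>K\<^esub> b) \<odot>\<^bsub>?Q\<^esub> v = a \<odot>\<^bsub>?Q\<^esub> v \<oplus>\<^bsub>?Q\<^esub> b \<odot>\<^bsub>?Q\<^esub> v"
      by (auto dest!: rep simp: simps mem V.smult_l_distr)
    show "\<forall>a v w. a \<in> carrier K \<and> v \<in> carrier ?Q \<and> w \<in> carrier ?Q \<longrightarrow>
        a \<odot>\<^bsub>?Q\<^esub> (v \<oplus>\<^bsub>?Q\<^esub> w) = a \<odot>\<^bsub>?Q\<^esub> v \<oplus>\<^bsub>?Q\<^esub> a \<odot>\<^bsub>?Q\<^esub> w"
      by (auto dest!: rep simp: simps mem V.smult_r_distr)
  qed
qed

text \<open>A finite carrier generates itself, so a finite basis exists, and coordinates identify
  vectors with functions from the basis to the field. This turns the count of boundary classes into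
  a dimension.\<close>

lemma (in vectorspace) card_eq_power_dim:
  assumes "finite (carrier V)"
  shows "card (carrier V) = card (carrier K) ^ dim"
proof -
  have "gen_set (carrier V)"
    using span_is_subset2[of "carrier V"] in_own_span[of "carrier V"] by auto
  then have "fin_dim" unfolding fin_dim_def using assms by blast
  then obtain B where B: "finite B" "basis B" using finite_basis_exists by blast
  then have BV: "B \<subseteq> carrier V" by (simp add: basis_def)
  have ex1: "\<exists>!a. a \<in> B \<rightarrow>\<^sub>E carrier K \<and> lincomb a B = v" if "v \<in> carrier V" for v
    using basis_criterion[OF B(1) BV] B(2) that by blast
  have closed: "lincomb a B \<in> carrier V" if "a \<in> B \<rightarrow>\<^sub>E carrier K" for a
    using BV that by (intro lincomb_closed) auto
  have "bij_betw (\<lambda>a. lincomb a B) (B \<rightarrow>\<^sub>E carrier K) (carrier V)"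
    unfolding bij_betw_def
  proof
    show "inj_on (\<lambda>a. lincomb a B) (B \<rightarrow>\<^sub>E carrier K)"
      using ex1 closed by (intro inj_onI) metis
    show "(\<lambda>a. lincomb a B) ` (B \<rightarrow>\<^sub>E carrier K) = carrier V"
      using ex1 closed by blast
  qed
  from bij_betw_same_card[OF this] show ?thesis
    using B by (simp add: card_PiE dim_basis)
qed

section \<open>The form on boundary colorings\<close>

text \<open>These are the coordinates in the basis \<open>f\<close>: position k occurs only in
  f_(k-1) and f_k, so a_k = s_(k-1) + s_k, which is solved from the left.\<close>

primrec alt_prefix :: "(nat \<Rightarrow> 'a::comm_ring_1) \<Rightarrow> nat \<Rightarrow> 'a" where
  "alt_prefix a 0 = 0"
| "alt_prefix a (Suc k) = a (Suc k) - alt_prefix a k"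

lemma neg_one_power_cancel: "(- 1 :: 'a::comm_ring_1) ^ k * ((- 1) ^ k * x) = x"
  by (simp flip: power_add mult_2 mult.assoc)

lemma alt_prefix_eq_sum: "alt_prefix a k = (- 1) ^ k * (\<Sum>i=1..k. (- 1) ^ i * a i)"
proof (induction k)
  case (Suc k)
  have "(\<Sum>i=1..Suc k. (- 1) ^ i * a i) = (\<Sum>i=1..k. (- 1) ^ i * a i) + (- 1) ^ Suc k * a (Suc k)"
    by simp
  then show ?case
    by (simp only: alt_prefix.simps Suc.IH distrib_left neg_one_power_cancel) simp
qed simp

lemma map_upt_snoc: "map c [1..<Suc (Suc k)] = map c [1..<Suc k] @ [c (Suc k)]"
  by simp

lemma alt_prefix_eq_alt: "alt_prefix a k = - ((- 1) ^ k * alt (map a [1..<Suc k]))"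
proof (induction k)
  case (Suc k)
  have "alt (map a [1..<Suc (Suc k)]) = alt (map a [1..<Suc k]) + (- 1) ^ k * a (Suc k)"
    unfolding map_upt_snoc by (simp add: alt_append del: upt_Suc)
  then show ?case
    by (simp only: alt_prefix.simps Suc.IH distrib_left power_Suc mult.assoc neg_one_power_cancel) simp
qed simp

lemma alt_prefix_boundary:
  assumes "a \<in> alternating n"
  shows "alt_prefix a (2 * n) = 0"
  using assms by (simp add: alternating_def alt_prefix_eq_sum)

text \<open>The alternating sum of the first k entries is the prefix at k up to sign. Hence entry k
  + 1 contributes the prefix of \<open>a\<close> at k times b_(k+1), minus the same with
  \<open>a\<close> and \<open>b\<close> exchanged. Writing the new entries as sums of two prefixes
  cancels the products at k.\<close>

lemma alt_form_eq_prefix: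
  "alt_form (map a [1..<Suc k]) (map b [1..<Suc k]) =
    (\<Sum>i<k. alt_prefix a i * alt_prefix b (Suc i) - alt_prefix a (Suc i) * alt_prefix b i)"
proof (induction k)
  case (Suc k)
  have "alt (map c [1..<Suc k]) = - ((- 1) ^ k * alt_prefix c k)" for c :: "nat \<Rightarrow> 'a"
    unfolding alt_prefix_eq_alt by (simp add: neg_one_power_cancel)
  then have "alt_form (map a [1..<Suc k] @ [a (Suc k)]) (map b [1..<Suc k] @ [b (Suc k)]) =
      alt_form (map a [1..<Suc k]) (map b [1..<Suc k]) + (alt_prefix a k * b (Suc k) - alt_prefix b k * a (Suc k))"
    by (subst alt_form_append) (simp_all add: right_diff_distrib mult.assoc neg_one_power_cancel del: upt_Suc)
  then show ?case
    unfolding map_upt_snoc Suc.IH by (simp add: algebra_simps)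
qed simp

lemma class_ring_ring: "ring (class_ring :: 'a::ring_1 ring)"
  by (rule class_ring.ring_axioms)

lemma f_basis_sum:
  fixes s :: "nat \<Rightarrow> 'p::prime_card mod_ring"
  assumes i: "i \<in> {1..2*n}"
  shows "(\<Sum>k=1..2*n-1. s k * bvec_f n k i) = (if i \<le> 2*n-1 then s i else 0) + (if 2 \<le> i then s (i - 1) else 0)"
proof -
  have f: "bvec_f n k i = (if k = i then 1 else 0) + (if k = i - 1 then 1 else 0)" if "k \<in> {1..2*n-1}" for k
    using i that unfolding bvec_f_def bvec_e_def ring.func_space_def[OF class_ring_ring] by auto
  have "(\<Sum>k=1..2*n-1. s k * bvec_f n k i) =
      (\<Sum>k=1..2*n-1. (if k = i then s k else 0) + (if k = i - 1 then s k else 0))"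
  proof (intro sum.cong refl)
    fix k assume "k \<in> {1..2*n-1}"
    show "s k * bvec_f n k i = (if k = i then s k else 0) + (if k = i - 1 then s k else 0)"
      unfolding f[OF \<open>k \<in> _\<close>] by (simp add: distrib_left)
  qed
  also have "\<dots> = (if i \<le> 2*n-1 then s i else 0) + (if 2 \<le> i then s (i - 1) else 0)"
    using i by (auto simp: sum.distrib)
  finally show ?thesis .
qed

text \<open>Positions 1 to 2n - 1 determine the coordinates recursively. The equation at 2n holds
  because the prefix there is zero, which is the alternating condition.\<close>

lemma f_coords_eq:
  fixes a :: "nat \<Rightarrow> 'p::prime_card mod_ring"
  assumes "a \<in> alternating n"
  shows "f_coords n a = (\<lambda>k\<in>{1..2*n-1}. alt_prefix a k)"
  unfolding f_coords_def
proof (rule the_equality)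
  let ?s = "\<lambda>k\<in>{1..2*n-1}. alt_prefix a k"
  have fit: "a i = (\<Sum>k=1..2*n-1. ?s k * bvec_f n k i)" if i: "i \<in> {1..2*n}" for i
  proof -
    obtain j where j: "i = Suc j" using i by (cases i) auto
    have "alt_prefix a (2 * n) = 0" by (rule alt_prefix_boundary[OF assms])
    then have "(if i \<le> 2*n-1 then ?s i else 0) = alt_prefix a i"
      using i by (cases "i = 2 * n") auto
    moreover have "(if 2 \<le> i then ?s (i - 1) else 0) = alt_prefix a j"
      using i j by (cases j) auto
    ultimately show ?thesis unfolding f_basis_sum[OF i] by (simp only:) (simp add: j)
  qed
  show "?s \<in> {1..2*n-1} \<rightarrow>\<^sub>E UNIV \<and> (\<forall>i\<in>{1..2*n}. a i = (\<Sum>k=1..2*n-1. ?s k * bvec_f n k i))"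
  proof
    show "?s \<in> {1..2*n-1} \<rightarrow>\<^sub>E UNIV" by (auto simp: PiE_def)
  qed (rule ballI, rule fit)
next
  fix s assume s: "s \<in> {1..2*n-1} \<rightarrow>\<^sub>E UNIV \<and> (\<forall>i\<in>{1..2*n}. a i = (\<Sum>k=1..2*n-1. s k * bvec_f n k i))"
  have eq: "a i = (if i \<le> 2*n-1 then s i else 0) + (if 2 \<le> i then s (i - 1) else 0)" if "i \<in> {1..2*n}" for i
    using s that f_basis_sum[OF that, of s] by simp
  have "s k = alt_prefix a k" if "1 \<le> k" "k \<le> 2*n-1" for k
    using that
  proof (induction k)
    case (Suc k)
    then show ?case using eq[of "Suc k"] by (cases k) auto
  qed simp
  then show "s = (\<lambda>k\<in>{1..2*n-1}. alt_prefix a k)"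
    using s by (intro extensionalityI[of _ "{1..2*n-1}"]) (auto simp: PiE_def)
qed

lemma sum_phi_f:
  fixes S T :: "nat \<Rightarrow> 'p::prime_card mod_ring"
  assumes "i \<in> {1..m}"
  shows "(\<Sum>j=1..m. S i * T j * phi_f i j) = S i * ((if i < m then T (Suc i) else 0) - (if 2 \<le> i then T (i - 1) else 0))"
proof -
  have "S i * T j * phi_f i j = (if j = Suc i then S i * T j else 0) - (if j = i - 1 then S i * T j else 0)"
    if "j \<in> {1..m}" for j
    using that assms by (auto simp: phi_f_def)
  then have "(\<Sum>j=1..m. S i * T j * phi_f i j) =
      (\<Sum>j=1..m. (if j = Suc i then S i * T j else 0) - (if j = i - 1 then S i * T j else 0))"
    by (intro sum.cong) auto
  also have "\<dots> = S i * ((if i < m then T (Suc i) else 0) - (if 2 \<le> i then T (i - 1) else 0))"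
    using assms by (auto simp: sum_subtractf algebra_simps)
  finally show ?thesis .
qed

lemma summation_shift:
  fixes S T :: "nat \<Rightarrow> 'a::comm_ring_1"
  assumes "S 0 = 0"
  shows "(\<Sum>i=1..m. S i * (T (Suc i) - T (i - 1))) =
    (\<Sum>i<Suc m. S i * T (Suc i) - S (Suc i) * T i) + S (Suc m) * T m"
  using assms by (induction m) (auto simp: algebra_simps)

text \<open>The basis pairs only neighbours, so \<open>phi\<close> is the sum of S_i * (T_(i+1) -
  T_(i-1)). As the prefixes vanish at 0 and 2n, summation by parts gives the expression in
  \<open>alt_form_eq_prefix\<close>.\<close>

lemma phi_eq_alt_form:
  fixes a b :: "nat \<Rightarrow> 'p::prime_card mod_ring"
  assumes "n \<ge> 1" "a \<in> alternating n" "b \<in> alternating n"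
  shows "phi n a b = alt_form (map a [1..<2*n+1]) (map b [1..<2*n+1])"
proof -
  define S where "S = alt_prefix a"
  define T where "T = alt_prefix b"
  define m where "m = 2 * n - 1"
  have m: "2 * n = Suc m" using assms(1) by (simp add: m_def)
  have ends: "S 0 = 0" "T 0 = 0" "S (Suc m) = 0" "T (Suc m) = 0"
    using alt_prefix_boundary[OF assms(2)] alt_prefix_boundary[OF assms(3)] m by (simp_all add: S_def T_def)
  have "phi n a b = (\<Sum>i=1..m. \<Sum>j=1..m. S i * T j * phi_f i j)"
    unfolding phi_def f_coords_eq[OF assms(2)] f_coords_eq[OF assms(3)] m_def S_def T_def
    by (intro sum.cong) auto
  also have "\<dots> = (\<Sum>i=1..m. S i * (T (Suc i) - T (i - 1)))"
  proof (intro sum.cong refl)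
    fix i assume i: "i \<in> {1..m}"
    have "(if i < m then T (Suc i) else 0) = T (Suc i)" using i ends by (cases "i = m") auto
    moreover have "(if 2 \<le> i then T (i - 1) else 0) = T (i - 1)" using i ends by (cases "i = 1") auto
    ultimately show "(\<Sum>j=1..m. S i * T j * phi_f i j) = S i * (T (Suc i) - T (i - 1))"
      unfolding sum_phi_f[OF i] by simp
  qed
  also have "\<dots> = (\<Sum>i<Suc m. S i * T (Suc i) - S (Suc i) * T i)"
    unfolding summation_shift[of S, OF ends(1)] using ends by simp
  also have "\<dots> = alt_form (map a [1..<2*n+1]) (map b [1..<2*n+1])"
    unfolding Suc_eq_plus1[symmetric] alt_form_eq_prefix m S_def T_def by simp
  finally show ?thesis .
qed

lemma alternating_iff_alt:
  "a \<in> alternating n \<longleftrightarrow> a \<in> {1..2*n} \<rightarrow>\<^sub>E UNIV \<and> alt (map a [1..<2*n+1]) = 0"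
proof -
  have "(\<Sum>i=1..2*n. (- 1) ^ i * a i) = alt_prefix a (2 * n)" by (simp add: alt_prefix_eq_sum)
  also have "\<dots> = - alt (map a [1..<2*n+1])" unfolding alt_prefix_eq_alt by (simp del: upt_Suc)
  finally show ?thesis by (simp add: alternating_def)
qed

lemma alt_replicate: "alt (replicate k c) = (if even k then 0 else c)"
  by (induction k) auto

text \<open>For even length a constant pairs with \<open>b\<close> through \<open>alt b\<close>
  alone, so constants lie in the radical on alternating sequences.\<close>

lemma alt_form_replicate:
  "alt_form (replicate (length b) c) b = (if even (length b) then - (c * alt b) else 0)"
  by (induction b) (auto simp: alt_replicate algebra_simps)

section \<open>Colorings of arcs and of edges\<close>

lemma sym_arc_step: "sym (arc_step T)"
  by (auto simp: sym_def arc_step_def insert_commute)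

lemma arc_of_eq:
  assumes "(e, f) \<in> (arc_step T)\<^sup>*"
  shows "arc_of T e = arc_of T f"
proof -
  have "(f, e) \<in> (arc_step T)\<^sup>*"
    using symD[OF sym_rtrancl[OF sym_arc_step]] assms by blast
  then show ?thesis
    using assms unfolding arc_of_def by (auto intro: rtrancl_trans)
qed

lemma crossing_vertex:
  assumes "crossing T v"
  shows "v \<in> vertices T"
proof -
  have "star T v \<noteq> {}" using crossing_card[OF assms] by auto
  then show ?thesis by (auto simp: star_def vertices_def)
qed

lemma coloring_good_at:
  assumes "c \<in> colorings T" "v \<in> vertices T"
  shows "good_at T v (\<lambda>e. c (arc_of T e))"
  unfolding good_at_def
proof (intro conjI allI impI)
  fix e e' assume "star T v = {e, e'} \<or> crossing T v \<and> over T v = {e, e'}"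
  then have "(e, e') \<in> arc_step T" using assms(2) by (auto simp: arc_step_def)
  then have "arc_of T e = arc_of T e'" by (intro arc_of_eq r_into_rtrancl)
  then show "c (arc_of T e) = c (arc_of T e')" by simp
next
  assume "crossing T v"
  then show "\<forall>h\<in>over T v. (\<Sum>u\<in>star T v - over T v. c (arc_of T u)) = 2 * c (arc_of T h)"
    using assms(1) by (simp add: colorings_def)
qed

text \<open>Goodness makes \<open>x\<close> constant along \<open>arc_step\<close>, hence on each
  arc, so the value at an arbitrarily chosen edge of the arc is the color of all its edges.\<close>

lemma good_coloring_exists:
  fixes x :: "complex set \<Rightarrow> 'p::prime_card mod_ring"
  assumes "\<forall>v\<in>vertices T. good_at T v x"
  obtains c where "c \<in> colorings T" "\<forall>e\<in>edges T. c (arc_of T e) = x e"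
proof -
  have const: "x e = x f" if "(e, f) \<in> (arc_step T)\<^sup>*" for e f
    using that
  proof induction
    case (step f g)
    then obtain v where "v \<in> vertices T" "star T v = {f, g} \<or> crossing T v \<and> over T v = {f, g}"
      by (auto simp: arc_step_def)
    then have "x f = x g" using assms unfolding good_at_def by blast
    then show ?case using step by simp
  qed simp
  define c where "c = (\<lambda>A\<in>arcs T. x (SOME e. e \<in> A))"
  have c: "c (arc_of T e) = x e" if "e \<in> edges T" for e
  proof -
    have "e \<in> arc_of T e" by (simp add: arc_of_def)
    then have "(SOME f. f \<in> arc_of T e) \<in> arc_of T e" by (rule someI)
    then have "(e, SOME f. f \<in> arc_of T e) \<in> (arc_step T)\<^sup>*" by (simp add: arc_of_def)
    then have "x e = x (SOME f. f \<in> arc_of T e)" by (rule const)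
    then show ?thesis using that by (simp add: c_def arcs_def)
  qed
  have "c \<in> colorings T"
    unfolding colorings_def
  proof (intro CollectI conjI allI impI ballI)
    show "c \<in> arcs T \<rightarrow>\<^sub>E UNIV" by (auto simp: c_def PiE_def)
    fix v h assume v: "crossing T v" and h: "h \<in> over T v"
    have "h \<in> edges T" using h crossing_over[OF v] by (auto simp: star_def)
    moreover have "(\<Sum>u\<in>star T v - over T v. c (arc_of T u)) = (\<Sum>u\<in>star T v - over T v. x u)"
      by (intro sum.cong refl c) (auto simp: star_def)
    moreover have "(\<Sum>u\<in>star T v - over T v. x u) = 2 * x h"
      using assms crossing_vertex[OF v] v h unfolding good_at_def by blast
    ultimately show "(\<Sum>u\<in>star T v - over T v. c (arc_of T u)) = 2 * c (arc_of T h)"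
      using c by simp
  qed
  then show thesis using c by (intro that) auto
qed

section \<open>The space of boundary colorings\<close>

lemma fun_space_vectorspace: "vectorspace Zp (fun_space I)"
  unfolding vectorspace_def
  using cring.func_space_is_module[OF class_cring.cring_axioms] class_field by blast

lemma alt_space_simps:
  "carrier (alt_space n) = alternating n"
  "a \<oplus>\<^bsub>alt_space n\<^esub> b = (\<lambda>i\<in>{1..2*n}. a i + b i)"
  "\<zero>\<^bsub>alt_space n\<^esub> = (\<lambda>i\<in>{1..2*n}. 0)"
  "r \<odot>\<^bsub>alt_space n\<^esub> a = (\<lambda>i\<in>{1..2*n}. r * a i)"
  by (simp_all add: alt_space_def ring.func_space_def[OF class_ring_ring])

lemma alternating_submodule: "LinearCombinations.submodule Zp (alternating n) (fun_space {1..2*n})"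
  unfolding LinearCombinations.submodule_def ring.func_space_def[OF class_ring_ring]
  using vectorspace.axioms(1)[OF fun_space_vectorspace, of "{1..2*n}", unfolded ring.func_space_def[OF class_ring_ring]]
  by (auto simp: alternating_def algebra_simps sum.distrib simp flip: sum_distrib_left)

lemma alt_space_vectorspace: "vectorspace Zp (alt_space n)"
  unfolding alt_space_def
  by (intro vectorspace.subspace_is_vs subspace.intro fun_space_vectorspace alternating_submodule)

lemma boundary_list_inj:
  assumes "a \<in> {1..2*n} \<rightarrow>\<^sub>E UNIV" "b \<in> {1..2*n} \<rightarrow>\<^sub>E UNIV"
    and "map a [1..<2*n+1] = map b [1..<2*n+1]"
  shows "a = b"
proof (rule PiE_ext[OF assms(1,2)])
  fix i assume "i \<in> {1..2*n}"
  then have "i \<in> set [1..<2*n+1]" by auto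
  then show "a i = b i" using assms(3) unfolding map_eq_conv by blast
qed

lemma boundary_list_const: "map (\<lambda>i\<in>{1..2*n}. x) [1..<2*n+1] = replicate (2 * n) x"
  by (rule nth_equalityI) (auto simp del: upt_Suc)

lemma boundary_list_lin_comb:
  "map (\<lambda>i\<in>{1..2*n}. r * a i + s * b i) [1..<2*n+1] =
     lin_comb r (map a [1..<2*n+1]) s (map b [1..<2*n+1])"
  by (rule nth_equalityI) (auto simp: lin_comb_def simp del: upt_Suc)

lemma const_alternating: "(\<lambda>i\<in>{1..2*n}. x) \<in> alternating n"
  unfolding alternating_iff_alt boundary_list_const by (auto simp: alt_replicate PiE_def)

lemma phi_const:
  fixes b :: "nat \<Rightarrow> 'p::prime_card mod_ring"
  assumes "n \<ge> 1" "b \<in> alternating n"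
  shows "phi n (\<lambda>i\<in>{1..2*n}. x) b = 0"
proof -
  have "alt (map b [1..<2*n+1]) = 0" using assms(2) unfolding alternating_iff_alt by blast
  then show ?thesis
    using alt_form_replicate[of "map b [1..<2*n+1]" x]
    unfolding phi_eq_alt_form[OF assms(1) const_alternating assms(2)] boundary_list_const
    by (simp del: upt_Suc)
qed

lemma phi_skew:
  fixes a b :: "nat \<Rightarrow> 'p::prime_card mod_ring"
  assumes "n \<ge> 1" "a \<in> alternating n" "b \<in> alternating n"
  shows "phi n b a = - phi n a b"
  unfolding phi_eq_alt_form[OF assms] phi_eq_alt_form[OF assms(1,3,2)]
  by (rule alt_form_skew) simp

lemma alternating_lin_comb:
  assumes "a \<in> alternating n" "b \<in> alternating n"
  shows "(\<lambda>i\<in>{1..2*n}. r * a i + s * b i) \<in> alternating n"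
  using assms unfolding alternating_iff_alt boundary_list_lin_comb
  by (auto simp: alt_lin_comb PiE_def simp del: upt_Suc)

lemma phi_lin_comb:
  fixes a b c :: "nat \<Rightarrow> 'p::prime_card mod_ring"
  assumes "n \<ge> 1" "a \<in> alternating n" "b \<in> alternating n" "c \<in> alternating n"
  shows "phi n (\<lambda>i\<in>{1..2*n}. r * a i + s * b i) c = r * phi n a c + s * phi n b c"
  unfolding phi_eq_alt_form[OF assms(1) alternating_lin_comb[OF assms(2,3)] assms(4)]
    phi_eq_alt_form[OF assms(1,2,4)] phi_eq_alt_form[OF assms(1,3,4)] boundary_list_lin_comb
  by (rule alt_form_lin_comb) simp_all

lemma monochromatic_submodule:
  "LinearCombinations.submodule Zp (monochromatic n) (alt_space n)"
  unfolding LinearCombinations.submodule_def alt_space_simps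
proof (intro conjI allI impI)
  show "module Zp (alt_space n)" by (rule vectorspace.axioms(1)[OF alt_space_vectorspace])
  show "monochromatic n \<subseteq> alternating n" using const_alternating unfolding monochromatic_def by blast
qed (auto simp: monochromatic_def restrict_def fun_eq_iff intro!: rangeI)

lemma symp_space_vectorspace: "vectorspace Zp (symp_space n)"
  unfolding symp_space_def
  by (rule quotient_space_vectorspace[OF alt_space_vectorspace monochromatic_submodule])

abbreviation boundary_class :: "nat \<Rightarrow> (nat \<Rightarrow> 'p::prime_card mod_ring) \<Rightarrow> (nat \<Rightarrow> 'p mod_ring) set" where
  "boundary_class n a \<equiv> monochromatic n +>\<^bsub>alt_space n\<^esub> a"

lemma boundary_class_eq: "boundary_class n a = range (\<lambda>x. \<lambda>i\<in>{1..2*n}. x + a i)"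
  by (auto simp: a_r_coset_def' alt_space_simps monochromatic_def fun_eq_iff restrict_def image_iff)

lemma boundary_class_shift: "boundary_class n (\<lambda>i\<in>{1..2*n}. x + a i) = boundary_class n a"
proof -
  have "range (\<lambda>y. \<lambda>i\<in>{1..2*n}. y + (\<lambda>i\<in>{1..2*n}. x + a i) i) = (\<lambda>y. \<lambda>i\<in>{1..2*n}. y + a i) ` range (\<lambda>y. y + x)"
    unfolding image_image by (intro image_cong refl restrict_ext) (simp add: add.assoc)
  also have "range (\<lambda>y. y + x) = UNIV" by (rule surjI[of _ "\<lambda>y. y - x"]) simp
  finally show ?thesis unfolding boundary_class_eq .
qed

text \<open>Since constants lie in the radical, \<open>phi\<close> takes a single value on the
  product of the two classes.\<close>

lemma phi_hat_boundary_class: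
  fixes a b :: "nat \<Rightarrow> 'p::prime_card mod_ring"
  assumes "n \<ge> 1" "a \<in> alternating n" "b \<in> alternating n"
  shows "phi_hat n (boundary_class n a) (boundary_class n b) = phi n a b"
proof -
  have shift: "(\<lambda>i\<in>{1..2*n}. x + a i) = (\<lambda>i\<in>{1..2*n}. 1 * (\<lambda>i\<in>{1..2*n}. x) i + 1 * a i)"
    for x and a :: "nat \<Rightarrow> 'p mod_ring" by (auto simp: restrict_def)
  have mem: "(\<lambda>i\<in>{1..2*n}. x + a i) \<in> alternating n" if "a \<in> alternating n" for x and a :: "nat \<Rightarrow> 'p mod_ring"
    unfolding shift by (rule alternating_lin_comb[OF const_alternating that])
  have left: "phi n (\<lambda>i\<in>{1..2*n}. x + a i) b = phi n a b"
    if "a \<in> alternating n" "b \<in> alternating n" for x and a b :: "nat \<Rightarrow> 'p mod_ring"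
    unfolding shift phi_lin_comb[OF assms(1) const_alternating that] phi_const[OF assms(1) that(2)] by simp
  have "phi n (\<lambda>i\<in>{1..2*n}. x + a i) (\<lambda>i\<in>{1..2*n}. y + b i) = phi n a b" for x y
  proof -
    have "phi n (\<lambda>i\<in>{1..2*n}. x + a i) (\<lambda>i\<in>{1..2*n}. y + b i) = phi n a (\<lambda>i\<in>{1..2*n}. y + b i)"
      by (rule left[OF assms(2) mem[OF assms(3)]])
    also have "\<dots> = - phi n (\<lambda>i\<in>{1..2*n}. y + b i) a"
      by (rule phi_skew[OF assms(1) mem[OF assms(3)] assms(2)])
    also have "\<dots> = phi n a b"
      unfolding left[OF assms(3,2)] by (rule phi_skew[OF assms(1,3,2), symmetric])
    finally show ?thesis .
  qed
  then have all: "phi n a' b' = phi n a b" if "a' \<in> boundary_class n a" "b' \<in> boundary_class n b" for a' b'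
    using that unfolding boundary_class_eq by blast
  have "(\<lambda>(a, b). phi n a b) ` (boundary_class n a \<times> boundary_class n b) =
      (\<lambda>_. phi n a b) ` (boundary_class n a \<times> boundary_class n b)"
    by (intro image_cong refl) (use all in auto)
  also have "\<dots> = {phi n a b}" unfolding boundary_class_eq by (simp add: image_constant_conv)
  finally have "(\<lambda>(a, b). phi n a b) ` (boundary_class n a \<times> boundary_class n b) = {phi n a b}" .
  then show ?thesis by (simp add: phi_hat_def)
qed

context sweep
begin

definition boundary_colorings :: "(nat \<Rightarrow> 'p::prime_card mod_ring) set" where
  "boundary_colorings = psi n T ` colorings T"

lemma end_edge_edges: "i \<in> {1..2*n} \<Longrightarrow> end_edge i \<in> edges T"
  using end_edge_star by (auto simp: star_def)

lemma end_arc_eq: "end_arc T i = arc_of T (end_edge i)"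
  by (simp add: end_arc_def end_edge_def)

lemma boundary_lists:
  "(\<lambda>a. map a [1..<2*n+1]) ` boundary_colorings =
    {map (x \<circ> end_edge) [1..<2*n+1] | x :: _ \<Rightarrow> 'p::prime_card mod_ring. \<forall>v\<in>V. good_at T v x}"
proof (intro equalityI subsetI)
  fix z assume "z \<in> (\<lambda>a. map a [1..<2*n+1]) ` (boundary_colorings :: (nat \<Rightarrow> 'p mod_ring) set)"
  then obtain c :: "complex set set \<Rightarrow> 'p mod_ring" where c: "c \<in> colorings T" "z = map (psi n T c) [1..<2*n+1]"
    unfolding boundary_colorings_def by blast
  have "z = map ((\<lambda>e. c (arc_of T e)) \<circ> end_edge) [1..<2*n+1]"
    unfolding c(2) by (intro map_cong) (auto simp: psi_def end_arc_eq)
  moreover have "\<forall>v\<in>V. good_at T v (\<lambda>e. c (arc_of T e))" using coloring_good_at[OF c(1)] by blast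
  ultimately show "z \<in> {map (x \<circ> end_edge) [1..<2*n+1] | x. \<forall>v\<in>V. good_at T v x}" by blast
next
  fix z assume "z \<in> {map (x \<circ> end_edge) [1..<2*n+1] | x :: _ \<Rightarrow> 'p mod_ring. \<forall>v\<in>V. good_at T v x}"
  then obtain x :: "_ \<Rightarrow> 'p mod_ring" where x: "z = map (x \<circ> end_edge) [1..<2*n+1]" "\<forall>v\<in>V. good_at T v x" by blast
  obtain c where c: "c \<in> colorings T" "\<forall>e\<in>edges T. c (arc_of T e) = x e"
    by (rule good_coloring_exists[OF x(2)])
  have "z = map (psi n T c) [1..<2*n+1]"
    unfolding x(1) by (intro map_cong) (auto simp: psi_def end_arc_eq bspec[OF c(2) end_edge_edges])
  then show "z \<in> (\<lambda>a. map a [1..<2*n+1]) ` boundary_colorings"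
    using c(1) unfolding boundary_colorings_def by blast
qed

lemma lagr_boundary_lists:
  "lagr n ((\<lambda>a. map a [1..<2*n+1]) ` (boundary_colorings :: (nat \<Rightarrow> 'p::prime_card mod_ring) set))"
  unfolding boundary_lists by (rule boundary_colors_lagr)

lemma boundary_colorings_PiE: "a \<in> boundary_colorings \<Longrightarrow> a \<in> {1..2*n} \<rightarrow>\<^sub>E UNIV"
  by (auto simp: boundary_colorings_def psi_def PiE_def)

lemma boundary_list_mem:
  assumes "a \<in> {1..2*n} \<rightarrow>\<^sub>E UNIV"
    and "map a [1..<2*n+1] \<in> (\<lambda>a. map a [1..<2*n+1]) ` boundary_colorings"
  shows "a \<in> boundary_colorings"
proof -
  obtain b where "b \<in> boundary_colorings" "map a [1..<2*n+1] = map b [1..<2*n+1]"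
    using assms(2) by blast
  then show ?thesis using boundary_list_inj[OF assms(1) boundary_colorings_PiE] by metis
qed

lemma boundary_colorings_alternating: "a \<in> boundary_colorings \<Longrightarrow> a \<in> alternating n"
  unfolding alternating_iff_alt
  using boundary_colorings_PiE lagrD(2)[OF lagr_boundary_lists] by blast

text \<open>Carries \<open>lagr\<close> from lists back to functions. One direction will give
  isotropy, the other maximality.\<close>

lemma boundary_colorings_self_orthogonal:
  fixes a :: "nat \<Rightarrow> 'p::prime_card mod_ring"
  assumes "n \<ge> 1"
  shows "a \<in> boundary_colorings \<longleftrightarrow> a \<in> alternating n \<and> (\<forall>b\<in>boundary_colorings. phi n a b = 0)"
proof (intro iffI conjI ballI)
  assume a: "a \<in> boundary_colorings"
  then show "a \<in> alternating n" by (rule boundary_colorings_alternating)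
  then show "phi n a b = 0" if "b \<in> boundary_colorings" for b
    using lagrD(3)[OF lagr_boundary_lists imageI[OF a] imageI[OF that]]
      phi_eq_alt_form[OF assms _ boundary_colorings_alternating[OF that]] by simp
next
  assume a: "a \<in> alternating n \<and> (\<forall>b\<in>boundary_colorings. phi n a b = 0)"
  show "a \<in> boundary_colorings"
  proof (rule boundary_list_mem)
    show "a \<in> {1..2*n} \<rightarrow>\<^sub>E UNIV" using a unfolding alternating_iff_alt by blast
    show "map a [1..<2*n+1] \<in> (\<lambda>a. map a [1..<2*n+1]) ` boundary_colorings"
    proof (rule lagr_mem[OF lagr_boundary_lists])
      show "length (map a [1..<2*n+1]) = 2 * n" by simp
      show "alt (map a [1..<2*n+1]) = 0" using a unfolding alternating_iff_alt by blast
      fix z assume "z \<in> (\<lambda>a. map a [1..<2*n+1]) ` (boundary_colorings :: (nat \<Rightarrow> 'p mod_ring) set)"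
      then obtain b where b: "b \<in> boundary_colorings" "z = map b [1..<2*n+1]" by blast
      have "alt_form (map a [1..<2*n+1]) (map b [1..<2*n+1]) = phi n a b"
        using a boundary_colorings_alternating[OF b(1)] by (intro phi_eq_alt_form[symmetric] assms) auto
      then show "alt_form (map a [1..<2*n+1]) z = 0" using a b by simp
    qed
  qed
qed

lemma boundary_colorings_lin_comb:
  assumes "a \<in> boundary_colorings" "b \<in> boundary_colorings"
  shows "(\<lambda>i\<in>{1..2*n}. r * a i + s * b i) \<in> boundary_colorings"
proof (rule boundary_list_mem)
  show "(\<lambda>i\<in>{1..2*n}. r * a i + s * b i) \<in> {1..2*n} \<rightarrow>\<^sub>E UNIV" by (auto simp: PiE_def)
  show "map (\<lambda>i\<in>{1..2*n}. r * a i + s * b i) [1..<2*n+1] \<in> (\<lambda>a. map a [1..<2*n+1]) ` boundary_colorings"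
    unfolding boundary_list_lin_comb
    by (rule lagr_lin_comb[OF lagr_boundary_lists]) (use assms in blast)+
qed

text \<open>Constants are orthogonal to everything, so self-orthogonality already forces them to be
  boundary colorings.\<close>

lemma const_boundary_colorings:
  assumes "n \<ge> 1"
  shows "(\<lambda>i\<in>{1..2*n}. x) \<in> boundary_colorings"
  unfolding boundary_colorings_self_orthogonal[OF assms]
  using const_alternating phi_const[OF assms boundary_colorings_alternating] by blast

lemma card_boundary_colorings:
  "card (boundary_colorings :: (nat \<Rightarrow> 'p::prime_card mod_ring) set) = CARD('p) ^ n"
proof -
  have "inj_on (\<lambda>a. map a [1..<2*n+1]) (boundary_colorings :: (nat \<Rightarrow> 'p mod_ring) set)"
    by (rule inj_onI) (rule boundary_list_inj[OF boundary_colorings_PiE boundary_colorings_PiE])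
  then have "card (boundary_colorings :: (nat \<Rightarrow> 'p mod_ring) set) =
      card ((\<lambda>a. map a [1..<2*n+1]) ` (boundary_colorings :: (nat \<Rightarrow> 'p mod_ring) set))"
    by (rule card_image[symmetric])
  also have "\<dots> = CARD('p mod_ring) ^ n" using lagr_boundary_lists unfolding lagr_def by blast
  finally show ?thesis by simp
qed

text \<open>Adding a trivial coloring shifts all boundary colors by one constant, so
  \<open>psi\<close> sends a coset into a single class.\<close>

lemma psi_hat_image:
  "psi_hat n T ` carrier (Col_mod_trivial T) =
    boundary_class n ` (boundary_colorings :: (nat \<Rightarrow> 'p::prime_card mod_ring) set)"
proof -
  have carrier: "carrier (Col_mod_trivial T) =
      (\<lambda>c. trivial_colorings T +>\<^bsub>Col T\<^esub> c) ` (colorings T :: (complex set set \<Rightarrow> 'p mod_ring) set)"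
    unfolding Col_mod_trivial_def quotient_space_carrier by (simp add: Col_def)
  have coset: "trivial_colorings T +>\<^bsub>Col T\<^esub> c = range (\<lambda>x. \<lambda>A\<in>arcs T. x + c A)"
    for c :: "complex set set \<Rightarrow> 'p mod_ring"
    by (auto simp: a_r_coset_def' Col_def ring.func_space_def[OF class_ring_ring] trivial_colorings_def
        fun_eq_iff restrict_def image_iff)
  have psi: "psi n T (\<lambda>A\<in>arcs T. x + c A) = (\<lambda>i\<in>{1..2*n}. x + psi n T c i)"
    for x and c :: "complex set set \<Rightarrow> 'p mod_ring"
    using end_edge_edges by (auto simp: psi_def end_arc_eq arcs_def fun_eq_iff restrict_def)
  have "psi_hat n T (trivial_colorings T +>\<^bsub>Col T\<^esub> c) = boundary_class n (psi n T c)"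
    for c :: "complex set set \<Rightarrow> 'p mod_ring"
  proof -
    have "(\<lambda>c. boundary_class n (psi n T c)) ` (trivial_colorings T +>\<^bsub>Col T\<^esub> c) = {boundary_class n (psi n T c)}"
      unfolding coset image_image psi boundary_class_shift by auto
    then show ?thesis by (simp add: psi_hat_def)
  qed
  then show ?thesis
    unfolding carrier boundary_colorings_def image_image by simp
qed

lemma boundary_class_mem:
  assumes n: "n \<ge> 1" and "a \<in> boundary_colorings"
  shows "boundary_class n a \<subseteq> (boundary_colorings :: (nat \<Rightarrow> 'p::prime_card mod_ring) set)"
proof -
  have "(\<lambda>i\<in>{1..2*n}. x + a i) = (\<lambda>i\<in>{1..2*n}. 1 * (\<lambda>i\<in>{1..2*n}. x) i + 1 * a i)" for x
    by (auto simp: restrict_def)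
  then show ?thesis
    unfolding boundary_class_eq
    using boundary_colorings_lin_comb[OF const_boundary_colorings[OF n] assms(2), of 1 _ 1] by auto
qed

lemma boundary_classes_subspace:
  assumes n: "n \<ge> 1"
  shows "subspace Zp (boundary_class n ` (boundary_colorings :: (nat \<Rightarrow> 'p::prime_card mod_ring) set)) (symp_space n)"
proof -
  note VS = alt_space_vectorspace monochromatic_submodule
  note ops = quotient_space_add[OF VS] quotient_space_zero[OF VS] quotient_space_smult[OF VS]
  let ?B = "boundary_colorings :: (nat \<Rightarrow> 'p mod_ring) set"
  let ?W = "boundary_class n ` ?B"
  have "LinearCombinations.submodule Zp ?W (symp_space n)"
    unfolding LinearCombinations.submodule_def
  proof (intro conjI allI impI)
    show "module Zp (symp_space n)" by (rule vectorspace.axioms(1)[OF symp_space_vectorspace])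
    show "?W \<subseteq> carrier (symp_space n)"
      using boundary_colorings_alternating
      by (auto simp: symp_space_def quotient_space_carrier alt_space_simps)
    show "\<zero>\<^bsub>symp_space n\<^esub> \<in> ?W"
      using const_boundary_colorings[OF n, of 0]
      by (auto simp: symp_space_def ops alt_space_simps intro!: imageI)
  next
    fix A B assume "A \<in> ?W" "B \<in> ?W"
    then obtain a b where ab: "a \<in> ?B" "b \<in> ?B" "A = boundary_class n a" "B = boundary_class n b" by blast
    have "A \<oplus>\<^bsub>symp_space n\<^esub> B = boundary_class n (\<lambda>i\<in>{1..2*n}. a i + b i)"
      unfolding symp_space_def ab(3,4)
      using boundary_colorings_alternating ab(1,2) by (subst ops) (simp_all add: alt_space_simps)
    moreover have "(\<lambda>i\<in>{1..2*n}. a i + b i) \<in> ?B"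
      using boundary_colorings_lin_comb[OF ab(1,2), of 1 1] by simp
    ultimately show "A \<oplus>\<^bsub>symp_space n\<^esub> B \<in> ?W" by simp
  next
    fix r :: "'p mod_ring" and A assume "r \<in> carrier Zp" "A \<in> ?W"
    then obtain a where a: "a \<in> ?B" "A = boundary_class n a" by blast
    have "r \<odot>\<^bsub>symp_space n\<^esub> A = boundary_class n (\<lambda>i\<in>{1..2*n}. r * a i)"
      unfolding symp_space_def a(2)
      using boundary_colorings_alternating a(1) by (subst ops) (simp_all add: alt_space_simps)
    moreover have "(\<lambda>i\<in>{1..2*n}. r * a i) \<in> ?B"
      using boundary_colorings_lin_comb[OF a(1) a(1), of r 0] by simp
    ultimately show "r \<odot>\<^bsub>symp_space n\<^esub> A \<in> ?W" by simp
  qed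
  then show ?thesis by (simp add: subspace_def symp_space_vectorspace)
qed

text \<open>The boundary colorings are closed under adding constants, so they are partitioned into
  classes of \<open>CARD('p)\<close> elements each.\<close>

lemma card_boundary_classes:
  assumes n: "n \<ge> 1"
  shows "card (boundary_class n ` (boundary_colorings :: (nat \<Rightarrow> 'p::prime_card mod_ring) set)) = CARD('p) ^ (n - 1)"
proof -
  let ?B = "boundary_colorings :: (nat \<Rightarrow> 'p mod_ring) set"
  let ?W = "boundary_class n ` ?B"
  have self: "a \<in> boundary_class n a" if "a \<in> ?B" for a
  proof -
    have "a = (\<lambda>i\<in>{1..2*n}. 0 + a i)"
      using boundary_colorings_PiE[OF that] by (simp add: PiE_def extensional_restrict)
    then show ?thesis unfolding boundary_class_eq by (rule range_eqI)
  qed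
  have union: "\<Union>?W = ?B" using self boundary_class_mem[OF n] by blast
  have p: "CARD('p) > 0" by (simp add: card_gt_0_iff)
  have fin: "finite ?B" using card_boundary_colorings[where 'p = 'p] p by (auto intro: card_ge_0_finite)
  have "CARD('p) * card ?W = card (\<Union>?W)"
  proof (rule card_partition)
    show "finite ?W" "finite (\<Union>?W)" using fin by (simp_all add: union)
    show "card A = CARD('p)" if W: "A \<in> ?W" for A
    proof -
      obtain a where A: "A = boundary_class n a" using W by blast
      have "inj (\<lambda>x :: 'p mod_ring. \<lambda>i\<in>{1..2*n}. x + a i)"
      proof (rule injI)
        fix x y :: "'p mod_ring"
        assume "(\<lambda>i\<in>{1..2*n}. x + a i) = (\<lambda>i\<in>{1..2*n}. y + a i)"
        \<comment> \<open>Position 1 exists because \<open>n\<close> is at least 1.\<close>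
        from fun_cong[OF this, of 1] show "x = y" using n by simp
      qed
      then show ?thesis unfolding A boundary_class_eq by (simp add: card_image)
    qed
    show "A \<inter> B = {}" if AB: "A \<in> ?W" "B \<in> ?W" "A \<noteq> B" for A B
    proof (rule ccontr)
      assume "A \<inter> B \<noteq> {}"
      moreover obtain a b where ab: "A = boundary_class n a" "B = boundary_class n b" using AB by blast
      ultimately obtain x y where "(\<lambda>i\<in>{1..2*n}. x + a i) = (\<lambda>i\<in>{1..2*n}. y + b i)"
        unfolding boundary_class_eq by blast
      then show False using AB(3) ab boundary_class_shift by metis
    qed
  qed
  then have "CARD('p) * card ?W = CARD('p) * CARD('p) ^ (n - 1)"
    unfolding union card_boundary_colorings using n by (simp flip: power_Suc)
  then show ?thesis using p by simp
qed

text \<open>A class in a larger isotropic subspace pairs to zero with every boundary coloring, so by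
  self-orthogonality it comes from one. The dimension follows by comparing exponents of
  \<open>CARD('p)\<close>.\<close>

lemma boundary_classes_lagrangian:
  assumes n: "n \<ge> 1"
  shows "lagrangian n (boundary_class n ` (boundary_colorings :: (nat \<Rightarrow> 'p::prime_card mod_ring) set))"
  unfolding lagrangian_def
proof (intro conjI allI impI)
  let ?B = "boundary_colorings :: (nat \<Rightarrow> 'p mod_ring) set"
  let ?W = "boundary_class n ` ?B"
  note alternating = boundary_colorings_alternating[where 'a = 'p]
  show "isotropic n ?W"
    unfolding isotropic_def
    using boundary_classes_subspace[OF n] boundary_colorings_self_orthogonal[OF n] alternating
    by (auto simp: phi_hat_boundary_class[OF n])
  show "W' = ?W" if W': "isotropic n W' \<and> ?W \<subseteq> W'" for W'
  proof
    show "W' \<subseteq> ?W"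
    proof
      fix A assume A: "A \<in> W'"
      have "W' \<subseteq> carrier (symp_space n)"
        using W' unfolding isotropic_def subspace_def LinearCombinations.submodule_def by blast
      then obtain a where a: "a \<in> alternating n" "A = boundary_class n a"
        using A by (auto simp: symp_space_def quotient_space_carrier alt_space_simps)
      have "phi n a b = 0" if b: "b \<in> ?B" for b
      proof -
        have "boundary_class n b \<in> W'" using W' b by blast
        then have "phi_hat n A (boundary_class n b) = 0" using W' A unfolding isotropic_def by blast
        then show ?thesis by (simp add: a(2) phi_hat_boundary_class[OF n a(1) alternating[OF b]])
      qed
      then show "A \<in> ?W" using a boundary_colorings_self_orthogonal[OF n] by blast
    qed
  qed (use W' in blast)
  let ?VW = "(symp_space n :: ('p mod_ring, (nat \<Rightarrow> 'p mod_ring) set) module)\<lparr>carrier := ?W\<rparr>"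
  interpret W: vectorspace Zp ?VW
    by (rule vectorspace.subspace_is_vs[OF symp_space_vectorspace boundary_classes_subspace[OF n]])
  have card: "card ?W = CARD('p) ^ (n - 1)" by (rule card_boundary_classes[OF n])
  have p: "CARD('p) > 1" using prime_card[where 'a = 'p] prime_gt_1_nat by blast
  then have "finite ?W" using card by (intro card_ge_0_finite) simp
  then have "CARD('p) ^ (n - 1) = CARD('p) ^ W.dim"
    using W.card_eq_power_dim card by simp
  then show "W.dim = n - 1" using p by (simp add: power_inject_exp)
qed

end

theorem theorem2p4:
  fixes n :: nat and T :: tangle_data
  assumes "n \<ge> 1"
    and "tangle_diagram n T"
  shows "lagrangian n (psi_hat n T `
    carrier (Col_mod_trivial T :: ('p::prime_card mod_ring, (complex set set \<Rightarrow> 'p mod_ring) set) module))"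
proof -
  obtain X Y where "sweep n T X Y" by (rule tangle_sweep[OF assms])
  then interpret sweep n T X Y .
  show ?thesis unfolding psi_hat_image by (rule boundary_classes_lagrangian[OF assms(1)])
qed

end
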